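(* Let $A(0)=0$ (i.e. the operator $A\colon Y\to Y'$ maps $0$ to $0$), and let $(Y^{\delta_i})_{i\in\mathbb N}$ be a sequence of closed non-trivial subspaces of $Y$, each finite dimensional or equal to $Y$, such that $Y^{\delta_i}\subset Y^{\delta_{i+1}}$ for all $i$ and $\overline{\bigcup_{i\in\mathbb N}Y^{\delta_i}}=Y$. Let $\varrho>0$, $(\ell,u_0)\in Y'\times H$, let $u\in X$ be the solution of $\mathrm{d}_tu+Au=\ell$, $\gamma_0u=u_0$, and let $X^\delta\subset X$ be a fixed finite dimensional non-trivial subspace with $u\notin X^\delta$. Then for $i$ sufficiently large, the following holds for every finite dimensional subspace $Y^\delta\subset Y$ with $Y^\delta\supset Y^{\delta_i}\cup X^\delta$: with $(\theta^\delta,u^\delta)\in Y^\delta\times X^\delta$ the solution of $$N^\delta(\theta^\delta,u^\delta)=\big((E_Y^\delta)'\ell,\,-(E_X^\delta)'(\ell+\gamma_0'u_0)\big)$$ and $\theta_\delta:=A^{-1}(\ell-\mathrm{d}_tE_X^\delta u^\delta)\in Y$, one has $$\|\theta_\delta-E_Y^\delta\theta^\delta\|_Y\le\varrho\Big(\|\theta^\delta-u^\delta\|_{Y^\delta}+\tfrac{\sqrt{1+L_A^2}}{m_A}\|u_0-\gamma_0E_X^\delta u^\delta\|_H\Big).$$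
   Context: All linear spaces are over $\mathbb R$. $V\hookrightarrow H\simeq H'\hookrightarrow V'$ is a Gelfand triple of Hilbert spaces, $T>0$, $\Xi:=(0,T)$. Set $Y:=L_2(\Xi;V)$ and $X:=L_2(\Xi;V)\cap H^1(\Xi;V')$. It is known that $X\hookrightarrow C(\overline\Xi;H)$, and $\gamma_t\colon X\to H$ denotes the trace $w\mapsto w(t)$. Define $\mathrm{d}_t\colon X\to Y'$ by $(\mathrm{d}_t w)(v):=\int_\Xi (\tfrac{\mathrm{d}w}{\mathrm{d}t}(t))(v(t))\,\mathrm{d}t$. For a.e. $t\in\Xi$, $A(t)\colon V\to V'$ is a possibly nonlinear operator, and $A\colon Y\to Y'$ is defined by $(Aw)(v):=\int_\Xi (A(t)w(t))(v(t))\,\mathrm{d}t$. It is assumed that $A\colon Y\to Y'$ is Lipschitz continuous, $\|Aw-Av\|_{Y'}\le L_A\|w-v\|_Y$, and strongly monotone, $(Aw-Av)(w-v)\ge m_A\|w-v\|_Y^2$, for all $w,v\in Y$, with constants $L_A,m_A>0$; hence $A$ is invertible. It is known that then for every $(\ell,u_0)\in Y'\times H$ there is a unique $u\in X$ with $\mathrm{d}_tu+Au=\ell$, $\gamma_0u=u_0$. Primes denote duals/adjoints, and functionals in $Y'$ are viewed in $X'$ by restriction. $E_X^\delta\colon X^\delta\to X$ and $E_Y^\delta\colon Y^\delta\to Y$ are the trivial embeddings (so $(E_Y^\delta)'$, $(E_X^\delta)'$ restrict functionals to $Y^\delta$, $X^\delta$). $Y^\delta$ is equipped with $\|\cdot\|_{Y^\delta}:=\|E_Y^\delta\cdot\|_Y$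 and $(Y^\delta)'$ with the dual norm. Set $A_Y^\delta:=(E_Y^\delta)'AE_Y^\delta$, $A_X^\delta:=(E_X^\delta)'AE_X^\delta$, $\mathrm{d}_t^\delta:=(E_Y^\delta)'\mathrm{d}_tE_X^\delta$, $\gamma_t^\delta:=\gamma_tE_X^\delta$, and define $N^\delta\colon Y^\delta\times X^\delta\to(Y^\delta)'\times(X^\delta)'$ by $$N^\delta(\theta,u):=\big(A_Y^\delta\theta+\mathrm{d}_t^\delta u,\ (\mathrm{d}_t^\delta)'\theta-(A_X^\delta u+(\gamma_T^\delta)'\gamma_T^\delta u)\big).$$ This operator is invertible. Note that $\theta_\delta$ (lower index) and $\theta^\delta$ (upper index) denote different objects, and that $\theta^\delta,u^\delta,\theta_\delta$ all depend on $Y^\delta$. *)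

theory Defs
  imports "HOL-Analysis.Analysis"
begin

section \<open>Bochner square-integrable functions on the real line\<close>

text \<open>Strong measurability is stated directly as the a.e. limit of simple functions, so that
  neither the values in \<open>V\<close> nor those in its dual have to lie in a second countable type.\<close>

definition strongly_measurable :: "(real \<Rightarrow> 'a::real_normed_vector) \<Rightarrow> bool" where
  "strongly_measurable f \<longleftrightarrow>
     (\<exists>s. (\<forall>n::nat. simple_function lebesgue (s n)) \<and>
          (AE t in lebesgue. (\<lambda>n. s n t) \<longlonglongrightarrow> f t))"

definition sq_integrable :: "(real \<Rightarrow> 'a::real_normed_vector) \<Rightarrow> bool" where
  "sq_integrable f \<longleftrightarrow>
     strongly_measurable f \<and> integrable lebesgue (\<lambda>t. (norm (f t))\<^sup>2)"

lemma strongly_measurable_zero: "strongly_measurable (\<lambda>t. 0)"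
  unfolding strongly_measurable_def by (rule exI[of _ "\<lambda>n t. 0"]) auto

lemma strongly_measurable_add:
  assumes "strongly_measurable f" "strongly_measurable g"
  shows "strongly_measurable (\<lambda>t. f t + g t)"
proof -
  obtain s where s: "\<And>n::nat. simple_function lebesgue (s n)" "AE t in lebesgue. (\<lambda>n. s n t) \<longlonglongrightarrow> f t"
    using assms(1) unfolding strongly_measurable_def by blast
  obtain r where r: "\<And>n::nat. simple_function lebesgue (r n)" "AE t in lebesgue. (\<lambda>n. r n t) \<longlonglongrightarrow> g t"
    using assms(2) unfolding strongly_measurable_def by blast
  have "AE t in lebesgue. (\<lambda>n. s n t + r n t) \<longlonglongrightarrow> f t + g t"
    using s(2) r(2) by eventually_elim (rule tendsto_add)
  moreover have "simple_function lebesgue (\<lambda>t. s n t + r n t)" for n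
    using simple_function_compose2[OF s(1) r(1), where h = "(+)"] .
  ultimately show ?thesis
    unfolding strongly_measurable_def by (intro exI[of _ "\<lambda>n t. s n t + r n t"]) auto
qed

lemma strongly_measurable_scaleR:
  assumes "strongly_measurable f"
  shows "strongly_measurable (\<lambda>t. c *\<^sub>R f t)"
proof -
  obtain s where s: "\<And>n::nat. simple_function lebesgue (s n)" "AE t in lebesgue. (\<lambda>n. s n t) \<longlonglongrightarrow> f t"
    using assms(1) unfolding strongly_measurable_def by blast
  have "AE t in lebesgue. (\<lambda>n. c *\<^sub>R s n t) \<longlonglongrightarrow> c *\<^sub>R f t"
    using s(2) by eventually_elim (intro tendsto_intros)
  moreover have "simple_function lebesgue (\<lambda>t. c *\<^sub>R s n t)" for n
    using simple_function_compose1[OF s(1), of "scaleR c" n] by simp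
  ultimately show ?thesis
    unfolding strongly_measurable_def by (intro exI[of _ "\<lambda>n t. c *\<^sub>R s n t"]) auto
qed

lemma strongly_measurable_norm:
  assumes "strongly_measurable f"
  shows "(\<lambda>t. norm (f t)) \<in> borel_measurable lebesgue"
proof -
  obtain s where s: "\<And>n::nat. simple_function lebesgue (s n)" "AE t in lebesgue. (\<lambda>n. s n t) \<longlonglongrightarrow> f t"
    using assms(1) unfolding strongly_measurable_def by blast
  have 1: "(\<lambda>t. norm (s n t)) \<in> borel_measurable lebesgue" for n
    using simple_function_compose1[OF s(1), of norm n]
    by (intro borel_measurable_simple_function) simp
  have 2: "(\<lambda>t. lim (\<lambda>n. norm (s n t))) \<in> borel_measurable lebesgue"
    by (rule borel_measurable_lim_metric) (rule 1)
  have "AE t in lebesgue. lim (\<lambda>n. norm (s n t)) = norm (f t)"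
    using s(2) by eventually_elim (intro limI tendsto_norm)
  with 2 show ?thesis by (rule borel_measurable_AE)
qed

lemma sq_integrable_zero: "sq_integrable (\<lambda>t. 0)"
  unfolding sq_integrable_def by (simp add: strongly_measurable_zero)

lemma sq_integrable_scaleR: "sq_integrable f \<Longrightarrow> sq_integrable (\<lambda>t. c *\<^sub>R f t)"
  unfolding sq_integrable_def by (simp add: strongly_measurable_scaleR power_mult_distrib)

lemma sq_integrable_add:
  assumes f: "sq_integrable f" and g: "sq_integrable g"
  shows "sq_integrable (\<lambda>t. f t + g t)"
proof -
  have sm: "strongly_measurable (\<lambda>t. f t + g t)"
    using assms strongly_measurable_add unfolding sq_integrable_def by blast
  have 1: "integrable lebesgue (\<lambda>t. 2 * (norm (f t))\<^sup>2 + 2 * (norm (g t))\<^sup>2)"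
    using f g unfolding sq_integrable_def by simp
  have 2: "(\<lambda>t. (norm (f t + g t))\<^sup>2) \<in> borel_measurable lebesgue"
    using strongly_measurable_norm[OF sm] by simp
  have 3: "(norm (f t + g t))\<^sup>2 \<le> 2 * (norm (f t))\<^sup>2 + 2 * (norm (g t))\<^sup>2" for t
  proof -
    have "(norm (f t + g t))\<^sup>2 \<le> (norm (f t) + norm (g t))\<^sup>2"
      by (intro power_mono norm_triangle_ineq) simp
    also have "\<dots> \<le> 2 * (norm (f t))\<^sup>2 + 2 * (norm (g t))\<^sup>2"
      using sum_squares_bound[of "norm (f t)" "norm (g t)"]
      by (simp add: power2_eq_square algebra_simps)
    finally show ?thesis .
  qed
  have "norm ((norm (f t + g t))\<^sup>2) \<le> norm (2 * (norm (f t))\<^sup>2 + 2 * (norm (g t))\<^sup>2)" for t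
    using 3[of t] by simp
  then have "AE t in lebesgue.
      norm ((norm (f t + g t))\<^sup>2) \<le> norm (2 * (norm (f t))\<^sup>2 + 2 * (norm (g t))\<^sup>2)"
    by (rule AE_I2)
  with 1 2 have "integrable lebesgue (\<lambda>t. (norm (f t + g t))\<^sup>2)"
    by (rule Bochner_Integration.integrable_bound)
  with sm show ?thesis unfolding sq_integrable_def by simp
qed

lemma sq_integrable_uminus: "sq_integrable f \<Longrightarrow> sq_integrable (\<lambda>t. - f t)"
  using sq_integrable_scaleR[of f "-1"] by simp

lemma sq_integrable_diff:
  "sq_integrable f \<Longrightarrow> sq_integrable g \<Longrightarrow> sq_integrable (\<lambda>t. f t - g t)"
  using sq_integrable_add[OF _ sq_integrable_uminus, of f g] by simp

definition L2_norm_fun :: "(real \<Rightarrow> 'a::real_normed_vector) \<Rightarrow> real" where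
  "L2_norm_fun f = sqrt (\<integral>t. (norm (f t))\<^sup>2 \<partial>lebesgue)"

lemma L2_norm_fun_triangle:
  assumes f: "sq_integrable f" and g: "sq_integrable g"
  shows "L2_norm_fun (\<lambda>t. f t + g t) \<le> L2_norm_fun f + L2_norm_fun g"
proof -
  define F where "F t = norm (f t)" for t
  define G where "G t = norm (g t)" for t
  define a where "a = (\<integral>t. (F t)\<^sup>2 \<partial>lebesgue)"
  define b where "b = (\<integral>t. (G t)\<^sup>2 \<partial>lebesgue)"
  have iF: "integrable lebesgue (\<lambda>t. (F t)\<^sup>2)" and iG: "integrable lebesgue (\<lambda>t. (G t)\<^sup>2)"
    using f g unfolding F_def G_def sq_integrable_def by simp_all
  have mF: "F \<in> borel_measurable lebesgue" and mG: "G \<in> borel_measurable lebesgue"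
    unfolding F_def[abs_def] G_def[abs_def]
    using f g unfolding sq_integrable_def by (simp_all add: strongly_measurable_norm)
  have nn: "a \<ge> 0" "b \<ge> 0" unfolding a_def b_def by simp_all
  have young: "2 * (F t * G t) \<le> e * (F t)\<^sup>2 + (G t)\<^sup>2 / e" if "e > 0" for e t
  proof -
    have "0 \<le> (e * F t - G t)\<^sup>2 / e" using that by simp
    also have "\<dots> = e * (F t)\<^sup>2 + (G t)\<^sup>2 / e - 2 * (F t * G t)"
      using that by (simp add: power2_eq_square field_simps)
    finally show ?thesis by simp
  qed
  have iFG: "integrable lebesgue (\<lambda>t. F t * G t)"
  proof (rule Bochner_Integration.integrable_bound[of _ "\<lambda>t. (F t)\<^sup>2 + (G t)\<^sup>2"])
    show "integrable lebesgue (\<lambda>t. (F t)\<^sup>2 + (G t)\<^sup>2)" using iF iG by simp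
    show "(\<lambda>t. F t * G t) \<in> borel_measurable lebesgue" using mF mG by simp
    have nnFG: "0 \<le> F t * G t" for t unfolding F_def G_def by simp
    have "norm (F t * G t) \<le> norm ((F t)\<^sup>2 + (G t)\<^sup>2)" for t
      using young[of 1 t] nnFG[of t] by simp
    then show "AE t in lebesgue. norm (F t * G t) \<le> norm ((F t)\<^sup>2 + (G t)\<^sup>2)" by simp
  qed
  have key: "2 * (\<integral>t. F t * G t \<partial>lebesgue) \<le> e * a + b / e" if "e > 0" for e
  proof -
    have "(\<integral>t. 2 * (F t * G t) \<partial>lebesgue) \<le> (\<integral>t. e * (F t)\<^sup>2 + (G t)\<^sup>2 / e \<partial>lebesgue)"
      using iFG iF iG young[OF that] by (intro integral_mono) auto
    then show ?thesis using iF iG iFG by (simp add: a_def b_def)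
  qed
  have CS: "(\<integral>t. F t * G t \<partial>lebesgue) \<le> sqrt a * sqrt b"
  proof -
    define x where "x = sqrt a"
    define y where "y = sqrt b"
    have x: "x \<ge> 0" "a = x\<^sup>2" and y: "y \<ge> 0" "b = y\<^sup>2" using nn by (auto simp: x_def y_def)
    have "2 * (\<integral>t. F t * G t \<partial>lebesgue) \<le> 2 * (x * y) + d" if "d > 0" for d
    proof -
      define r where "r = d / (2 * (x + y + 1))"
      have pos: "2 * (x + y + 1) > 0" using x y by simp
      have r0: "r > 0" and r2: "r * (2 * (x + y + 1)) \<le> d"
        using that pos unfolding r_def by (auto simp del: distrib_left_numeral)
      have "2 * (\<integral>t. F t * G t \<partial>lebesgue) \<le> (y + r) / (x + r) * x\<^sup>2 + y\<^sup>2 / ((y + r) / (x + r))"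
        using key[of "(y + r) / (x + r)"] r0 x y by (simp add: add_nonneg_pos)
      also have "(y + r) / (x + r) * x\<^sup>2 \<le> (y + r) * x"
      proof -
        have "x * x / (x + r) \<le> x" using x r0 by (simp add: field_simps)
        then have "(y + r) * (x * x / (x + r)) \<le> (y + r) * x"
          using y r0 by (intro mult_left_mono) auto
        then show ?thesis by (simp add: power2_eq_square)
      qed
      also have "y\<^sup>2 / ((y + r) / (x + r)) \<le> (x + r) * y"
      proof -
        have "y * y / (y + r) \<le> y" using y r0 by (simp add: field_simps)
        then have "(x + r) * (y * y / (y + r)) \<le> (x + r) * y"
          using x r0 by (intro mult_left_mono) auto
        then show ?thesis by (simp add: power2_eq_square mult.commute)
      qed
      finally have "2 * (\<integral>t. F t * G t \<partial>lebesgue) \<le> 2 * (x * y) + r * (x + y)"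
        by (simp add: algebra_simps)
      also have "r * (x + y) \<le> r * (2 * (x + y + 1))"
        using x y r0 by (intro mult_left_mono) auto
      finally show ?thesis using r2 by simp
    qed
    then have "2 * (\<integral>t. F t * G t \<partial>lebesgue) \<le> 2 * (x * y)" by (rule field_le_epsilon)
    then show ?thesis by (simp add: x_def y_def)
  qed
  have "(\<integral>t. (norm (f t + g t))\<^sup>2 \<partial>lebesgue) \<le> (\<integral>t. (F t)\<^sup>2 + 2 * (F t * G t) + (G t)\<^sup>2 \<partial>lebesgue)"
  proof (rule integral_mono)
    show "integrable lebesgue (\<lambda>t. (norm (f t + g t))\<^sup>2)"
      using sq_integrable_add[OF f g] unfolding sq_integrable_def by simp
    show "integrable lebesgue (\<lambda>t. (F t)\<^sup>2 + 2 * (F t * G t) + (G t)\<^sup>2)"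
      using iF iG iFG by simp
    fix t
    have "(norm (f t + g t))\<^sup>2 \<le> (F t + G t)\<^sup>2"
      unfolding F_def G_def by (intro power_mono norm_triangle_ineq) simp
    then show "(norm (f t + g t))\<^sup>2 \<le> (F t)\<^sup>2 + 2 * (F t * G t) + (G t)\<^sup>2"
      by (simp add: power2_eq_square algebra_simps)
  qed
  also have "\<dots> = a + 2 * (\<integral>t. F t * G t \<partial>lebesgue) + b"
    using iF iG iFG by (simp add: a_def b_def)
  also have "\<dots> \<le> (sqrt a + sqrt b)\<^sup>2"
    using CS nn by (simp add: power2_eq_square algebra_simps)
  finally have "sqrt (\<integral>t. (norm (f t + g t))\<^sup>2 \<partial>lebesgue) \<le> sqrt ((sqrt a + sqrt b)\<^sup>2)"
    by (rule real_sqrt_le_mono)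
  then show ?thesis using nn by (simp add: L2_norm_fun_def a_def b_def F_def G_def)
qed

definition L2_rel :: "(real \<Rightarrow> 'a::real_normed_vector) \<Rightarrow> (real \<Rightarrow> 'a) \<Rightarrow> bool" where
  "L2_rel f g \<longleftrightarrow> sq_integrable f \<and> sq_integrable g \<and> (AE t in lebesgue. f t = g t)"

lemma part_equivp_L2_rel: "part_equivp L2_rel"
proof (rule part_equivpI)
  show "\<exists>f. L2_rel f f"
    by (rule exI[of _ "\<lambda>t. 0"]) (simp add: L2_rel_def sq_integrable_zero)
  show "symp L2_rel" unfolding symp_def L2_rel_def by (auto simp: eq_commute)
  show "transp L2_rel"
  proof (rule transpI)
    fix f g h
    assume "L2_rel f g" "L2_rel g h"
    moreover from this have "AE t in lebesgue. f t = h t"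
      unfolding L2_rel_def by (auto elim: eventually_elim2)
    ultimately show "L2_rel f h" unfolding L2_rel_def by blast
  qed
qed

text \<open>The type \<open>'a L2\<close> is the Bochner space \<open>L\<^sub>2(\<real>;'a)\<close>; \<open>rep_L2 w\<close> is a
  representative of the class \<open>w\<close>.\<close>

quotient_type (overloaded) 'a L2 = "real \<Rightarrow> 'a::real_normed_vector" / partial: L2_rel
  by (rule part_equivp_L2_rel)

instantiation L2 :: (real_normed_vector) real_normed_vector
begin

lift_definition zero_L2 :: "'a L2" is "\<lambda>t. 0"
  by (simp add: L2_rel_def sq_integrable_zero)

lift_definition plus_L2 :: "'a L2 \<Rightarrow> 'a L2 \<Rightarrow> 'a L2" is "\<lambda>f g t. f t + g t"
  unfolding L2_rel_def by (auto intro: sq_integrable_add elim: eventually_elim2)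

lift_definition uminus_L2 :: "'a L2 \<Rightarrow> 'a L2" is "\<lambda>f t. - f t"
  unfolding L2_rel_def by (auto intro: sq_integrable_uminus)

lift_definition minus_L2 :: "'a L2 \<Rightarrow> 'a L2 \<Rightarrow> 'a L2" is "\<lambda>f g t. f t - g t"
  unfolding L2_rel_def by (auto intro: sq_integrable_diff elim: eventually_elim2)

lift_definition scaleR_L2 :: "real \<Rightarrow> 'a L2 \<Rightarrow> 'a L2" is "\<lambda>c f t. c *\<^sub>R f t"
  unfolding L2_rel_def by (auto intro: sq_integrable_scaleR)

lift_definition norm_L2 :: "'a L2 \<Rightarrow> real" is L2_norm_fun
proof -
  fix f g :: "real \<Rightarrow> 'a"
  assume fg: "L2_rel f g"
  have "(\<integral>t. (norm (f t))\<^sup>2 \<partial>lebesgue) = (\<integral>t. (norm (g t))\<^sup>2 \<partial>lebesgue)"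
    using fg unfolding L2_rel_def sq_integrable_def
    by (intro integral_cong_AE) (auto elim: eventually_mono)
  then show "L2_norm_fun f = L2_norm_fun g" unfolding L2_norm_fun_def by simp
qed

definition dist_L2 :: "'a L2 \<Rightarrow> 'a L2 \<Rightarrow> real" where
  "dist_L2 f g = norm (f - g)"

definition sgn_L2 :: "'a L2 \<Rightarrow> 'a L2" where
  "sgn_L2 f = scaleR (inverse (norm f)) f"

definition uniformity_L2 :: "('a L2 \<times> 'a L2) filter" where
  "uniformity_L2 = (INF e\<in>{0 <..}. principal {(x, y). dist x y < e})"

definition open_L2 :: "'a L2 set \<Rightarrow> bool" where
  "open_L2 U = (\<forall>x\<in>U. \<forall>\<^sub>F (x', y) in uniformity. x' = x \<longrightarrow> y \<in> U)"

instance
proof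
  fix f g h :: "'a L2" and c d :: real
  note [simp] = L2_rel_def sq_integrable_zero sq_integrable_add sq_integrable_diff
    sq_integrable_uminus sq_integrable_scaleR
  show "f + g + h = f + (g + h)" by transfer (simp add: add.assoc)
  show "f + g = g + f" by transfer (simp add: add.commute)
  show "0 + f = f" by transfer simp
  show "- f + f = 0" by transfer simp
  show "f - g = f + - g" by transfer simp
  show "c *\<^sub>R (f + g) = c *\<^sub>R f + c *\<^sub>R g" by transfer (simp add: scaleR_add_right)
  show "(c + d) *\<^sub>R f = c *\<^sub>R f + d *\<^sub>R f" by transfer (simp add: scaleR_add_left)
  show "c *\<^sub>R d *\<^sub>R f = (c * d) *\<^sub>R f" by transfer simp
  show "1 *\<^sub>R f = f" by transfer simp
  show "dist f g = norm (f - g)" by (rule dist_L2_def)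
  show "sgn f = scaleR (inverse (norm f)) f" by (rule sgn_L2_def)
  show "uniformity = (INF e\<in>{0 <..}. principal {(x, y). dist x (y::'a L2) < e})"
    by (rule uniformity_L2_def)
  show "open U = (\<forall>x\<in>U. \<forall>\<^sub>F (x', y) in uniformity. x' = x \<longrightarrow> y \<in> U)" for U :: "'a L2 set"
    by (rule open_L2_def)
  show "norm (c *\<^sub>R f) = \<bar>c\<bar> * norm f"
    by transfer (simp add: L2_norm_fun_def power_mult_distrib real_sqrt_mult)
  show "norm (f + g) \<le> norm f + norm g"
    by transfer (simp add: L2_norm_fun_triangle)
  show "norm f = 0 \<longleftrightarrow> f = 0"
  proof transfer
    fix f :: "real \<Rightarrow> 'a"
    assume "L2_rel f f"
    then have f: "sq_integrable f" by simp
    then have "(\<integral>t. (norm (f t))\<^sup>2 \<partial>lebesgue) = 0 \<longleftrightarrow> (AE t in lebesgue. (norm (f t))\<^sup>2 = 0)"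
      unfolding sq_integrable_def by (intro integral_nonneg_eq_0_iff_AE) auto
    then show "L2_norm_fun f = 0 \<longleftrightarrow> L2_rel f (\<lambda>t. 0)"
      using f by (simp add: L2_norm_fun_def)
  qed
qed

end

text \<open>\<open>L\<^sub>2(S;'a)\<close>, identified via extension by zero with a closed subspace of
  \<open>L\<^sub>2(\<real>;'a)\<close>; the norm of the type \<open>'a L2\<close> restricts to the norm of
  \<open>L\<^sub>2(S;'a)\<close>.\<close>

definition L2_on :: "real set \<Rightarrow> 'a::real_normed_vector L2 set" where
  "L2_on S = {w. AE t in lebesgue. t \<notin> S \<longrightarrow> rep_L2 w t = 0}"


section \<open>Subspaces and their duals\<close>

definition finite_dimensional :: "'a::real_vector set \<Rightarrow> bool" where
  "finite_dimensional S \<longleftrightarrow> (\<exists>B. finite B \<and> S = span B)"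

text \<open>The dual of a subspace \<open>S\<close> of a normed space. Only the values on \<open>S\<close> matter:
  two functionals agree in the dual of \<open>S\<close> iff their restrictions \<open>restrict f S\<close>
  coincide, and for a subspace \<open>S'\<close> of \<open>S\<close> with embedding \<open>E\<close>, the adjoint \<open>E'\<close> is
  \<open>\<lambda>f. restrict f S'\<close>.\<close>

definition dual :: "'a::real_normed_vector set \<Rightarrow> ('a \<Rightarrow> real) set" where
  "dual S = {f. (\<forall>x\<in>S. \<forall>y\<in>S. f (x + y) = f x + f y) \<and>
                (\<forall>c. \<forall>x\<in>S. f (c *\<^sub>R x) = c * f x) \<and>
                (\<exists>K. \<forall>x\<in>S. \<bar>f x\<bar> \<le> K * norm x)}"

definition dual_norm :: "'a::real_normed_vector set \<Rightarrow> ('a \<Rightarrow> real) \<Rightarrow> real" where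
  "dual_norm S f = (SUP x\<in>{x \<in> S. norm x \<le> 1}. \<bar>f x\<bar>)"


section \<open>The parabolic setting\<close>

text \<open>\<open>j\<close> is the embedding \<open>V \<hookrightarrow> H\<close>. The dual \<open>V'\<close> is the type
  \<open>'v \<Rightarrow>\<^sub>L real\<close> with the operator norm, and \<open>h \<in> H\<close> acts on \<open>V\<close> as
  \<open>\<lambda>v. h \<bullet> j v\<close>.\<close>

definition gelfand_triple ::
    "('v::{real_inner,complete_space} \<Rightarrow> 'h::{real_inner,complete_space}) \<Rightarrow> bool" where
  "gelfand_triple j \<longleftrightarrow> bounded_linear j \<and> inj j \<and> closure (range j) = UNIV"

definition Y_space :: "real \<Rightarrow> 'v::real_normed_vector L2 set" where
  "Y_space T = L2_on {0<..<T}"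

definition test_function :: "real \<Rightarrow> (real \<Rightarrow> real) \<Rightarrow> bool" where
  "test_function T \<phi> \<longleftrightarrow>
     (\<forall>n x. ((deriv ^^ n) \<phi>) differentiable (at x)) \<and>
     (\<exists>a b. 0 < a \<and> b < T \<and> (\<forall>x. x \<notin> {a..b} \<longrightarrow> \<phi> x = 0))"

text \<open>\<open>g \<in> L\<^sub>2(\<Xi>;V')\<close> is the distributional derivative of \<open>w\<close>, the latter viewed as
  a \<open>V'\<close>-valued function. The defining identity between elements of \<open>V'\<close> is written out
  on each \<open>v \<in> V\<close>.\<close>

definition has_weak_derivative ::
    "real \<Rightarrow> ('v::real_inner \<Rightarrow> 'h::real_inner) \<Rightarrow> 'v L2 \<Rightarrow> ('v \<Rightarrow>\<^sub>L real) L2 \<Rightarrow> bool" where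
  "has_weak_derivative T j w g \<longleftrightarrow> g \<in> L2_on {0<..<T} \<and>
     (\<forall>\<phi> v. test_function T \<phi> \<longrightarrow>
       (LINT t:{0<..<T}|lebesgue. deriv \<phi> t * (j (rep_L2 w t) \<bullet> j v)) =
       - (LINT t:{0<..<T}|lebesgue. \<phi> t * blinfun_apply (rep_L2 g t) v))"

definition X_space :: "real \<Rightarrow> ('v::real_inner \<Rightarrow> 'h::real_inner) \<Rightarrow> 'v L2 set" where
  "X_space T j = {w \<in> Y_space T. \<exists>g. has_weak_derivative T j w g}"

definition weak_derivative ::
    "real \<Rightarrow> ('v::real_inner \<Rightarrow> 'h::real_inner) \<Rightarrow> 'v L2 \<Rightarrow> ('v \<Rightarrow>\<^sub>L real) L2" where
  "weak_derivative T j w = (THE g. has_weak_derivative T j w g)"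

definition d_t :: "real \<Rightarrow> ('v::real_inner \<Rightarrow> 'h::real_inner) \<Rightarrow> 'v L2 \<Rightarrow> 'v L2 \<Rightarrow> real" where
  "d_t T j w v =
     (LINT t:{0<..<T}|lebesgue. blinfun_apply (rep_L2 (weak_derivative T j w) t) (rep_L2 v t))"

text \<open>\<open>time_trace T j t w\<close> is \<open>\<gamma>\<^sub>t w\<close>, the value at \<open>t \<in> [0,T]\<close> of the representative of
  \<open>w \<in> X\<close> in \<open>C([0,T];H)\<close>.\<close>

definition time_trace ::
    "real \<Rightarrow> ('v::real_inner \<Rightarrow> 'h::real_inner) \<Rightarrow> real \<Rightarrow> 'v L2 \<Rightarrow> 'h" where
  "time_trace T j t w = (THE h. \<exists>c. continuous_on {0..T} c \<and>
     (AE s in lebesgue. s \<in> {0<..<T} \<longrightarrow> c s = j (rep_L2 w s)) \<and> c t = h)"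

text \<open>The operator \<open>A : Y \<rightarrow> Y'\<close> induced by the family \<open>A(t) : V \<rightarrow> V'\<close>.\<close>

definition induced_op ::
    "real \<Rightarrow> (real \<Rightarrow> 'v::real_normed_vector \<Rightarrow> 'v \<Rightarrow>\<^sub>L real) \<Rightarrow> 'v L2 \<Rightarrow> 'v L2 \<Rightarrow> real" where
  "induced_op T A w v =
     (LINT t:{0<..<T}|lebesgue. blinfun_apply (A t (rep_L2 w t)) (rep_L2 v t))"

definition maps_Y_to_dual ::
    "real \<Rightarrow> (real \<Rightarrow> 'v::real_normed_vector \<Rightarrow> 'v \<Rightarrow>\<^sub>L real) \<Rightarrow> bool" where
  "maps_Y_to_dual T A \<longleftrightarrow>
     (\<forall>w\<in>Y_space T. \<forall>v\<in>Y_space T.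
        set_integrable lebesgue {0<..<T} (\<lambda>t. blinfun_apply (A t (rep_L2 w t)) (rep_L2 v t))) \<and>
     (\<forall>w\<in>Y_space T. induced_op T A w \<in> dual (Y_space T))"

definition lipschitz_op ::
    "real \<Rightarrow> (real \<Rightarrow> 'v::real_normed_vector \<Rightarrow> 'v \<Rightarrow>\<^sub>L real) \<Rightarrow> real \<Rightarrow> bool" where
  "lipschitz_op T A L \<longleftrightarrow>
     (\<forall>w\<in>Y_space T. \<forall>v\<in>Y_space T.
        dual_norm (Y_space T) (\<lambda>z. induced_op T A w z - induced_op T A v z) \<le> L * norm (w - v))"

definition strongly_monotone_op ::
    "real \<Rightarrow> (real \<Rightarrow> 'v::real_normed_vector \<Rightarrow> 'v \<Rightarrow>\<^sub>L real) \<Rightarrow> real \<Rightarrow> bool" where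
  "strongly_monotone_op T A m \<longleftrightarrow>
     (\<forall>w\<in>Y_space T. \<forall>v\<in>Y_space T.
        induced_op T A w (w - v) - induced_op T A v (w - v) \<ge> m * (norm (w - v))\<^sup>2)"

definition solves ::
    "real \<Rightarrow> ('v::real_inner \<Rightarrow> 'h::real_inner) \<Rightarrow> (real \<Rightarrow> 'v \<Rightarrow> 'v \<Rightarrow>\<^sub>L real) \<Rightarrow>
     ('v L2 \<Rightarrow> real) \<Rightarrow> 'h \<Rightarrow> 'v L2 \<Rightarrow> bool" where
  "solves T j A l u\<^sub>0 u \<longleftrightarrow> u \<in> X_space T j \<and>
     (\<forall>v\<in>Y_space T. d_t T j u v + induced_op T A u v = l v) \<and>
     time_trace T j 0 u = u\<^sub>0"

text \<open>The operator \<open>N\<^sup>\<delta>\<close> for trial spaces \<open>Yd\<close>, \<open>Xd\<close>. The adjoint of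
  \<open>d_t\<close> sends \<open>\<theta>\<close> to \<open>\<lambda>w. d_t T j w \<theta>\<close>, and, with \<open>H \<simeq> H'\<close>, the adjoint of
  \<open>\<gamma>\<^sub>t\<close> sends \<open>h\<close> to \<open>\<lambda>w. h \<bullet> time_trace T j t w\<close>.\<close>

definition N_op ::
    "real \<Rightarrow> ('v::real_inner \<Rightarrow> 'h::real_inner) \<Rightarrow> (real \<Rightarrow> 'v \<Rightarrow> 'v \<Rightarrow>\<^sub>L real) \<Rightarrow>
     'v L2 set \<Rightarrow> 'v L2 set \<Rightarrow> 'v L2 \<times> 'v L2 \<Rightarrow> ('v L2 \<Rightarrow> real) \<times> ('v L2 \<Rightarrow> real)" where
  "N_op T j A Yd Xd = (\<lambda>(\<theta>, u).
     (restrict (\<lambda>v. induced_op T A \<theta> v + d_t T j u v) Yd,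
      restrict (\<lambda>w. d_t T j w \<theta> -
        (induced_op T A u w + time_trace T j T u \<bullet> time_trace T j T w)) Xd))"

end

theory Submission
  imports Defs
begin

text \<open>Suppose that the inequality fails for arbitrarily large \<open>i\<close>. This gives a sequence of discrete
  solutions \<open>(\<theta>\<^sub>n, u\<^sub>n)\<close> over test spaces \<open>Y\<^sub>n \<supseteq> Ys n \<union> Xd\<close>, with \<open>\<eta>\<^sub>n = A\<inverse>(l - d_t u\<^sub>n)\<close>, for each of
  which the inequality is violated. Testing the two equations with \<open>\<theta>\<^sub>n\<close> and \<open>u\<^sub>n\<close> cancels the coupling
  terms; since \<open>A 0 = 0\<close>, what remains is coercive and bounds \<open>u\<^sub>n\<close> (\<open>a_priori_bound\<close>). As \<open>Xd\<close> is
  finite dimensional, a subsequence of \<open>u\<^sub>n\<close> converges to some \<open>z \<in> Xd\<close>. Now \<open>\<theta>\<^sub>n\<close> is the Galerkin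
  approximation of \<open>\<eta>\<^sub>n\<close> in \<open>Y\<^sub>n\<close>, hence quasi-optimal, and \<open>\<eta>\<^sub>n\<close> is a Cauchy sequence because \<open>u\<^sub>n\<close> is;
  so \<open>\<parallel>\<eta>\<^sub>n - \<theta>\<^sub>n\<parallel>\<close> tends to zero (\<open>discrete_solution_error_tendsto_0\<close>). By the violated inequality
  \<open>\<parallel>\<theta>\<^sub>n - u\<^sub>n\<parallel>\<close> and \<open>\<parallel>u\<^sub>0 - \<gamma>\<^sub>0 u\<^sub>n\<parallel>\<close> tend to zero as well. In the limit \<open>A z = l - d_t z\<close> and
  \<open>\<gamma>\<^sub>0 z = u\<^sub>0\<close>, so that \<open>z\<close> is the exact solution, which does not lie in \<open>Xd\<close>
  (\<open>eventually_error_small\<close>).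

  This argument uses four facts on the space \<open>X\<close>: weak derivatives are unique, so that \<open>d_t\<close> is
  linear; continuous representatives with values in \<open>H\<close> exist, so that the trace is defined and
  linear; \<open>2 d_t w w = \<parallel>w T\<parallel>\<^sup>2 - \<parallel>w 0\<parallel>\<^sup>2\<close>; and, as a consequence of this identity, the exact solution
  is unique (\<open>solution_unique\<close>). They are proved as follows.

  Bump functions yield the fundamental lemma of the calculus of variations and the du Bois-Reymond
  lemma. With them, the weak derivative \<open>g\<close> of \<open>w\<close> satisfies, off a null set,
  \<open>(j (w t) - j (w s)) \<bullet> j (w r) = \<integral>\<^sub>s\<^sup>t g(x)(w r) dx\<close> (\<open>ex_increment_set\<close>). Choosing \<open>r = s\<close> and \<open>r = t\<close>
  shows that the increment of \<open>\<parallel>j w\<parallel>\<^sup>2\<close> over \<open>(t, t + h)\<close> differs from that of the primitive of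
  \<open>2 g w\<close> by an integral of \<open>g\<close> paired with translation differences of \<open>w\<close>. Its mean over \<open>t\<close> is \<open>o(h)\<close>,
  because translations are continuous in \<open>L\<^sub>2\<close>; hence the difference of the two functions has weak
  derivative zero and is constant (\<open>energy_primitive\<close>). The same identity for \<open>w - w s\<close> bounds
  \<open>\<parallel>j (w t) - j (w s)\<parallel>\<^sup>2\<close> by integrals over \<open>(s, t)\<close> and makes \<open>j w\<close> uniformly continuous off a null
  set, so that it extends continuously to \<open>[0, T]\<close> (\<open>continuous_representative\<close>).\<close>

section \<open>Smooth functions and bump functions\<close>

lemma DERIV_differentiable: "DERIV f x :> D \<Longrightarrow> f differentiable (at (x::real))"
  using real_differentiable_def by blast

definition smooth :: "(real \<Rightarrow> real) \<Rightarrow> bool" where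
  "smooth f \<longleftrightarrow> (\<forall>n x. (deriv ^^ n) f differentiable (at x))"

text \<open>Products and compositions do not allow a direct induction on the iterated derivative, but on
  this finite-order version of smoothness they do: the derivative of \<open>f g\<close> is a sum of products of
  functions that are differentiable one time less.\<close>

definition diff_upto :: "nat \<Rightarrow> (real \<Rightarrow> real) \<Rightarrow> bool" where
  "diff_upto n f \<longleftrightarrow> (\<forall>k\<le>n. \<forall>x. (deriv ^^ k) f differentiable (at x))"

lemma smooth_iff_diff_upto: "smooth f \<longleftrightarrow> (\<forall>n. diff_upto n f)"
  unfolding smooth_def diff_upto_def by auto

lemma diff_upto_0: "diff_upto 0 f \<longleftrightarrow> (\<forall>x. f differentiable (at x))"
  unfolding diff_upto_def by simp

lemma diff_upto_Suc:
  "diff_upto (Suc n) f \<longleftrightarrow> (\<forall>x. f differentiable (at x)) \<and> diff_upto n (deriv f)"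
proof
  assume f: "diff_upto (Suc n) f"
  have "(deriv ^^ k) (deriv f) differentiable (at x)" if "k \<le> n" for k x
    using f that unfolding diff_upto_def
    by (metis Suc_le_mono comp_apply funpow_Suc_right)
  moreover have "f differentiable (at x)" for x
    using f unfolding diff_upto_def by (metis funpow_0 le0)
  ultimately show "(\<forall>x. f differentiable (at x)) \<and> diff_upto n (deriv f)"
    unfolding diff_upto_def by blast
next
  assume f: "(\<forall>x. f differentiable (at x)) \<and> diff_upto n (deriv f)"
  have "(deriv ^^ k) f differentiable (at x)" if "k \<le> Suc n" for k x
  proof (cases k)
    case (Suc m)
    then show ?thesis using f that unfolding diff_upto_def
      by (metis Suc_le_mono comp_apply funpow_Suc_right)
  qed (use f in simp)
  then show "diff_upto (Suc n) f" unfolding diff_upto_def by blast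
qed

lemma diff_upto_mono: "diff_upto n f \<Longrightarrow> m \<le> n \<Longrightarrow> diff_upto m f"
  unfolding diff_upto_def by auto

lemma differentiable_DERIV: "f differentiable (at x) \<Longrightarrow> DERIV f x :> deriv f (x::real)"
  using DERIV_deriv_iff_real_differentiable by blast

lemma diff_upto_add: "diff_upto n f \<Longrightarrow> diff_upto n g \<Longrightarrow> diff_upto n (\<lambda>x. f x + g x)"
proof (induction n arbitrary: f g)
  case (Suc n)
  have "deriv (\<lambda>x. f x + g x) = (\<lambda>x. deriv f x + deriv g x)"
  proof
    fix x
    show "deriv (\<lambda>x. f x + g x) x = deriv f x + deriv g x"
      using Suc.prems by (intro DERIV_imp_deriv DERIV_add differentiable_DERIV) (auto simp: diff_upto_Suc)
  qed
  with Suc show ?case by (auto simp: diff_upto_Suc)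
qed (auto simp: diff_upto_0)

lemma diff_upto_mult: "diff_upto n f \<Longrightarrow> diff_upto n g \<Longrightarrow> diff_upto n (\<lambda>x. f x * g x)"
proof (induction n arbitrary: f g)
  case (Suc n)
  have "deriv (\<lambda>x. f x * g x) = (\<lambda>x. deriv f x * g x + deriv g x * f x)"
  proof
    fix x
    show "deriv (\<lambda>x. f x * g x) x = deriv f x * g x + deriv g x * f x"
      using Suc.prems by (intro DERIV_imp_deriv DERIV_mult differentiable_DERIV) (auto simp: diff_upto_Suc)
  qed
  moreover have "diff_upto n f" "diff_upto n g" using Suc.prems diff_upto_mono by auto
  ultimately show ?case using Suc by (auto simp: diff_upto_Suc intro!: diff_upto_add)
qed (auto simp: diff_upto_0)

lemma diff_upto_const: "diff_upto n (\<lambda>x. c)"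
proof (induction n arbitrary: c)
  case (Suc n)
  have "deriv (\<lambda>x::real. c) = (\<lambda>x. 0)" by auto
  with Suc show ?case by (auto simp: diff_upto_Suc)
qed (auto simp: diff_upto_0)

lemma diff_upto_affine: "diff_upto n f \<Longrightarrow> diff_upto n (\<lambda>x. f (c * x + d))"
proof (induction n arbitrary: f)
  case 0
  have "(\<lambda>x. f (c * x + d)) differentiable (at x)" for x
  proof -
    have "DERIV f (c * x + d) :> deriv f (c * x + d)"
      using 0 by (intro differentiable_DERIV) (auto simp: diff_upto_0)
    then have "DERIV (\<lambda>x. f (c * x + d)) x :> deriv f (c * x + d) * c"
      by (rule DERIV_chain2) (auto intro!: derivative_eq_intros)
    then show ?thesis using DERIV_differentiable by blast
  qed
  then show ?case by (auto simp: diff_upto_0)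
next
  case (Suc n)
  have D: "DERIV (\<lambda>x. f (c * x + d)) x :> c * deriv f (c * x + d)" for x
  proof -
    have "DERIV f (c * x + d) :> deriv f (c * x + d)"
      using Suc.prems by (intro differentiable_DERIV) (auto simp: diff_upto_Suc)
    then have "DERIV (\<lambda>x. f (c * x + d)) x :> deriv f (c * x + d) * c"
      by (rule DERIV_chain2) (auto intro!: derivative_eq_intros)
    then show ?thesis by (simp add: mult.commute)
  qed
  then have "deriv (\<lambda>x. f (c * x + d)) = (\<lambda>x. c * deriv f (c * x + d))"
    using DERIV_imp_deriv by blast
  moreover have "diff_upto n (\<lambda>x. c * deriv f (c * x + d))"
    using Suc by (auto simp: diff_upto_Suc intro!: diff_upto_mult diff_upto_const)
  ultimately show ?case using D by (auto simp: diff_upto_Suc intro: DERIV_differentiable)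
qed

lemma smooth_add: "smooth f \<Longrightarrow> smooth g \<Longrightarrow> smooth (\<lambda>x. f x + g x)"
  by (simp add: smooth_iff_diff_upto diff_upto_add)

lemma smooth_mult: "smooth f \<Longrightarrow> smooth g \<Longrightarrow> smooth (\<lambda>x. f x * g x)"
  by (simp add: smooth_iff_diff_upto diff_upto_mult)

lemma smooth_const: "smooth (\<lambda>x. c)"
  by (simp add: smooth_iff_diff_upto diff_upto_const)

lemma smooth_affine: "smooth f \<Longrightarrow> smooth (\<lambda>x. f (c * x + d))"
  by (simp add: smooth_iff_diff_upto diff_upto_affine)

lemma smooth_has_deriv: "smooth f \<Longrightarrow> DERIV f x :> deriv f x"
  unfolding smooth_def using differentiable_DERIV[of f x] by (metis funpow_0)

lemma smooth_deriv: "smooth f \<Longrightarrow> smooth (deriv f)"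
  unfolding smooth_def by (metis comp_apply funpow_Suc_right)

lemma smooth_continuous: "smooth f \<Longrightarrow> continuous_on S f"
  using smooth_has_deriv by (meson DERIV_isCont continuous_at_imp_continuous_on)

lemma smooth_primitive:
  assumes "smooth f" "\<And>x. DERIV F x :> f x"
  shows "smooth F"
proof -
  have "deriv F = f" using assms(2) DERIV_imp_deriv by blast
  moreover have "F differentiable (at x)" for x
    using assms(2) DERIV_differentiable by blast
  ultimately have "diff_upto n F" for n
    using assms(1)
    by (cases n) (auto simp: diff_upto_0 diff_upto_Suc smooth_iff_diff_upto)
  then show ?thesis by (simp add: smooth_iff_diff_upto)
qed

lemma smooth_coinduct:
  assumes "f \<in> S" "\<And>f x. f \<in> S \<Longrightarrow> f differentiable (at x)" "\<And>f. f \<in> S \<Longrightarrow> deriv f \<in> S"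
  shows "smooth f"
proof -
  have "(deriv ^^ n) f \<in> S" for n by (induction n) (use assms in auto)
  then show ?thesis unfolding smooth_def using assms(2) by blast
qed

text \<open>The functions \<open>p(1/x) exp(-1/x)\<close>, extended by zero to \<open>x \<le> 0\<close>, with \<open>p\<close> a polynomial, are
  stable under differentiation, because \<open>exp(-1/x)\<close> beats every power of \<open>1/x\<close> at \<open>0\<close>.\<close>

definition flat :: "real poly \<Rightarrow> real \<Rightarrow> real" where
  "flat p x = (if x > 0 then poly p (1 / x) * exp (- (1 / x)) else 0)"

lemma poly_exp_tendsto_0: "((\<lambda>y. poly p y * exp (- y)) \<longlongrightarrow> (0::real)) at_top"
proof (induction p)
  case (pCons a p)
  have "((\<lambda>y. poly p y * exp (- y) * y) \<longlongrightarrow> 0) at_top"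
  proof -
    have "((\<lambda>y. poly q y * exp (- y)) \<longlongrightarrow> (0::real)) at_top" for q
    proof -
      have "((\<lambda>y. \<Sum>i\<le>degree q. coeff q i * (y ^ i / exp y)) \<longlongrightarrow> (\<Sum>i\<le>degree q. coeff q i * 0)) at_top"
        by (intro tendsto_intros tendsto_power_div_exp_0)
      then show ?thesis
        by (simp add: poly_altdef sum_distrib_right exp_minus divide_inverse mult.assoc)
    qed
    from this[of "p * [:0, 1:]"] show ?thesis by (simp add: algebra_simps)
  qed
  moreover have "((\<lambda>y. a * exp (- y)) \<longlongrightarrow> a * 0) at_top"
    by (intro tendsto_intros filterlim_compose[OF exp_at_bot] filterlim_uminus_at_bot_at_top)
  ultimately have "((\<lambda>y. a * exp (- y) + poly p y * exp (- y) * y) \<longlongrightarrow> a * 0 + 0) at_top"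
    by (intro tendsto_add)
  then show ?case by (simp add: algebra_simps)
qed simp

lemma flat_has_deriv: "DERIV (flat p) x :> flat ([:0, 0, 1:] * (p - pderiv p)) x"
proof -
  consider "x > 0" | "x < 0" | "x = 0" by linarith
  then show ?thesis
  proof cases
    case 1
    have "DERIV (\<lambda>x. poly p (1 / x) * exp (- (1 / x))) x :> flat ([:0, 0, 1:] * (p - pderiv p)) x"
      using 1 unfolding flat_def
      by (auto intro!: derivative_eq_intros simp: field_simps power2_eq_square)
    then show ?thesis
    proof (rule has_field_derivative_transform_within_open[where S = "{0<..}"])
      fix y :: real assume "y \<in> {0<..}"
      then show "poly p (1 / y) * exp (- (1 / y)) = flat p y" by (simp add: flat_def)
    qed (use 1 in auto)
  next
    case 2
    have "DERIV (\<lambda>x. 0) x :> flat ([:0, 0, 1:] * (p - pderiv p)) x"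
      using 2 by (simp add: flat_def)
    then show ?thesis
    proof (rule has_field_derivative_transform_within_open[where S = "{..<0}"])
      fix y :: real assume "y \<in> {..<0}"
      then show "0 = flat p y" by (simp add: flat_def)
    qed (use 2 in auto)
  next
    case 3
    have R: "((\<lambda>y. (flat p y - flat p 0) / (y - 0)) \<longlongrightarrow> 0) (at_right 0)"
    proof (rule Lim_transform_eventually)
      show "((\<lambda>y. poly (p * [:0, 1:]) (inverse y) * exp (- inverse y)) \<longlongrightarrow> (0::real)) (at_right 0)"
        by (rule filterlim_compose[OF poly_exp_tendsto_0 filterlim_inverse_at_top_right])
      show "\<forall>\<^sub>F y in at_right 0. poly (p * [:0, 1:]) (inverse y) * exp (- inverse y)
          = (flat p y - flat p 0) / (y - 0)"
        by (rule eventually_at_rightI[of 0 1]) (auto simp: flat_def field_simps)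
    qed
    have L: "((\<lambda>y. (flat p y - flat p 0) / (y - 0)) \<longlongrightarrow> 0) (at_left 0)"
    proof (rule Lim_transform_eventually)
      show "\<forall>\<^sub>F y in at_left 0. (0::real) = (flat p y - flat p 0) / (y - 0)"
        by (rule eventually_at_leftI[of "-1" 0]) (auto simp: flat_def)
    qed simp
    have "((\<lambda>y. (flat p y - flat p 0) / (y - 0)) \<longlongrightarrow> 0) (at 0)"
      using L R by (rule filterlim_split_at)
    then show ?thesis using 3 by (simp add: has_field_derivative_iff flat_def)
  qed
qed

lemma smooth_flat: "smooth (flat p)"
proof (rule smooth_coinduct[where S = "range flat"])
  show "f differentiable (at x)" if "f \<in> range flat" for f x
    using that flat_has_deriv by (auto intro: DERIV_differentiable)
  show "deriv f \<in> range flat" if "f \<in> range flat" for f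
  proof -
    from that obtain q where "f = flat q" by auto
    then have "deriv f = flat ([:0, 0, 1:] * (q - pderiv q))"
      using flat_has_deriv DERIV_imp_deriv by blast
    then show ?thesis by blast
  qed
qed auto

text \<open>The scaling makes the two factors steeper, while the shift by \<open>1\<close> keeps the support at
  distance \<open>1/(n+1)\<close> from \<open>a\<close> and \<open>b\<close>. So these are test functions on \<open>(0, T)\<close> even for \<open>a = 0\<close> and
  \<open>b = T\<close>, and they still converge to the indicator function of \<open>(a, b)\<close>.\<close>

definition bump :: "real \<Rightarrow> real \<Rightarrow> nat \<Rightarrow> real \<Rightarrow> real" where
  "bump a b n x = flat 1 (real (Suc n) * (x - a) - 1) * flat 1 (real (Suc n) * (b - x) - 1)"

lemma smooth_bump: "smooth (bump a b n)"
proof -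
  have "smooth (\<lambda>x. flat 1 (real (Suc n) * x + (- real (Suc n) * a - 1))
      * flat 1 (- real (Suc n) * x + (real (Suc n) * b - 1)))"
    by (intro smooth_mult smooth_affine smooth_flat)
  then show ?thesis unfolding bump_def[abs_def] by (simp add: algebra_simps)
qed

lemma flat_1_bounds: "0 \<le> flat 1 x" "flat 1 x \<le> 1"
  by (auto simp: flat_def)

lemma bump_bounds: "0 \<le> bump a b n x" "bump a b n x \<le> 1"
  unfolding bump_def using flat_1_bounds by (auto intro: mult_le_one)

lemma bump_support:
  assumes "x \<notin> {a + 1 / real (Suc n)..b - 1 / real (Suc n)}"
  shows "bump a b n x = 0"
proof -
  have "real (Suc n) * (x - a) \<le> 1 \<or> real (Suc n) * (b - x) \<le> 1"
    using assms by (auto simp: field_simps)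
  then show ?thesis unfolding bump_def flat_def by auto
qed

lemma flat_1_tendsto: "filterlim y at_top F \<Longrightarrow> ((\<lambda>i. flat 1 (y i)) \<longlongrightarrow> 1) F"
proof (rule Lim_transform_eventually)
  assume y: "filterlim y at_top F"
  have "((\<lambda>i. 1 / y i) \<longlongrightarrow> 0) F"
    by (rule real_tendsto_divide_at_top[OF tendsto_const y])
  then have "((\<lambda>i. exp (- (1 / y i))) \<longlongrightarrow> exp (- 0)) F" by (intro tendsto_intros)
  then show "((\<lambda>i. exp (- (1 / y i))) \<longlongrightarrow> 1) F" by simp
  show "\<forall>\<^sub>F i in F. exp (- (1 / y i)) = flat 1 (y i)"
    using filterlim_at_top_dense[THEN iffD1, OF y, rule_format, of 0]
    by eventually_elim (simp add: flat_def)
qed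

lemma bump_tendsto: "(\<lambda>n. bump a b n x) \<longlonglongrightarrow> indicator {a<..<b} x"
proof (cases "a < x \<and> x < b")
  case True
  have *: "filterlim (\<lambda>n. real (Suc n) * c - 1) at_top sequentially" if "c > 0" for c
  proof -
    have "filterlim (\<lambda>n. - 1 + real (Suc n) * c) at_top sequentially"
      using that
      by (intro filterlim_tendsto_add_at_top[OF tendsto_const]
          filterlim_at_top_mult_tendsto_pos[OF tendsto_const]
          filterlim_compose[OF filterlim_real_sequentially filterlim_Suc])
    then show ?thesis by simp
  qed
  have "(\<lambda>n. bump a b n x) \<longlonglongrightarrow> 1 * 1"
    unfolding bump_def using True by (intro tendsto_mult flat_1_tendsto *) auto
  then show ?thesis using True by simp
next
  case False
  have "bump a b n x = 0" for n
  proof (rule bump_support)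
    have "0 < 1 / real (Suc n)" by simp
    with False show "x \<notin> {a + 1 / real (Suc n)..b - 1 / real (Suc n)}"
      unfolding atLeastAtMost_iff by argo
  qed
  then show ?thesis using False by simp
qed

lemma test_function_iff:
  "test_function T \<phi> \<longleftrightarrow> smooth \<phi> \<and> (\<exists>a b. 0 < a \<and> b < T \<and> (\<forall>x. x \<notin> {a..b} \<longrightarrow> \<phi> x = 0))"
  unfolding test_function_def smooth_def ..

lemma test_function_bump:
  assumes "0 \<le> a" "b \<le> T"
  shows "test_function T (bump a b n)"
proof -
  have "0 < 1 / real (Suc n)" by simp
  then have "0 < a + 1 / real (Suc n)" "b - 1 / real (Suc n) < T"
    using assms by argo+
  then show ?thesis
    unfolding test_function_iff using bump_support[of _ a n b] smooth_bump by blast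
qed

section \<open>Weak derivatives of real functions\<close>

lemma dominated_bump:
  fixes f :: "real \<Rightarrow> real"
  assumes f: "integrable lborel f"
  shows "(\<lambda>n. \<integral>x. bump a b n x * f x \<partial>lborel) \<longlonglongrightarrow> (\<integral>x. indicator {a<..<b} x * f x \<partial>lborel)"
proof (rule integral_dominated_convergence[where w = "\<lambda>x. norm (f x)"])
  note [measurable] = borel_measurable_integrable[OF f]
  have [measurable]: "bump a b n \<in> borel_measurable borel" for n
    by (intro borel_measurable_continuous_onI smooth_continuous smooth_bump)
  show "(\<lambda>x. bump a b n x * f x) \<in> borel_measurable lborel" for n by measurable
  show "(\<lambda>x. indicator {a<..<b} x * f x) \<in> borel_measurable lborel" by measurable
  show "integrable lborel (\<lambda>x. norm (f x))" using f by simp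
  show "AE x in lborel. (\<lambda>n. bump a b n x * f x) \<longlonglongrightarrow> indicator {a<..<b} x * f x"
    by (intro AE_I2 tendsto_mult bump_tendsto tendsto_const)
  have "norm (bump a b n x * f x) \<le> norm (f x)" for n x
    using bump_bounds[of a b n x] mult_left_le_one_le[of "\<bar>f x\<bar>" "bump a b n x"]
    by (simp add: abs_mult)
  then show "AE x in lborel. norm (bump a b n x * f x) \<le> norm (f x)" for n by simp
qed

text \<open>The positive and the negative part of \<open>h\<close> are densities of two finite measures which agree on
  all half-lines and therefore coincide.\<close>

lemma AE_zero_of_tail_integrals_zero:
  fixes h :: "real \<Rightarrow> real"
  assumes h: "integrable lborel h"
    and 0: "\<And>c. (\<integral>x. indicator {c<..} x * h x \<partial>lborel) = 0"
  shows "AE x in lborel. h x = 0"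
proof -
  note [measurable] = borel_measurable_integrable[OF h]
  define M where "M = density lborel (\<lambda>x. ennreal (h x))"
  define N where "N = density lborel (\<lambda>x. ennreal (- h x))"
  have ih: "integrable lborel (\<lambda>x. indicator {c<..} x * h x)" for c
    using integrable_mult_indicator[OF _ h, of "{c<..}"] by simp
  have eM: "emeasure M {c<..} = (\<integral>\<^sup>+x. ennreal (indicator {c<..} x * h x) \<partial>lborel)" for c
    unfolding M_def by (subst emeasure_density) (auto intro!: nn_integral_cong simp: indicator_def)
  have eN: "emeasure N {c<..} = (\<integral>\<^sup>+x. ennreal (- (indicator {c<..} x * h x)) \<partial>lborel)" for c
    unfolding N_def by (subst emeasure_density) (auto intro!: nn_integral_cong simp: indicator_def)
  have fin: "emeasure M {c<..} < \<infinity>" "emeasure N {c<..} < \<infinity>" for c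
    using ih[of c] unfolding eM eN real_integrable_def by (auto simp: less_top)
  have "M = N"
  proof (rule measure_eqI_lessThan)
    show "emeasure M {c<..} = emeasure N {c<..}" for c
    proof -
      have "enn2real (emeasure M {c<..}) - enn2real (emeasure N {c<..}) = 0"
        unfolding eM eN using 0[of c] real_lebesgue_integral_def[OF ih[of c]] by simp
      then show ?thesis using fin[of c] by (metis diff_eq_diff_eq diff_self ennreal_enn2real infinity_ennreal_def)
    qed
  qed (use fin in \<open>auto simp: M_def N_def\<close>)
  then have "AE x in lborel. ennreal (h x) = ennreal (- h x)"
    unfolding M_def N_def
    by (subst (asm) sigma_finite_measure.density_unique_iff[OF sigma_finite_lborel]) auto
  then show ?thesis
  proof eventually_elim
    case (elim x)
    then show ?case
      by (cases "h x \<ge> 0") (auto simp: ennreal_neg)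
  qed
qed

text \<open>The bump functions turn the hypothesis into vanishing integrals over intervals.\<close>

lemma fundamental_lemma:
  fixes f :: "real \<Rightarrow> real"
  assumes f: "integrable lborel f"
    and test: "\<And>\<phi>. test_function T \<phi> \<Longrightarrow> (\<integral>x. \<phi> x * f x \<partial>lborel) = 0"
  shows "AE x in lborel. x \<in> {0<..<T} \<longrightarrow> f x = 0"
proof -
  have "(\<integral>x. indicator {c<..} x * (indicator {0<..<T} x * f x) \<partial>lborel) = 0" for c
  proof -
    have "(\<lambda>n. \<integral>x. bump (max 0 c) T n x * f x \<partial>lborel)
        \<longlonglongrightarrow> (\<integral>x. indicator {max 0 c<..<T} x * f x \<partial>lborel)"
      by (rule dominated_bump[OF f])
    moreover have "(\<integral>x. bump (max 0 c) T n x * f x \<partial>lborel) = 0" for n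
      by (intro test test_function_bump) auto
    ultimately have "(\<integral>x. indicator {max 0 c<..<T} x * f x \<partial>lborel) = 0"
      by (simp add: LIMSEQ_const_iff)
    moreover have "indicator {max 0 c<..<T} x * f x = indicator {c<..} x * (indicator {0<..<T} x * f x)" for x
      by (auto simp: indicator_def)
    ultimately show ?thesis by simp
  qed
  moreover have "integrable lborel (\<lambda>x. indicator {0<..<T} x * f x)"
    using integrable_mult_indicator[OF _ f, of "{0<..<T}"] by simp
  ultimately have "AE x in lborel. indicator {0<..<T} x * f x = 0"
    by (intro AE_zero_of_tail_integrals_zero)
  then show ?thesis by eventually_elim auto
qed

lemma ex_primitive:
  fixes \<psi> :: "real \<Rightarrow> real"
  assumes cont: "continuous_on UNIV \<psi>" and ab: "a \<le> b" and supp: "\<And>x. x \<notin> {a..b} \<Longrightarrow> \<psi> x = 0"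
  shows "\<exists>\<Phi>. (\<forall>x. DERIV \<Phi> x :> \<psi> x) \<and> (\<forall>x\<le>a. \<Phi> x = 0) \<and> (\<forall>x\<ge>b. \<Phi> x = (\<integral>x. \<psi> x \<partial>lborel))"
proof -
  have "\<exists>F. \<forall>x. -\<infinity> < ereal x \<longrightarrow> ereal x < \<infinity> \<longrightarrow> (F has_vector_derivative \<psi> x) (at x)"
    by (rule einterval_antiderivative) (use cont in \<open>auto simp: continuous_on_eq_continuous_at\<close>)
  then obtain F where F: "\<And>x. DERIV F x :> \<psi> x"
    by (auto simp: has_real_derivative_iff_has_vector_derivative)
  define \<Phi> where "\<Phi> x = F x - F a" for x
  have D: "DERIV \<Phi> x :> \<psi> x" for x
    unfolding \<Phi>_def using F[of x] by (auto intro!: derivative_eq_intros)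
  have int: "(\<integral>x. \<psi> x * indicator {x0..y0} x \<partial>lborel) = \<Phi> y0 - \<Phi> x0" if "x0 \<le> y0" for x0 y0
    using that D cont
    by (intro integral_FTC_Icc_real) (auto simp: continuous_on_eq_continuous_at)
  have "\<Phi> x = 0" if "x \<le> a" for x
  proof -
    have "(\<integral>t. \<psi> t * indicator {x..a} t \<partial>lborel) = 0"
    proof (rule integral_eq_zero_AE)
      show "AE t in lborel. \<psi> t * indicator {x..a} t = 0"
        using AE_lborel_singleton[of a] by eventually_elim (use supp in \<open>auto simp: indicator_def\<close>)
    qed
    with int[OF that] show ?thesis by (simp add: \<Phi>_def)
  qed
  moreover have "\<Phi> x = (\<integral>x. \<psi> x \<partial>lborel)" if "x \<ge> b" for x
  proof -
    have "\<psi> t * indicator {a..x} t = \<psi> t" for t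
      using supp[of t] that by (cases "t \<in> {a..b}") auto
    with int[of a x] ab that show ?thesis by (simp add: \<Phi>_def)
  qed
  ultimately show ?thesis using D by blast
qed

lemma test_function_continuous: "test_function T \<phi> \<Longrightarrow> continuous_on S \<phi>"
  by (simp add: test_function_iff smooth_continuous)

lemma test_function_deriv: "test_function T \<phi> \<Longrightarrow> test_function T (deriv \<phi>)"
proof -
  assume "test_function T \<phi>"
  then obtain a b where s: "smooth \<phi>" and ab: "0 < a" "b < T" "\<And>x. x \<notin> {a..b} \<Longrightarrow> \<phi> x = 0"
    unfolding test_function_iff by blast
  have "deriv \<phi> x = 0" if "x \<notin> {a..b}" for x
  proof -
    have "DERIV (\<lambda>x. 0) x :> (0::real)" by simp
    then have "DERIV \<phi> x :> 0"
      by (rule has_field_derivative_transform_within_open[where S = "- {a..b}"]) (use that ab in auto)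
    then show ?thesis by (rule DERIV_imp_deriv)
  qed
  then show ?thesis using ab smooth_deriv[OF s] unfolding test_function_iff by blast
qed

lemma test_function_bounded:
  assumes "test_function T \<phi>"
  obtains B where "B > 0" "\<And>x. \<bar>\<phi> x\<bar> \<le> B"
proof -
  obtain a b where ab: "\<And>x. x \<notin> {a..b} \<Longrightarrow> \<phi> x = 0"
    using assms unfolding test_function_iff by blast
  have "bounded (\<phi> ` {a..b})"
    by (intro compact_imp_bounded compact_continuous_image test_function_continuous[OF assms]) simp
  then obtain B where B: "B > 0" "\<And>x. x \<in> {a..b} \<Longrightarrow> \<bar>\<phi> x\<bar> \<le> B"
    unfolding bounded_pos by auto
  have "\<bar>\<phi> x\<bar> \<le> B" for x using B ab[of x] by (cases "x \<in> {a..b}") auto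
  with B that show ?thesis by blast
qed

lemma test_function_integrable:
  assumes "test_function T \<phi>"
  shows "integrable lborel \<phi>"
proof -
  obtain a b where ab: "\<And>x. x \<notin> {a..b} \<Longrightarrow> \<phi> x = 0"
    using assms unfolding test_function_iff by blast
  have "set_integrable lborel {a..b} \<phi>"
    by (rule borel_integrable_atLeastAtMost') (use assms in \<open>auto intro: test_function_continuous\<close>)
  moreover have "(\<lambda>x. indicator {a..b} x *\<^sub>R \<phi> x) = \<phi>"
    using ab by (auto simp: fun_eq_iff indicator_def)
  ultimately show ?thesis unfolding set_integrable_def by simp
qed

lemma test_function_mult_integrable:
  fixes f :: "real \<Rightarrow> real"
  assumes "test_function T \<phi>" "integrable lborel f"
  shows "integrable lborel (\<lambda>x. \<phi> x * f x)"
proof -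
  obtain B where B: "B > 0" "\<And>x. \<bar>\<phi> x\<bar> \<le> B" using test_function_bounded[OF assms(1)] by blast
  show ?thesis
  proof (rule Bochner_Integration.integrable_bound[of _ "\<lambda>x. B * f x"])
    show "integrable lborel (\<lambda>x. B * f x)" using assms by simp
    show "(\<lambda>x. \<phi> x * f x) \<in> borel_measurable lborel"
      using borel_measurable_integrable[OF assms(2)] borel_measurable_integrable[OF test_function_integrable[OF assms(1)]]
      by measurable
    show "AE x in lborel. norm (\<phi> x * f x) \<le> norm (B * f x)"
      using B by (auto simp: abs_mult intro!: mult_right_mono)
  qed
qed

text \<open>A test function with mean value zero is the derivative of a test function; subtracting a
  multiple of a fixed bump reduces the general test function to this case.\<close>

lemma du_Bois_Reymond:
  fixes D :: "real \<Rightarrow> real"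
  assumes D: "integrable lborel D" and T: "T > 0"
    and test: "\<And>\<phi>. test_function T \<phi> \<Longrightarrow> (\<integral>x. deriv \<phi> x * D x \<partial>lborel) = 0"
  shows "\<exists>c. AE x in lborel. x \<in> {0<..<T} \<longrightarrow> D x = c"
proof -
  have "(\<lambda>n. \<integral>x. bump 0 T n x * indicator {0<..<T} x \<partial>lborel)
      \<longlonglongrightarrow> (\<integral>x. indicator {0<..<T} x * indicator {0<..<T} x \<partial>lborel)"
    by (rule dominated_bump) (use T in simp)
  also have "(\<integral>x. indicator {0<..<T} x * indicator {0<..<T} x \<partial>lborel) = T"
    using T by (simp add: indicator_inter_arith[symmetric])
  finally have "\<forall>\<^sub>F n in sequentially. (\<integral>x. bump 0 T n x * indicator {0<..<T} x \<partial>lborel) > 0"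
    using T by (rule order_tendstoD(1))
  then obtain n where n: "(\<integral>x. bump 0 T n x * indicator {0<..<T} x \<partial>lborel) > 0"
    using eventually_happens'[OF sequentially_bot] by blast
  define \<rho> where "\<rho> = bump 0 T n"
  have \<rho>: "test_function T \<rho>" unfolding \<rho>_def by (rule test_function_bump) auto
  then have ri: "integrable lborel \<rho>" by (rule test_function_integrable)
  define k where "k = (\<integral>x. \<rho> x \<partial>lborel)"
  have "bump 0 T n x * indicator {0<..<T} x = \<rho> x" for x
  proof -
    have "\<rho> x = 0" if "x \<notin> {0<..<T}"
    proof -
      have "0 < 1 / real (Suc n)" by simp
      with that have "x \<notin> {0 + 1 / real (Suc n)..T - 1 / real (Suc n)}"
        unfolding atLeastAtMost_iff greaterThanLessThan_iff by argo
      then show ?thesis unfolding \<rho>_def by (rule bump_support)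
    qed
    then show ?thesis by (auto simp: indicator_def \<rho>_def)
  qed
  with n have k: "k > 0" by (simp add: k_def)
  define c where "c = (\<integral>x. \<rho> x * D x \<partial>lborel) / k"
  have "AE x in lborel. x \<in> {0<..<T} \<longrightarrow> indicator {0<..<T} x * (D x - c) = 0"
  proof (rule fundamental_lemma)
    have 1: "integrable lborel (\<lambda>x. indicator {0<..<T} x * D x)"
      using integrable_mult_indicator[OF _ D, of "{0<..<T}"] by simp
    have 2: "integrable lborel (\<lambda>x. indicator {0<..<T} x * c)" using T by simp
    show "integrable lborel (\<lambda>x. indicator {0<..<T} x * (D x - c))"
      using Bochner_Integration.integrable_diff[OF 1 2] by (simp add: right_diff_distrib)
    fix \<psi> assume \<psi>: "test_function T \<psi>"
    then have pi: "integrable lborel \<psi>" by (rule test_function_integrable)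
    define I where "I = (\<integral>x. \<psi> x \<partial>lborel)"
    \<comment> \<open>\<open>\<xi>\<close> has mean value zero, hence a primitive with compact support in \<open>(0, T)\<close>\<close>
    define \<xi> where "\<xi> x = \<psi> x + (- (I / k)) * \<rho> x" for x
    obtain a b where ab: "0 < a" "b < T" "\<And>x. x \<notin> {a..b} \<Longrightarrow> \<psi> x = 0"
      using \<psi> unfolding test_function_iff by blast
    obtain a' b' where ab': "0 < a'" "b' < T" "\<And>x. x \<notin> {a'..b'} \<Longrightarrow> \<rho> x = 0"
      using \<rho> unfolding test_function_iff by blast
    define a1 where "a1 = min (min a a') (T / 2)"
    define b1 where "b1 = max (max b b') (T / 2)"
    have 3: "0 < a1" "a1 \<le> b1" "b1 < T" using ab ab' T unfolding a1_def b1_def by auto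
    have \<xi>0: "\<xi> x = 0" if "x \<notin> {a1..b1}" for x
    proof -
      have "x \<notin> {a..b}" "x \<notin> {a'..b'}" using that unfolding a1_def b1_def by auto
      then show ?thesis using ab ab' unfolding \<xi>_def by simp
    qed
    have \<xi>s: "smooth \<xi>" unfolding \<xi>_def[abs_def] using \<psi> \<rho>
      by (intro smooth_add smooth_mult smooth_const) (auto simp: test_function_iff)
    have "(\<integral>x. \<xi> x \<partial>lborel) = 0"
      unfolding \<xi>_def using pi ri k by (simp add: I_def[symmetric] k_def[symmetric])
    then obtain \<Phi> where \<Phi>: "\<And>x. DERIV \<Phi> x :> \<xi> x" "\<And>x. x \<le> a1 \<Longrightarrow> \<Phi> x = 0" "\<And>x. b1 \<le> x \<Longrightarrow> \<Phi> x = 0"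
      using ex_primitive[OF smooth_continuous[OF \<xi>s] 3(2) \<xi>0] by auto
    have "smooth \<Phi>" using smooth_primitive[OF \<xi>s \<Phi>(1)] .
    moreover have "\<Phi> x = 0" if "x \<notin> {a1..b1}" for x using that \<Phi> by auto
    ultimately have "test_function T \<Phi>" unfolding test_function_iff using 3 by blast
    from test[OF this] have "(\<integral>x. \<xi> x * D x \<partial>lborel) = 0"
      using \<Phi>(1) DERIV_imp_deriv[OF \<Phi>(1)] by simp
    also have "(\<integral>x. \<xi> x * D x \<partial>lborel)
        = (\<integral>x. \<psi> x * D x - I / k * (\<rho> x * D x) \<partial>lborel)"
      unfolding \<xi>_def by (intro Bochner_Integration.integral_cong) (auto simp: algebra_simps)
    also have "\<dots> = (\<integral>x. \<psi> x * D x \<partial>lborel) - I / k * (\<integral>x. \<rho> x * D x \<partial>lborel)"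
      using test_function_mult_integrable[OF \<psi> D] test_function_mult_integrable[OF \<rho> D] by simp
    finally have "(\<integral>x. \<psi> x * D x \<partial>lborel) - I * c = 0" by (simp add: c_def)
    moreover have "\<psi> x * (indicator {0<..<T} x * (D x - c)) = \<psi> x * D x - c * \<psi> x" for x
      using ab(1,2) ab(3)[of x] by (cases "x \<in> {a..b}") (auto simp: algebra_simps)
    ultimately show "(\<integral>x. \<psi> x * (indicator {0<..<T} x * (D x - c)) \<partial>lborel) = 0"
      using test_function_mult_integrable[OF \<psi> D] pi by (simp add: I_def mult.commute)
  qed
  then show ?thesis by (intro exI[of _ c]) (auto elim: eventually_mono)
qed

text \<open>The primitive that vanishes at \<open>-\<infinity>\<close>. Starting there, and not at \<open>0\<close>, spares a case distinction
  on the sign of \<open>t\<close>; only its increments matter.\<close>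

definition prim :: "(real \<Rightarrow> real) \<Rightarrow> real \<Rightarrow> real" where
  "prim f t = (\<integral>x. (if x \<le> t then f x else 0) \<partial>lborel)"

lemma integrable_if_le:
  fixes f :: "real \<Rightarrow> real"
  assumes "integrable lborel f"
  shows "integrable lborel (\<lambda>x. if x \<le> t then f x else 0)"
proof -
  have "(\<lambda>x. indicator {..t} x *\<^sub>R f x) = (\<lambda>x. if x \<le> t then f x else 0)"
    by (auto simp: fun_eq_iff)
  then show ?thesis using integrable_mult_indicator[OF _ assms, of "{..t}"] by simp
qed

lemma measurable_prim [measurable]:
  assumes [measurable]: "f \<in> borel_measurable lborel"
  shows "prim f \<in> borel_measurable borel"
  unfolding prim_def[abs_def] by (intro lborel.borel_measurable_lebesgue_integral) measurable

lemma prim_bound: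
  assumes "integrable lborel f"
  shows "\<bar>prim f t\<bar> \<le> (\<integral>x. \<bar>f x\<bar> \<partial>lborel)"
proof -
  have "\<bar>prim f t\<bar> \<le> (\<integral>x. \<bar>if x \<le> t then f x else 0\<bar> \<partial>lborel)"
    unfolding prim_def using integral_norm_bound[of lborel "\<lambda>x. if x \<le> t then f x else 0"] by simp
  also have "\<dots> \<le> (\<integral>x. \<bar>f x\<bar> \<partial>lborel)"
    using assms integrable_if_le[OF assms, of t] by (intro integral_mono) auto
  finally show ?thesis .
qed

lemma prim_diff:
  assumes "integrable lborel f" "s \<le> t"
  shows "prim f t - prim f s = (\<integral>x. indicator {s<..t} x * f x \<partial>lborel)"
  unfolding prim_def using assms
  by (subst Bochner_Integration.integral_diff[symmetric])
     (auto intro!: integrable_if_le Bochner_Integration.integral_cong simp: indicator_def)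

lemma integral_deriv_test_tail:
  assumes \<phi>: "test_function T \<phi>"
  shows "(\<integral>t. (if x \<le> t then deriv \<phi> t else 0) \<partial>lborel) = - \<phi> x"
proof -
  obtain a b where s: "smooth \<phi>" and ab: "0 < a" "b < T" "\<And>x. x \<notin> {a..b} \<Longrightarrow> \<phi> x = 0"
    using \<phi> unfolding test_function_iff by blast
  obtain a' b' where ab': "\<And>x. x \<notin> {a'..b'} \<Longrightarrow> deriv \<phi> x = 0"
    using test_function_deriv[OF \<phi>] unfolding test_function_iff by blast
  define y where "y = max x (max b b') + 1"
  have "(\<integral>t. deriv \<phi> t * indicator {x..y} t \<partial>lborel) = \<phi> y - \<phi> x"
    using smooth_has_deriv[OF s] smooth_continuous[OF smooth_deriv[OF s], of UNIV]
    by (intro integral_FTC_Icc_real) (auto simp: y_def continuous_on_eq_continuous_at)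
  moreover have "deriv \<phi> t * indicator {x..y} t = (if x \<le> t then deriv \<phi> t else 0)" for t
    using ab'[of t] by (cases "t \<le> b'") (auto simp: indicator_def y_def)
  moreover have "\<phi> y = 0"
  proof (rule ab(3))
    show "y \<notin> {a..b}" by (auto simp: y_def)
  qed
  ultimately show ?thesis by simp
qed

text \<open>Integration by parts. As \<open>prim f\<close> is differentiable only almost everywhere, this is Fubini's
  theorem on the triangle \<open>x \<le> t\<close>.\<close>

lemma integral_deriv_test_prim:
  assumes f: "integrable lborel f" and \<phi>: "test_function T \<phi>"
  shows "(\<integral>t. deriv \<phi> t * prim f t \<partial>lborel) = - (\<integral>t. \<phi> t * f t \<partial>lborel)"
proof -
  note [measurable] = borel_measurable_integrable[OF f]
    borel_measurable_integrable[OF test_function_integrable[OF test_function_deriv[OF \<phi>]], simplified]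
  have di: "integrable lborel (deriv \<phi>)"
    using \<phi> test_function_deriv test_function_integrable by blast
  have 0: "integrable (lborel \<Otimes>\<^sub>M lborel) (\<lambda>(t, x). deriv \<phi> t * f x)"
  proof (rule lborel_pair.Fubini_integrable)
    show "integrable lborel (\<lambda>t. \<integral>x. norm (case (t, x) of (t, x) \<Rightarrow> deriv \<phi> t * f x) \<partial>lborel)"
      using di by (simp add: abs_mult)
    show "AE t in lborel. integrable lborel (\<lambda>x. case (t, x) of (t, x) \<Rightarrow> deriv \<phi> t * f x)"
      using f by simp
  qed measurable
  have 1: "integrable (lborel \<Otimes>\<^sub>M lborel) (\<lambda>(t, x). deriv \<phi> t * (if x \<le> t then f x else 0))"
    by (rule Bochner_Integration.integrable_bound[OF 0]) (auto simp: split_beta')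
  have "(\<integral>t. deriv \<phi> t * prim f t \<partial>lborel)
      = (\<integral>t. \<integral>x. deriv \<phi> t * (if x \<le> t then f x else 0) \<partial>lborel \<partial>lborel)"
    unfolding prim_def by simp
  also have "\<dots> = (\<integral>x. \<integral>t. deriv \<phi> t * (if x \<le> t then f x else 0) \<partial>lborel \<partial>lborel)"
    using lborel_pair.Fubini_integral[OF 1] by simp
  also have "\<dots> = (\<integral>x. f x * (\<integral>t. (if x \<le> t then deriv \<phi> t else 0) \<partial>lborel) \<partial>lborel)"
    unfolding integral_mult_right_zero[symmetric]
    by (intro Bochner_Integration.integral_cong refl) (auto simp: mult.commute)
  also have "\<dots> = - (\<integral>t. \<phi> t * f t \<partial>lborel)"
    unfolding integral_deriv_test_tail[OF \<phi>] by (simp add: mult.commute)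
  finally show ?thesis .
qed

text \<open>The difference of \<open>F\<close> and the primitive of \<open>f\<close> satisfies the hypothesis of the du Bois-Reymond
  lemma.\<close>

lemma weak_derivative_imp_primitive:
  assumes F: "integrable lborel F" and f: "integrable lborel f" and T: "T > 0"
    and test: "\<And>\<phi>. test_function T \<phi> \<Longrightarrow>
      (\<integral>x. deriv \<phi> x * F x \<partial>lborel) = - (\<integral>x. \<phi> x * f x \<partial>lborel)"
  shows "\<exists>c. AE t in lborel. t \<in> {0<..<T} \<longrightarrow> F t = c + prim f t"
proof -
  note [measurable] = borel_measurable_integrable[OF f] borel_measurable_integrable[OF F]
  define D where "D t = F t - indicator {0<..<T} t * prim f t" for t
  have pi: "integrable lborel (\<lambda>t. indicator {0<..<T} t * prim f t)"
  proof (rule Bochner_Integration.integrable_bound)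
    show "integrable lborel (\<lambda>t. indicator {0<..<T} t * (\<integral>x. \<bar>f x\<bar> \<partial>lborel))" using T by simp
    show "AE t in lborel. norm (indicator {0<..<T} t * prim f t)
        \<le> norm (indicator {0<..<T} t * (\<integral>x. \<bar>f x\<bar> \<partial>lborel))"
      using prim_bound[OF f] by (auto simp: indicator_def)
  qed measurable
  have "\<exists>c. AE t in lborel. t \<in> {0<..<T} \<longrightarrow> D t = c"
  proof (rule du_Bois_Reymond)
    show "integrable lborel D" unfolding D_def[abs_def] using F pi by simp
    fix \<phi> assume \<phi>: "test_function T \<phi>"
    have "deriv \<phi> t * D t = deriv \<phi> t * F t - deriv \<phi> t * prim f t" for t
    proof -
      have "deriv \<phi> t = 0" if "t \<notin> {0<..<T}"
        using test_function_deriv[OF \<phi>] that unfolding test_function_iff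
        by (metis atLeastAtMost_iff greaterThanLessThan_iff order_less_le_trans order_le_less_trans)
      then show ?thesis by (cases "t \<in> {0<..<T}") (auto simp: D_def algebra_simps)
    qed
    moreover have "integrable lborel (\<lambda>t. deriv \<phi> t * prim f t)"
    proof (rule Bochner_Integration.integrable_bound)
      show "integrable lborel (\<lambda>t. deriv \<phi> t * (\<integral>x. \<bar>f x\<bar> \<partial>lborel))"
        using test_function_integrable[OF test_function_deriv[OF \<phi>]] by simp
      show "AE t in lborel. norm (deriv \<phi> t * prim f t)
          \<le> norm (deriv \<phi> t * (\<integral>x. \<bar>f x\<bar> \<partial>lborel))"
        using prim_bound[OF f] by (auto simp: abs_mult intro!: mult_left_mono)
      show "(\<lambda>t. deriv \<phi> t * prim f t) \<in> borel_measurable lborel"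
        using borel_measurable_integrable[OF test_function_integrable[OF test_function_deriv[OF \<phi>]]]
        by measurable
    qed
    ultimately show "(\<integral>x. deriv \<phi> x * D x \<partial>lborel) = 0"
      using test_function_mult_integrable[OF test_function_deriv[OF \<phi>] F]
        test[OF \<phi>] integral_deriv_test_prim[OF f \<phi>] by simp
  qed fact
  then obtain c where "AE t in lborel. t \<in> {0<..<T} \<longrightarrow> D t = c" by blast
  then have "AE t in lborel. t \<in> {0<..<T} \<longrightarrow> F t = c + prim f t"
    by eventually_elim (auto simp: D_def)
  then show ?thesis by blast
qed

section \<open>Strongly measurable functions\<close>

text \<open>In contrast to \<open>strongly_measurable\<close>, the limit is taken everywhere. Such functions can be
  composed with measurable maps, which is what is needed for Tonelli's theorem on product spaces.\<close>

definition simple_limit :: "'b measure \<Rightarrow> ('b \<Rightarrow> 'a::real_normed_vector) \<Rightarrow> bool" where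
  "simple_limit M f \<longleftrightarrow>
     (\<exists>s. (\<forall>n::nat. simple_function M (s n)) \<and> (\<forall>x\<in>space M. (\<lambda>n. s n x) \<longlonglongrightarrow> f x))"

lemma simple_limit_comp:
  assumes T: "T \<in> measurable M N" and f: "simple_limit N f"
  shows "simple_limit M (\<lambda>x. f (T x))"
proof -
  obtain s where s: "\<And>n::nat. simple_function N (s n)" "\<And>x. x \<in> space N \<Longrightarrow> (\<lambda>n. s n x) \<longlonglongrightarrow> f x"
    using f unfolding simple_limit_def by blast
  have "simple_function M (\<lambda>x. s n (T x))" for n
    using simple_function_comp[OF T s(1)] .
  moreover have "(\<lambda>n. s n (T x)) \<longlonglongrightarrow> f (T x)" if "x \<in> space M" for x
    using s(2) measurable_space[OF T that] by blast
  ultimately show ?thesis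
    unfolding simple_limit_def by (intro exI[of _ "\<lambda>n x. s n (T x)"]) auto
qed

lemma simple_limit_map2:
  assumes f: "simple_limit M f" and g: "simple_limit M g"
    and h: "\<And>u v a b. u \<longlonglongrightarrow> a \<Longrightarrow> v \<longlonglongrightarrow> b \<Longrightarrow> (\<lambda>n. h (u n) (v n)) \<longlonglongrightarrow> h a b"
  shows "simple_limit M (\<lambda>x. h (f x) (g x))"
proof -
  obtain s where s: "\<And>n::nat. simple_function M (s n)" "\<And>x. x \<in> space M \<Longrightarrow> (\<lambda>n. s n x) \<longlonglongrightarrow> f x"
    using f unfolding simple_limit_def by blast
  obtain r where r: "\<And>n::nat. simple_function M (r n)" "\<And>x. x \<in> space M \<Longrightarrow> (\<lambda>n. r n x) \<longlonglongrightarrow> g x"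
    using g unfolding simple_limit_def by blast
  have "simple_function M (\<lambda>x. h (s n x) (r n x))" for n
    using simple_function_compose2[OF s(1) r(1)] .
  moreover have "(\<lambda>n. h (s n x) (r n x)) \<longlonglongrightarrow> h (f x) (g x)" if "x \<in> space M" for x
    using h s(2) r(2) that by blast
  ultimately show ?thesis
    unfolding simple_limit_def by (intro exI[of _ "\<lambda>n x. h (s n x) (r n x)"]) auto
qed

lemma simple_limit_measurable:
  fixes f :: "'b \<Rightarrow> real"
  assumes "simple_limit M f"
  shows "f \<in> borel_measurable M"
proof -
  obtain s where s: "\<And>n::nat. simple_function M (s n)" "\<And>x. x \<in> space M \<Longrightarrow> (\<lambda>n. s n x) \<longlonglongrightarrow> f x"
    using assms unfolding simple_limit_def by blast
  show ?thesis
    by (rule borel_measurable_LIMSEQ_metric[of s])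
      (use s borel_measurable_simple_function in auto)
qed

lemma simple_limit_diff:
  "simple_limit M f \<Longrightarrow> simple_limit M g \<Longrightarrow> simple_limit M (\<lambda>x. f x - g x)"
  by (rule simple_limit_map2) (auto intro: tendsto_diff)

lemma simple_limit_norm_measurable:
  assumes "simple_limit M f"
  shows "(\<lambda>x. norm (f x)) \<in> borel_measurable M"
  by (rule simple_limit_measurable, rule simple_limit_map2[OF assms assms, of "\<lambda>x y. norm x"])
     (auto intro: tendsto_norm)

lemma simple_limit_pairing_measurable:
  fixes g :: "'b \<Rightarrow> 'a::real_normed_vector \<Rightarrow>\<^sub>L real"
  assumes "simple_limit M g" "simple_limit M f"
  shows "(\<lambda>x. blinfun_apply (g x) (f x)) \<in> borel_measurable M"
  by (rule simple_limit_measurable, rule simple_limit_map2[OF assms, of "blinfun_apply"])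
     (auto intro: blinfun.tendsto)

lemma simple_limit_const: "simple_limit M (\<lambda>x. c)"
  unfolding simple_limit_def by (intro exI[of _ "\<lambda>n x. c"]) auto

text \<open>Lebesgue measurable simple functions agree with Borel measurable ones off null sets. The value
  zero on a Borel null set containing all exceptional points makes the limit exist everywhere.\<close>

lemma ex_borel_representative:
  fixes f :: "real \<Rightarrow> 'a::real_normed_vector"
  assumes f: "sq_integrable f" and S: "S \<in> sets borel"
    and 0: "AE t in lebesgue. t \<notin> S \<longrightarrow> f t = 0"
  shows "\<exists>f'. simple_limit borel f' \<and> (AE t in lebesgue. f t = f' t) \<and> (\<forall>t. t \<notin> S \<longrightarrow> f' t = 0)
     \<and> integrable lborel (\<lambda>t. (norm (f' t))\<^sup>2)"
proof -
  obtain s where s: "\<And>n::nat. simple_function lebesgue (s n)" "AE t in lebesgue. (\<lambda>n. s n t) \<longlonglongrightarrow> f t"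
    using f unfolding sq_integrable_def strongly_measurable_def by blast
  have "\<forall>n. \<exists>r. simple_function lborel r \<and> (AE t in lborel. s n t = r t)"
    using completion_ex_simple_function[OF s(1)] by blast
  then obtain r where r: "\<And>n. simple_function lborel (r n)" "\<And>n. AE t in lborel. s n t = r n t"
    by metis
  have "AE t in lborel. \<forall>n. s n t = r n t" using r(2) by (simp add: AE_all_countable)
  moreover have "AE t in lborel. (\<lambda>n. s n t) \<longlonglongrightarrow> f t" using s(2) by (simp add: AE_completion_iff)
  ultimately have "AE t in lborel. (\<lambda>n. r n t) \<longlonglongrightarrow> f t" by eventually_elim auto
  then obtain N where N: "N \<in> null_sets lborel" "{t. \<not> (\<lambda>n. r n t) \<longlonglongrightarrow> f t} \<subseteq> N"
    by (auto elim!: AE_E simp: null_sets_def)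
  have N': "N \<in> sets borel" using N by (auto simp: null_sets_def)
  define f' where "f' t = (if t \<in> N \<union> - S then 0 else f t)" for t
  have "simple_function borel (\<lambda>t. if t \<in> N \<union> - S then 0 else r n t)" for n
    using r(1)[of n] S N' by (intro simple_function_If) (auto simp: simple_function_def)
  moreover have "(\<lambda>n. if t \<in> N \<union> - S then 0 else r n t) \<longlonglongrightarrow> f' t" for t
    using N(2) by (auto simp: f'_def)
  ultimately have sl: "simple_limit borel f'"
    unfolding simple_limit_def by (intro exI[of _ "\<lambda>n t. if t \<in> N \<union> - S then 0 else r n t"]) auto
  have "AE t in lebesgue. t \<notin> N" using AE_completion[OF AE_not_in[OF N(1)]] .
  with 0 have ae: "AE t in lebesgue. f t = f' t"
    by eventually_elim (auto simp: f'_def)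
  have m: "(\<lambda>t. (norm (f' t))\<^sup>2) \<in> borel_measurable lborel"
    using simple_limit_norm_measurable[OF sl] by simp
  have "integrable lebesgue (\<lambda>t. (norm (f t))\<^sup>2)" using f unfolding sq_integrable_def by simp
  then have "integrable lebesgue (\<lambda>t. (norm (f' t))\<^sup>2)"
    by (rule integrable_cong_AE_imp) (use m ae in \<open>auto intro: measurable_completion elim: eventually_mono\<close>)
  then have "integrable lborel (\<lambda>t. (norm (f' t))\<^sup>2)"
    using m by (simp add: integrable_completion)
  with sl ae show ?thesis by (intro exI[of _ f']) (auto simp: f'_def)
qed

section \<open>Continuity of translations in the mean square\<close>

lemma tendsto_ennreal_0I:
  fixes g :: "'b \<Rightarrow> ennreal"
  assumes "\<And>e. e > 0 \<Longrightarrow> \<forall>\<^sub>F x in F. g x \<le> ennreal e"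
  shows "(g \<longlongrightarrow> 0) F"
proof (rule order_tendstoI)
  fix a :: ennreal assume "0 < a"
  then obtain r where r: "0 < r" "r < a" using dense by blast
  then obtain e where e: "r = ennreal e" "e \<ge> 0"
    by (metis ennreal_cases less_top top_greatest leD)
  with r have "e > 0" by (cases "e = 0") auto
  from assms[OF this] show "\<forall>\<^sub>F x in F. g x < a" using r e by (auto elim: eventually_mono)
qed simp

lemma tendsto_ennreal_0D:
  "((g::'b \<Rightarrow> ennreal) \<longlongrightarrow> 0) F \<Longrightarrow> e > 0 \<Longrightarrow> \<forall>\<^sub>F x in F. g x \<le> ennreal e"
  by (drule order_tendstoD(2)[of _ _ _ "ennreal e"]) (auto elim: eventually_mono)

lemma nn_integral_translate:
  fixes f :: "real \<Rightarrow> ennreal"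
  assumes "f \<in> borel_measurable borel"
  shows "(\<integral>\<^sup>+t. f (t + h) \<partial>lborel) = (\<integral>\<^sup>+t. f t \<partial>lborel)"
  using nn_integral_real_affine[OF assms, of 1 h] by (simp add: add.commute)

text \<open>A point of an open set stays in it under all small translations.\<close>

lemma translate_open:
  fixes U :: "real set"
  assumes U: "open U" "emeasure lborel U < \<infinity>" and S: "S \<longlonglongrightarrow> 0"
  shows "(\<lambda>n. \<integral>\<^sup>+t. indicator {t. t \<in> U \<and> t + S n \<notin> U} t \<partial>lborel) \<longlonglongrightarrow> (0::ennreal)"
proof -
  have [measurable]: "U \<in> sets borel" using U by simp
  have "(\<lambda>n. \<integral>\<^sup>+t. indicator {t. t \<in> U \<and> t + S n \<notin> U} t \<partial>lborel)
      \<longlonglongrightarrow> (\<integral>\<^sup>+t. (0::ennreal) \<partial>(lborel :: real measure))"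
  proof (rule nn_integral_dominated_convergence[where w = "indicator U"])
    show "(\<integral>\<^sup>+ t. indicator U t \<partial>lborel) < \<infinity>" using U by simp
    show "AE t in lborel. indicator {t. t \<in> U \<and> t + S n \<notin> U} t \<le> (indicator U t :: ennreal)" for n
      by (auto simp: indicator_def)
    have "(\<lambda>n. indicator {t. t \<in> U \<and> t + S n \<notin> U} t) \<longlonglongrightarrow> (0::ennreal)" for t
    proof (cases "t \<in> U")
      case True
      have "(\<lambda>n. t + S n) \<longlonglongrightarrow> t + 0" using S by (intro tendsto_intros)
      then have "\<forall>\<^sub>F n in sequentially. t + S n \<in> U"
        using U True by (auto dest: topological_tendstoD)
      then show ?thesis by (intro tendsto_eventually) (auto elim!: eventually_mono)
    qed simp
    then show "AE t in lborel. (\<lambda>n. indicator {t. t \<in> U \<and> t + S n \<notin> U} t) \<longlonglongrightarrow> (0::ennreal)"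
      by simp
  qed measurable
  then show ?thesis by simp
qed

text \<open>By outer regularity, \<open>B\<close> may be replaced by an open set; the points entering it under the
  translation by \<open>h\<close> correspond to those leaving it under the translation by \<open>-h\<close>.\<close>

lemma translate_indicator:
  fixes B :: "real set"
  assumes B[measurable]: "B \<in> sets borel" and fin: "emeasure lborel B < \<infinity>" and S: "S \<longlonglongrightarrow> 0"
  shows "(\<lambda>n. \<integral>\<^sup>+t. indicator {t. (t + S n \<in> B) \<noteq> (t \<in> B)} t \<partial>lborel) \<longlonglongrightarrow> (0::ennreal)"
proof (rule tendsto_ennreal_0I)
  fix e :: real assume e: "e > 0"
  obtain U where U: "open U" "B \<subseteq> U" "emeasure lborel (U - B) < e / 4"
    using outer_regular_lborel[OF B, of "e / 4"] e by auto
  have [measurable]: "U \<in> sets borel" using U by simp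
  have "emeasure lborel U = emeasure lborel (B \<union> (U - B))" using U by (simp add: Un_absorb1)
  also have "\<dots> \<le> emeasure lborel B + emeasure lborel (U - B)" by (rule emeasure_subadditive) auto
  also have "\<dots> < \<infinity>" using fin U(3) by (auto simp: less_top[symmetric] top_unique)
  finally have finU: "emeasure lborel U < \<infinity>" .
  have S': "(\<lambda>n. - S n) \<longlonglongrightarrow> 0" using tendsto_minus[OF S] by simp
  have e4: "0 < e / 4" using e by simp
  have eq: "(\<integral>\<^sup>+t. indicator {t. t \<notin> U \<and> t + h \<in> U} t \<partial>lborel)
      = (\<integral>\<^sup>+t. indicator {t. t \<in> U \<and> t + (- h) \<notin> U} t \<partial>lborel)" for h
  proof -
    have "(\<lambda>t. indicator {t. t \<notin> U \<and> t + h \<in> U} t :: ennreal) \<in> borel_measurable borel" by measurable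
    from nn_integral_translate[OF this, of "- h", symmetric]
    show ?thesis by (simp only:) (intro nn_integral_cong, auto simp: indicator_def)
  qed
  have eqB: "(\<integral>\<^sup>+t. indicator (U - B) (t + h) \<partial>lborel) = emeasure lborel (U - B)" for h
    by (subst nn_integral_translate) auto
  have "\<forall>\<^sub>F n in sequentially. (\<integral>\<^sup>+t. indicator {t. t \<in> U \<and> t + S n \<notin> U} t \<partial>lborel) \<le> ennreal (e / 4)"
    using tendsto_ennreal_0D[OF translate_open[OF U(1) finU S] e4] .
  moreover have "\<forall>\<^sub>F n in sequentially.
      (\<integral>\<^sup>+t. indicator {t. t \<in> U \<and> t + (- S n) \<notin> U} t \<partial>lborel) \<le> ennreal (e / 4)"
    using tendsto_ennreal_0D[OF translate_open[OF U(1) finU S'] e4] .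
  ultimately show "\<forall>\<^sub>F n in sequentially.
      (\<integral>\<^sup>+t. indicator {t. (t + S n \<in> B) \<noteq> (t \<in> B)} t \<partial>lborel) \<le> ennreal e"
  proof eventually_elim
    case (elim n)
    have "(\<integral>\<^sup>+t. indicator {t. (t + S n \<in> B) \<noteq> (t \<in> B)} t \<partial>lborel)
      \<le> (\<integral>\<^sup>+t. indicator (U - B) (t + S n) + (indicator (U - B) t
          + (indicator {t. t \<in> U \<and> t + S n \<notin> U} t + indicator {t. t \<notin> U \<and> t + S n \<in> U} t)) \<partial>lborel)"
      using U(2) by (intro nn_integral_mono) (auto simp: indicator_def)
    also have "\<dots> = emeasure lborel (U - B) + (emeasure lborel (U - B)
        + ((\<integral>\<^sup>+t. indicator {t. t \<in> U \<and> t + S n \<notin> U} t \<partial>lborel)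
        + (\<integral>\<^sup>+t. indicator {t. t \<in> U \<and> t + (- S n) \<notin> U} t \<partial>lborel)))"
      by (simp add: nn_integral_add eqB eq)
    also have "\<dots> \<le> ennreal (e / 4) + (ennreal (e / 4) + (ennreal (e / 4) + ennreal (e / 4)))"
      using elim U(3) by (intro add_mono) auto
    also have "\<dots> = ennreal e" using e by (simp flip: ennreal_plus)
    finally show ?case .
  qed
qed

text \<open>A value \<open>s (t + h) \<noteq> s t\<close> requires \<open>t\<close> to enter or leave the set on which one of the finitely many
  nonzero values is taken.\<close>

lemma translate_simple:
  fixes s :: "real \<Rightarrow> 'a::real_normed_vector"
  assumes s: "simple_function borel s" and fin: "(\<integral>\<^sup>+t. ennreal ((norm (s t))\<^sup>2) \<partial>lborel) < \<infinity>"
    and S: "S \<longlonglongrightarrow> 0"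
  shows "(\<lambda>n. \<integral>\<^sup>+t. ennreal ((norm (s (t + S n) - s t))\<^sup>2) \<partial>lborel) \<longlonglongrightarrow> 0"
proof -
  define R where "R = range s - {0}"
  have finR: "finite (range s)" "finite R" using s unfolding R_def simple_function_def by auto
  have B[measurable]: "s -` {v} \<in> sets borel" for v
    using simple_functionD(2)[OF s, of "{v}"] by simp
  have fB: "emeasure lborel (s -` {v}) < \<infinity>" if "v \<in> R" for v
  proof -
    have v: "v \<noteq> 0" using that by (auto simp: R_def)
    have "ennreal ((norm v)\<^sup>2) * emeasure lborel (s -` {v})
        = (\<integral>\<^sup>+t. ennreal ((norm v)\<^sup>2) * indicator (s -` {v}) t \<partial>lborel)"
      by (simp add: nn_integral_cmult_indicator)
    also have "\<dots> \<le> (\<integral>\<^sup>+t. ennreal ((norm (s t))\<^sup>2) \<partial>lborel)"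
      by (intro nn_integral_mono) (auto simp: indicator_def)
    also have "\<dots> < \<infinity>" by (rule fin)
    finally show ?thesis using v by (auto simp: ennreal_mult_less_top ennreal_mult_eq_top_iff less_top[symmetric])
  qed
  define M where "M = Max (norm ` range s)"
  have M: "norm (s t) \<le> M" for t using finR unfolding M_def by (intro Max_ge) auto
  have bound: "ennreal ((norm (s (t + h) - s t))\<^sup>2)
      \<le> ennreal ((2 * M)\<^sup>2) * (\<Sum>v\<in>R. indicator {t. (t + h \<in> s -` {v}) \<noteq> (t \<in> s -` {v})} t)" for t h
  proof (cases "s (t + h) = s t")
    case False
    then obtain v where v: "v \<in> R" "(t + h \<in> s -` {v}) \<noteq> (t \<in> s -` {v})"
      unfolding R_def by (cases "s t = 0") auto
    have "norm (s (t + h) - s t) \<le> 2 * M"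
      using M[of t] M[of "t + h"] norm_triangle_ineq4[of "s (t + h)" "s t"] by linarith
    then have "(norm (s (t + h) - s t))\<^sup>2 \<le> (2 * M)\<^sup>2" by (rule power_mono) simp
    then have "ennreal ((norm (s (t + h) - s t))\<^sup>2) \<le> ennreal ((2 * M)\<^sup>2) * 1"
      using ennreal_leI by simp
    also have "\<dots> \<le> ennreal ((2 * M)\<^sup>2) *
        (\<Sum>v\<in>R. indicator {t. (t + h \<in> s -` {v}) \<noteq> (t \<in> s -` {v})} t)"
    proof (rule mult_left_mono)
      show "(1::ennreal) \<le> (\<Sum>v\<in>R. indicator {t. (t + h \<in> s -` {v}) \<noteq> (t \<in> s -` {v})} t)"
        using finR v by (subst sum.remove[of _ v]) auto
    qed simp
    finally show ?thesis .
  qed simp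
  have le: "(\<integral>\<^sup>+t. ennreal ((norm (s (t + h) - s t))\<^sup>2) \<partial>lborel)
      \<le> ennreal ((2 * M)\<^sup>2) *
        (\<Sum>v\<in>R. \<integral>\<^sup>+t. indicator {t. (t + h \<in> s -` {v}) \<noteq> (t \<in> s -` {v})} t \<partial>lborel)" for h
  proof -
    have m: "(\<lambda>t. indicator {t. (t + h \<in> s -` {v}) \<noteq> (t \<in> s -` {v})} t :: ennreal)
        \<in> borel_measurable lborel" for v by measurable
    have "(\<integral>\<^sup>+t. ennreal ((norm (s (t + h) - s t))\<^sup>2) \<partial>lborel)
        \<le> (\<integral>\<^sup>+t. ennreal ((2 * M)\<^sup>2) *
            (\<Sum>v\<in>R. indicator {t. (t + h \<in> s -` {v}) \<noteq> (t \<in> s -` {v})} t) \<partial>lborel)"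
      by (intro nn_integral_mono bound)
    also have "\<dots> = ennreal ((2 * M)\<^sup>2) *
        (\<Sum>v\<in>R. \<integral>\<^sup>+t. indicator {t. (t + h \<in> s -` {v}) \<noteq> (t \<in> s -` {v})} t \<partial>lborel)"
      by (simp only: nn_integral_cmult[OF borel_measurable_sum[OF m]] nn_integral_sum[OF m])
    finally show ?thesis .
  qed
  have "(\<lambda>n. ennreal ((2 * M)\<^sup>2) *
      (\<Sum>v\<in>R. \<integral>\<^sup>+t. indicator {t. (t + S n \<in> s -` {v}) \<noteq> (t \<in> s -` {v})} t \<partial>lborel))
      \<longlonglongrightarrow> ennreal ((2 * M)\<^sup>2) * (\<Sum>v\<in>R. 0)"
    by (intro ennreal_tendsto_cmult tendsto_sum translate_indicator B fB S) auto
  then have "(\<lambda>n. ennreal ((2 * M)\<^sup>2) *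
      (\<Sum>v\<in>R. \<integral>\<^sup>+t. indicator {t. (t + S n \<in> s -` {v}) \<noteq> (t \<in> s -` {v})} t \<partial>lborel)) \<longlonglongrightarrow> 0"
    by simp
  from tendsto_sandwich[OF _ _ tendsto_const this] show ?thesis using le by auto
qed

lemma norm_diff_square_le3:
  fixes a b c d :: "'a::real_normed_vector"
  shows "(norm (a - d))\<^sup>2 \<le> 3 * (norm (a - b))\<^sup>2 + 3 * (norm (b - c))\<^sup>2 + 3 * (norm (c - d))\<^sup>2"
proof -
  have 1: "(x + y + z)\<^sup>2 \<le> 3 * x\<^sup>2 + 3 * y\<^sup>2 + 3 * z\<^sup>2" for x y z :: real
  proof -
    have "0 \<le> (x - y)\<^sup>2 + (y - z)\<^sup>2 + (x - z)\<^sup>2" by simp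
    then show ?thesis by (simp add: power2_eq_square algebra_simps)
  qed
  have "norm (a - d) \<le> norm (a - b) + norm (b - c) + norm (c - d)"
    using norm_triangle_ineq[of "a - b" "b - c"] norm_triangle_ineq[of "a - c" "c - d"] by simp
  then have "(norm (a - d))\<^sup>2 \<le> (norm (a - b) + norm (b - c) + norm (c - d))\<^sup>2"
    by (rule power_mono) simp
  also note 1
  finally show ?thesis .
qed

text \<open>Setting \<open>s n\<close> to zero where it exceeds \<open>2 \<parallel>f\<parallel>\<close> does not affect the pointwise limit and provides
  the integrable majorant \<open>9 \<parallel>f\<parallel>\<^sup>2\<close> of the squared error.\<close>

lemma simple_approximation:
  fixes f :: "real \<Rightarrow> 'a::real_normed_vector"
  assumes f: "simple_limit borel f" and fin: "(\<integral>\<^sup>+t. ennreal ((norm (f t))\<^sup>2) \<partial>lborel) < \<infinity>"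
  obtains s where "\<And>n::nat. simple_function borel (s n)"
    "\<And>n. (\<integral>\<^sup>+t. ennreal ((norm (s n t))\<^sup>2) \<partial>lborel) < \<infinity>"
    "(\<lambda>n. \<integral>\<^sup>+t. ennreal ((norm (f t - s n t))\<^sup>2) \<partial>lborel) \<longlonglongrightarrow> 0"
proof -
  obtain r where r: "\<And>n::nat. simple_function borel (r n)" "\<And>t. (\<lambda>n. r n t) \<longlonglongrightarrow> f t"
    using f unfolding simple_limit_def by auto
  define s where "s n t = (if norm (r n t) \<le> 2 * norm (f t) then r n t else 0)" for n t
  note [measurable] = simple_limit_norm_measurable[OF f]
  have rl: "simple_limit borel (r n)" for n
    using r(1) unfolding simple_limit_def by (intro exI[of _ "\<lambda>_. r n"]) auto
  note [measurable] = simple_limit_norm_measurable[OF rl]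
  have s: "simple_function borel (s n)" for n
    unfolding s_def by (intro simple_function_If r) auto
  have sl: "simple_limit borel (s n)" for n
    using s unfolding simple_limit_def by (intro exI[of _ "\<lambda>_. s n"]) auto
  note [measurable] = simple_limit_norm_measurable[OF simple_limit_diff[OF f sl]]
  have le: "norm (s n t) \<le> 2 * norm (f t)" for n t by (simp add: s_def)
  have lim: "(\<lambda>n. s n t) \<longlonglongrightarrow> f t" for t
  proof (cases "f t = 0")
    case True
    then have "s n t = 0" for n using le[of n t] by simp
    with True show ?thesis by simp
  next
    case False
    have "(\<lambda>n. norm (r n t)) \<longlonglongrightarrow> norm (f t)" using r(2) by (intro tendsto_norm)
    then have "\<forall>\<^sub>F n in sequentially. norm (r n t) < 2 * norm (f t)"
      by (rule order_tendstoD(2)) (use False in simp)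
    then have "\<forall>\<^sub>F n in sequentially. r n t = s n t" by eventually_elim (simp add: s_def)
    then show ?thesis by (rule Lim_transform_eventually[OF r(2)])
  qed
  have finC: "(\<integral>\<^sup>+t. ennreal (c * (norm (f t))\<^sup>2) \<partial>lborel) < \<infinity>" if "c \<ge> 0" for c
    using that fin by (simp add: ennreal_mult nn_integral_cmult ennreal_mult_less_top)
  have "(\<lambda>n. \<integral>\<^sup>+t. ennreal ((norm (f t - s n t))\<^sup>2) \<partial>lborel) \<longlonglongrightarrow> (\<integral>\<^sup>+t. (0::ennreal) \<partial>(lborel :: real measure))"
  proof (rule nn_integral_dominated_convergence[where w = "\<lambda>t. ennreal (9 * (norm (f t))\<^sup>2)"])
    have "(norm (f t - s n t))\<^sup>2 \<le> 9 * (norm (f t))\<^sup>2" for n t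
    proof -
      have "norm (f t - s n t) \<le> 3 * norm (f t)"
        using le[of n t] norm_triangle_ineq4[of "f t" "s n t"] by linarith
      then have "(norm (f t - s n t))\<^sup>2 \<le> (3 * norm (f t))\<^sup>2" by (rule power_mono) simp
      then show ?thesis by (simp add: power_mult_distrib)
    qed
    then show "AE t in lborel. ennreal ((norm (f t - s n t))\<^sup>2) \<le> ennreal (9 * (norm (f t))\<^sup>2)" for n
      by (intro AE_I2 ennreal_leI)
    show "AE t in lborel. (\<lambda>n. ennreal ((norm (f t - s n t))\<^sup>2)) \<longlonglongrightarrow> 0"
    proof (rule AE_I2)
      fix t
      have "(\<lambda>n. ennreal ((norm (f t - s n t))\<^sup>2)) \<longlonglongrightarrow> ennreal ((norm (f t - f t))\<^sup>2)"
        by (intro tendsto_ennrealI tendsto_intros lim)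
      then show "(\<lambda>n. ennreal ((norm (f t - s n t))\<^sup>2)) \<longlonglongrightarrow> 0" by simp
    qed
  qed (use finC in \<open>auto\<close>)
  moreover have "(\<integral>\<^sup>+t. ennreal ((norm (s n t))\<^sup>2) \<partial>lborel) < \<infinity>" for n
  proof -
    have "(\<integral>\<^sup>+t. ennreal ((norm (s n t))\<^sup>2) \<partial>lborel) \<le> (\<integral>\<^sup>+t. ennreal (4 * (norm (f t))\<^sup>2) \<partial>lborel)"
    proof (intro nn_integral_mono ennreal_leI)
      fix t
      have "(norm (s n t))\<^sup>2 \<le> (2 * norm (f t))\<^sup>2" using le by (rule power_mono) simp
      then show "(norm (s n t))\<^sup>2 \<le> 4 * (norm (f t))\<^sup>2" by (simp add: power_mult_distrib)
    qed
    then show ?thesis using finC[of 4] by (rule le_less_trans) simp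
  qed
  ultimately show ?thesis using that[of s] s by simp
qed

lemma translate_L2:
  fixes f :: "real \<Rightarrow> 'a::real_normed_vector"
  assumes f: "simple_limit borel f" and fin: "(\<integral>\<^sup>+t. ennreal ((norm (f t))\<^sup>2) \<partial>lborel) < \<infinity>"
    and S: "S \<longlonglongrightarrow> 0"
  shows "(\<lambda>n. \<integral>\<^sup>+t. ennreal ((norm (f (t + S n) - f t))\<^sup>2) \<partial>lborel) \<longlonglongrightarrow> 0"
proof (rule tendsto_ennreal_0I)
  fix e :: real assume e: "e > 0"
  then have e9: "e / 9 > 0" by simp
  obtain s where s: "\<And>n::nat. simple_function borel (s n)"
    "\<And>n. (\<integral>\<^sup>+t. ennreal ((norm (s n t))\<^sup>2) \<partial>lborel) < \<infinity>"
    "(\<lambda>n. \<integral>\<^sup>+t. ennreal ((norm (f t - s n t))\<^sup>2) \<partial>lborel) \<longlonglongrightarrow> 0"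
    using simple_approximation[OF f fin] by blast
  obtain k where k: "(\<integral>\<^sup>+t. ennreal ((norm (f t - s k t))\<^sup>2) \<partial>lborel) \<le> ennreal (e / 9)"
    using eventually_happens'[OF sequentially_bot tendsto_ennreal_0D[OF s(3) e9]] by blast
  have sl: "simple_limit borel (s k)"
    using s(1) unfolding simple_limit_def by (intro exI[of _ "\<lambda>_. s k"]) auto
  note [measurable] = simple_limit_norm_measurable[OF simple_limit_diff[OF f sl]]
    simple_limit_norm_measurable[OF simple_limit_diff[OF sl f]]
  have tr: "(\<lambda>t. t + h) \<in> borel_measurable borel" for h :: real by measurable
  have [measurable]: "(\<lambda>t. norm (s k (t + h) - s k t)) \<in> borel_measurable borel" for h
    by (intro simple_limit_norm_measurable simple_limit_diff simple_limit_comp[OF tr sl] sl)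
  have shift: "(\<integral>\<^sup>+t. ennreal ((norm (f (t + h) - s k (t + h)))\<^sup>2) \<partial>lborel)
      = (\<integral>\<^sup>+t. ennreal ((norm (f t - s k t))\<^sup>2) \<partial>lborel)" for h
    by (rule nn_integral_translate) measurable
  show "\<forall>\<^sub>F n in sequentially. (\<integral>\<^sup>+t. ennreal ((norm (f (t + S n) - f t))\<^sup>2) \<partial>lborel) \<le> ennreal e"
    using tendsto_ennreal_0D[OF translate_simple[OF s(1,2) S, of k] e9]
  proof eventually_elim
    case (elim n)
    have "(\<integral>\<^sup>+t. ennreal ((norm (f (t + S n) - f t))\<^sup>2) \<partial>lborel)
      \<le> (\<integral>\<^sup>+t. 3 * ennreal ((norm (f (t + S n) - s k (t + S n)))\<^sup>2)
          + (3 * ennreal ((norm (s k (t + S n) - s k t))\<^sup>2) + 3 * ennreal ((norm (f t - s k t))\<^sup>2)) \<partial>lborel)"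
    proof (rule nn_integral_mono)
      fix t
      have "ennreal ((norm (f (t + S n) - f t))\<^sup>2) \<le>
        ennreal (3 * (norm (f (t + S n) - s k (t + S n)))\<^sup>2
          + (3 * (norm (s k (t + S n) - s k t))\<^sup>2 + 3 * (norm (f t - s k t))\<^sup>2))"
        using norm_diff_square_le3[of "f (t + S n)" "f t" "s k (t + S n)" "s k t"]
        by (intro ennreal_leI) (simp add: norm_minus_commute)
      then show "ennreal ((norm (f (t + S n) - f t))\<^sup>2) \<le>
        3 * ennreal ((norm (f (t + S n) - s k (t + S n)))\<^sup>2)
          + (3 * ennreal ((norm (s k (t + S n) - s k t))\<^sup>2) + 3 * ennreal ((norm (f t - s k t))\<^sup>2))"
        by (simp add: ennreal_plus ennreal_mult)
    qed
    also have "\<dots> = 3 * (\<integral>\<^sup>+t. ennreal ((norm (f t - s k t))\<^sup>2) \<partial>lborel)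
          + (3 * (\<integral>\<^sup>+t. ennreal ((norm (s k (t + S n) - s k t))\<^sup>2) \<partial>lborel)
          + 3 * (\<integral>\<^sup>+t. ennreal ((norm (f t - s k t))\<^sup>2) \<partial>lborel))"
    proof -
      have [measurable]: "(\<lambda>t. norm (f (t + S n) - s k (t + S n))) \<in> borel_measurable borel"
        by (intro simple_limit_norm_measurable simple_limit_diff simple_limit_comp[OF tr] sl f)
      show ?thesis by (simp add: nn_integral_add nn_integral_cmult shift)
    qed
    also have "\<dots> \<le> 3 * ennreal (e / 9) + (3 * ennreal (e / 9) + 3 * ennreal (e / 9))"
      using k elim by (intro add_mono mult_left_mono) auto
    also have "\<dots> = ennreal (3 * (e / 9)) + (ennreal (3 * (e / 9)) + ennreal (3 * (e / 9)))"
      using e by (simp only: ennreal_mult ennreal_numeral) 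
    also have "\<dots> = ennreal e" using e by (simp flip: ennreal_plus)
    finally show ?case .
  qed
qed

section \<open>Integrals of products\<close>

lemma integrable_product_of_squares:
  fixes f h :: "'b \<Rightarrow> real"
  assumes [measurable]: "f \<in> borel_measurable M" "h \<in> borel_measurable M"
    and "integrable M (\<lambda>x. (f x)\<^sup>2)" "integrable M (\<lambda>x. (h x)\<^sup>2)"
  shows "integrable M (\<lambda>x. f x * h x)"
proof (rule Bochner_Integration.integrable_bound)
  show "integrable M (\<lambda>x. (f x)\<^sup>2 + (h x)\<^sup>2)" using assms by simp
  have "\<bar>a * b\<bar> \<le> a\<^sup>2 + b\<^sup>2" for a b :: real
  proof -
    have "2 * (\<bar>a\<bar> * \<bar>b\<bar>) \<le> a\<^sup>2 + b\<^sup>2" using sum_squares_bound[of "\<bar>a\<bar>" "\<bar>b\<bar>"] by simp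
    moreover have "0 \<le> \<bar>a\<bar> * \<bar>b\<bar>" by simp
    ultimately show ?thesis unfolding abs_mult by linarith
  qed
  then show "AE x in M. norm (f x * h x) \<le> norm ((f x)\<^sup>2 + (h x)\<^sup>2)" by simp
qed measurable

lemma Cauchy_Schwarz_integral:
  fixes f h :: "'b \<Rightarrow> real"
  assumes [measurable]: "f \<in> borel_measurable M" "h \<in> borel_measurable M"
    and f: "integrable M (\<lambda>x. (f x)\<^sup>2)" and h: "integrable M (\<lambda>x. (h x)\<^sup>2)"
  shows "(\<integral>x. \<bar>f x\<bar> * \<bar>h x\<bar> \<partial>M) \<le> sqrt ((\<integral>x. (f x)\<^sup>2 \<partial>M) * (\<integral>x. (h x)\<^sup>2 \<partial>M))"
proof -
  have i: "integrable M (\<lambda>x. \<bar>f x\<bar> * \<bar>h x\<bar>)"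
    using integrable_product_of_squares[of "\<lambda>x. \<bar>f x\<bar>" M "\<lambda>x. \<bar>h x\<bar>"] f h by simp
  have "(\<integral>\<^sup>+x. ennreal \<bar>f x\<bar> * ennreal \<bar>h x\<bar> \<partial>M)\<^sup>2
      \<le> (\<integral>\<^sup>+x. ennreal \<bar>f x\<bar> ^ 2 \<partial>M) * (\<integral>\<^sup>+x. ennreal \<bar>h x\<bar> ^ 2 \<partial>M)"
    by (rule Cauchy_Schwarz_nn_integral) measurable
  moreover have "(\<integral>\<^sup>+x. ennreal \<bar>f x\<bar> * ennreal \<bar>h x\<bar> \<partial>M) = ennreal (\<integral>x. \<bar>f x\<bar> * \<bar>h x\<bar> \<partial>M)"
    using i by (subst nn_integral_eq_integral[symmetric]) (auto simp: ennreal_mult)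
  moreover have "(\<integral>\<^sup>+x. ennreal \<bar>f x\<bar> ^ 2 \<partial>M) = ennreal (\<integral>x. (f x)\<^sup>2 \<partial>M)"
    using f by (subst nn_integral_eq_integral[symmetric]) (auto simp: ennreal_power)
  moreover have "(\<integral>\<^sup>+x. ennreal \<bar>h x\<bar> ^ 2 \<partial>M) = ennreal (\<integral>x. (h x)\<^sup>2 \<partial>M)"
    using h by (subst nn_integral_eq_integral[symmetric]) (auto simp: ennreal_power)
  ultimately have "ennreal ((\<integral>x. \<bar>f x\<bar> * \<bar>h x\<bar> \<partial>M)\<^sup>2)
      \<le> ennreal ((\<integral>x. (f x)\<^sup>2 \<partial>M) * (\<integral>x. (h x)\<^sup>2 \<partial>M))"
    by (simp add: ennreal_power ennreal_mult)
  then have "(\<integral>x. \<bar>f x\<bar> * \<bar>h x\<bar> \<partial>M)\<^sup>2 \<le> (\<integral>x. (f x)\<^sup>2 \<partial>M) * (\<integral>x. (h x)\<^sup>2 \<partial>M)"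
    by (subst (asm) ennreal_le_iff) auto
  then show ?thesis by (rule real_le_rsqrt)
qed

lemma continuous_prim:
  assumes f: "integrable lborel f"
  shows "continuous_on UNIV (prim f)"
proof (rule continuous_at_imp_continuous_on, rule ballI, unfold continuous_at_sequentially, intro allI impI)
  fix t and u :: "nat \<Rightarrow> real" assume u: "u \<longlonglongrightarrow> t"
  note [measurable] = borel_measurable_integrable[OF f]
  have "(\<lambda>n. prim f (u n)) \<longlonglongrightarrow> prim f t"
    unfolding prim_def
  proof (rule integral_dominated_convergence[where w = "\<lambda>x. norm (f x)"])
    show "AE x in lborel. (\<lambda>n. if x \<le> u n then f x else 0) \<longlonglongrightarrow> (if x \<le> t then f x else 0)"
      using AE_lborel_singleton[of t]
    proof eventually_elim
      case (elim x)
      consider "x < t" | "t < x" using elim by linarith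
      then show ?case
      proof cases
        case 1
        have "\<forall>\<^sub>F n in sequentially. x < u n" using order_tendstoD(1)[OF u 1] .
        then have "\<forall>\<^sub>F n in sequentially. (if x \<le> u n then f x else 0) = (if x \<le> t then f x else 0)"
          by eventually_elim (use 1 in auto)
        then show ?thesis by (rule tendsto_eventually)
      next
        case 2
        have "\<forall>\<^sub>F n in sequentially. u n < x" using order_tendstoD(2)[OF u 2] .
        then have "\<forall>\<^sub>F n in sequentially. (if x \<le> u n then f x else 0) = (if x \<le> t then f x else 0)"
          by eventually_elim (use 2 in auto)
        then show ?thesis by (rule tendsto_eventually)
      qed
    qed
  qed (use f in auto)
  then show "(prim f \<circ> u) \<longlonglongrightarrow> prim f t" by (simp add: comp_def)
qed

lemma AE_ex_in_interval:
  fixes a b :: real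
  assumes "a < b" "AE x in lborel. P x"
  shows "\<exists>x\<in>{a<..<b}. P x"
proof (rule ccontr)
  assume *: "\<not> ?thesis"
  have "AE x in lborel. x \<notin> {a<..<b}" using assms(2) by eventually_elim (use * in auto)
  then have "emeasure lborel {a<..<b} = 0"
    by (subst (asm) AE_iff_measurable[OF _ refl]) (auto simp: Collect_conj_eq[symmetric] greaterThanLessThan_def greaterThan_def lessThan_def Int_def)
  then show False using assms(1) by simp
qed

lemma abs_blinfun_le: "\<bar>blinfun_apply f x\<bar> \<le> norm f * norm x"
  using norm_blinfun[of f x] by simp

lemma integrable_norm_of_square:
  fixes f :: "real \<Rightarrow> 'a::real_normed_vector"
  assumes f: "simple_limit borel f" "integrable lborel (\<lambda>t. (norm (f t))\<^sup>2)"
    and supp: "\<And>t. t \<notin> {0<..<T} \<Longrightarrow> f t = 0"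
  shows "integrable lborel (\<lambda>t. norm (f t))"
proof -
  have "emeasure lborel {0<..<T} < \<infinity>" by (cases "0 \<le> T") auto
  then have "integrable lborel (\<lambda>t. norm (f t) * indicator {0<..<T} t)"
    using simple_limit_norm_measurable[OF f(1)] f(2)
    by (intro integrable_product_of_squares)
       (auto simp: power2_eq_square indicator_inter_arith[symmetric])
  moreover have "norm (f t) * indicator {0<..<T} t = norm (f t)" for t
    using supp[of t] by (cases "t \<in> {0<..<T}") auto
  ultimately show ?thesis by simp
qed

lemma measurable_functional:
  fixes L :: "'a::real_normed_vector \<Rightarrow> real"
  assumes f: "simple_limit M f" and L: "bounded_linear L"
  shows "(\<lambda>t. L (f t)) \<in> borel_measurable M"
  by (rule simple_limit_measurable, rule simple_limit_map2[OF f f, of "\<lambda>x y. L x"])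
     (rule bounded_linear.tendsto[OF L])

lemma integrable_functional:
  fixes L :: "'a::real_normed_vector \<Rightarrow> real"
  assumes f: "simple_limit M f" "integrable M (\<lambda>t. norm (f t))" and L: "bounded_linear L"
  shows "integrable M (\<lambda>t. L (f t))"
proof -
  obtain K where K: "\<And>x. norm (L x) \<le> norm x * K"
    using bounded_linear.bounded[OF L] by blast
  show ?thesis
  proof (rule Bochner_Integration.integrable_bound[of _ "\<lambda>t. norm (f t) * K"])
    show "(\<lambda>t. L (f t)) \<in> borel_measurable M" by (rule measurable_functional[OF f(1) L])
    show "AE t in M. norm (L (f t)) \<le> norm (norm (f t) * K)"
      using K order_trans[OF K abs_ge_self] by (intro AE_I2) simp
  qed (use f in simp)
qed

section \<open>Continuity in \<open>H\<close> and the energy identity\<close>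

text \<open>The function \<open>w\<close> is a Borel measurable representative of an element of \<open>X\<close>, extended by zero, and
  \<open>g\<close> is one of its weak derivative.\<close>

locale weak_pair =
  fixes j :: "'v::real_inner \<Rightarrow> 'h::{real_inner,complete_space}" and T :: real
    and w :: "real \<Rightarrow> 'v" and g :: "real \<Rightarrow> 'v \<Rightarrow>\<^sub>L real"
  assumes j: "bounded_linear j" and T: "T > 0"
    and wl: "simple_limit borel w" and gl: "simple_limit borel g"
    and w2: "integrable lborel (\<lambda>t. (norm (w t))\<^sup>2)" and g2: "integrable lborel (\<lambda>t. (norm (g t))\<^sup>2)"
    and w0: "\<And>t. t \<notin> {0<..<T} \<Longrightarrow> w t = 0" and g0: "\<And>t. t \<notin> {0<..<T} \<Longrightarrow> g t = 0"
    and weak: "\<And>\<phi> v. test_function T \<phi> \<Longrightarrow>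
      (\<integral>t. deriv \<phi> t * (j (w t) \<bullet> j v) \<partial>lborel) = - (\<integral>t. \<phi> t * blinfun_apply (g t) v \<partial>lborel)"
begin

lemmas [measurable] = simple_limit_norm_measurable[OF wl] simple_limit_norm_measurable[OF gl]
  simple_limit_pairing_measurable[OF gl wl] simple_limit_pairing_measurable[OF gl simple_limit_const]

lemma integrable_norm_w: "integrable lborel (\<lambda>t. norm (w t))"
  by (rule integrable_norm_of_square[OF wl w2 w0])

lemma integrable_norm_g: "integrable lborel (\<lambda>t. norm (g t))"
  by (rule integrable_norm_of_square[OF gl g2 g0])

lemma integrable_norm_gw: "integrable lborel (\<lambda>t. norm (g t) * norm (w t))"
  by (rule integrable_product_of_squares) (use w2 g2 in auto)

lemma integrable_g_const: "integrable lborel (\<lambda>t. blinfun_apply (g t) v)"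
proof -
  have "simple_limit lborel g" using gl unfolding simple_limit_def simple_function_def by simp
  then show ?thesis
    by (rule integrable_functional[OF _ integrable_norm_g]) (rule blinfun.bounded_linear_left)
qed

lemma integrable_gw: "integrable lborel (\<lambda>t. blinfun_apply (g t) (w t))"
  by (rule Bochner_Integration.integrable_bound[OF integrable_norm_gw])
     (use abs_blinfun_le in auto)

lemma measurable_jw [measurable]: "(\<lambda>t. norm (j (w t))) \<in> borel_measurable borel"
proof -
  have "simple_limit borel (\<lambda>t. j (w t))"
    by (rule simple_limit_map2[OF wl wl, of "\<lambda>x y. j x"]) (rule bounded_linear.tendsto[OF j])
  then show ?thesis by (rule simple_limit_norm_measurable)
qed

lemma integrable_jw_const: "integrable lborel (\<lambda>t. j (w t) \<bullet> j v)"
proof -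
  have "simple_limit lborel w" using wl unfolding simple_limit_def simple_function_def by simp
  then show ?thesis
    by (rule integrable_functional[OF _ integrable_norm_w])
       (rule bounded_linear_compose[OF bounded_linear_inner_left j])
qed

lemma integrable_jw_square: "integrable lborel (\<lambda>t. (norm (j (w t)))\<^sup>2)"
proof -
  obtain K where K: "K > 0" "\<And>x. norm (j x) \<le> norm x * K"
    using bounded_linear.pos_bounded[OF j] by blast
  show ?thesis
  proof (rule Bochner_Integration.integrable_bound[of _ "\<lambda>t. (norm (w t))\<^sup>2 * K\<^sup>2"])
    have "(norm (j (w t)))\<^sup>2 \<le> (norm (w t))\<^sup>2 * K\<^sup>2" for t
      using K(2)[of "w t"] by (simp flip: power_mult_distrib add: power_mono)
    then show "AE t in lborel. norm ((norm (j (w t)))\<^sup>2) \<le> norm ((norm (w t))\<^sup>2 * K\<^sup>2)" by simp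
  qed (use w2 in auto)
qed

definition increment_at :: "real \<Rightarrow> real \<Rightarrow> bool" where
  "increment_at s t \<longleftrightarrow> (\<forall>r. (j (w t) - j (w s)) \<bullet> j (w r) =
     prim (\<lambda>x. blinfun_apply (g x) (w r)) t - prim (\<lambda>x. blinfun_apply (g x) (w r)) s)"

text \<open>For each test vector \<open>v\<close>, the weak derivative determines \<open>j (w t) \<bullet> j v\<close> up to a constant, off a null
  set depending on \<open>v\<close>. One null set serves for all values of \<open>w\<close> as test vectors, because these are limits of the countably
  many values of simple functions.\<close>

lemma ex_increment_set:
  obtains E where "E \<in> sets borel" "E \<subseteq> {0<..<T}" "AE t in lborel. t \<in> {0<..<T} \<longrightarrow> t \<in> E"
    "\<And>s t. s \<in> E \<Longrightarrow> t \<in> E \<Longrightarrow> increment_at s t"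
proof -
  obtain s where s: "\<And>n::nat. simple_function borel (s n)" "\<And>t. (\<lambda>n. s n t) \<longlonglongrightarrow> w t"
    using wl unfolding simple_limit_def by auto
  define Q where "Q = (\<Union>n. range (s n))"
  have "finite (range (s n))" for n using s(1)[of n] by (simp add: simple_function_def)
  then have cQ: "countable Q" unfolding Q_def by (intro countable_UN) (auto intro: countable_finite)
  have "\<forall>q. \<exists>c. AE t in lborel. t \<in> {0<..<T} \<longrightarrow>
      j (w t) \<bullet> j q = c + prim (\<lambda>x. blinfun_apply (g x) q) t"
    using weak_derivative_imp_primitive[OF integrable_jw_const integrable_g_const T weak] by blast
  then obtain c where c: "\<And>q. AE t in lborel. t \<in> {0<..<T} \<longrightarrow>
      j (w t) \<bullet> j q = c q + prim (\<lambda>x. blinfun_apply (g x) q) t" by metis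
  then have "AE t in lborel. \<forall>q\<in>Q. t \<in> {0<..<T} \<longrightarrow>
      j (w t) \<bullet> j q = c q + prim (\<lambda>x. blinfun_apply (g x) q) t"
    unfolding AE_ball_countable[OF cQ] by blast
  then obtain N where N: "N \<in> null_sets lborel"
    "{t. \<not> (\<forall>q\<in>Q. t \<in> {0<..<T} \<longrightarrow> j (w t) \<bullet> j q = c q + prim (\<lambda>x. blinfun_apply (g x) q) t)} \<subseteq> N"
    by (auto elim!: AE_E simp: null_sets_def)
  define E where "E = {0<..<T} - N"
  have "E \<in> sets borel" using N(1) by (auto simp: E_def null_sets_def)
  moreover have "AE t in lborel. t \<in> {0<..<T} \<longrightarrow> t \<in> E"
    using AE_not_in[OF N(1)] by eventually_elim (auto simp: E_def)
  moreover have "increment_at s' t" if E: "s' \<in> E" "t \<in> E" for s' t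
    unfolding increment_at_def
  proof
    fix r
    have q: "(j (w t) - j (w s')) \<bullet> j q =
        prim (\<lambda>x. blinfun_apply (g x) q) t - prim (\<lambda>x. blinfun_apply (g x) q) s'" if "q \<in> Q" for q
    proof -
      have "j (w t) \<bullet> j q = c q + prim (\<lambda>x. blinfun_apply (g x) q) t"
        "j (w s') \<bullet> j q = c q + prim (\<lambda>x. blinfun_apply (g x) q) s'"
        using E N(2) that unfolding E_def by blast+
      then show ?thesis by (simp add: inner_diff_left)
    qed
    have P: "(\<lambda>n. prim (\<lambda>x. blinfun_apply (g x) (s n r)) t')
        \<longlonglongrightarrow> prim (\<lambda>x. blinfun_apply (g x) (w r)) t'" for t'
    proof (rule Lim_null_comparison[THEN LIM_zero_cancel])
      have "norm (prim (\<lambda>x. blinfun_apply (g x) (s n r)) t' - prim (\<lambda>x. blinfun_apply (g x) (w r)) t')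
        \<le> (\<integral>x. norm (g x) \<partial>lborel) * norm (s n r - w r)" for n
      proof -
        have "prim (\<lambda>x. blinfun_apply (g x) (s n r)) t' - prim (\<lambda>x. blinfun_apply (g x) (w r)) t'
            = prim (\<lambda>x. blinfun_apply (g x) (s n r - w r)) t'"
          unfolding prim_def
          by (subst Bochner_Integration.integral_diff[symmetric])
             (auto intro!: integrable_if_le integrable_g_const Bochner_Integration.integral_cong
               simp: blinfun.diff_right)
        also have "\<bar>\<dots>\<bar> \<le> (\<integral>x. \<bar>blinfun_apply (g x) (s n r - w r)\<bar> \<partial>lborel)"
          by (rule prim_bound[OF integrable_g_const])
        also have "\<dots> \<le> (\<integral>x. norm (g x) * norm (s n r - w r) \<partial>lborel)"
          using integrable_g_const integrable_norm_g abs_blinfun_le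
          by (intro integral_mono) (auto simp del: blinfun.diff_right)
        finally show ?thesis by simp
      qed
      then show "\<forall>\<^sub>F n in sequentially. norm (prim (\<lambda>x. blinfun_apply (g x) (s n r)) t'
          - prim (\<lambda>x. blinfun_apply (g x) (w r)) t') \<le> (\<integral>x. norm (g x) \<partial>lborel) * norm (s n r - w r)"
        by simp
      have "(\<lambda>n. (\<integral>x. norm (g x) \<partial>lborel) * norm (s n r - w r))
          \<longlonglongrightarrow> (\<integral>x. norm (g x) \<partial>lborel) * norm (w r - w r)"
        by (intro tendsto_intros s(2))
      then show "(\<lambda>n. (\<integral>x. norm (g x) \<partial>lborel) * norm (s n r - w r)) \<longlonglongrightarrow> 0" by simp
    qed
    have "(\<lambda>n. (j (w t) - j (w s')) \<bullet> j (s n r)) \<longlonglongrightarrow> (j (w t) - j (w s')) \<bullet> j (w r)"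
      by (intro tendsto_inner bounded_linear.tendsto[OF j] tendsto_const s(2))
    moreover have "s n r \<in> Q" for n unfolding Q_def by blast
    moreover have "(\<lambda>n. prim (\<lambda>x. blinfun_apply (g x) (s n r)) t - prim (\<lambda>x. blinfun_apply (g x) (s n r)) s')
        \<longlonglongrightarrow> prim (\<lambda>x. blinfun_apply (g x) (w r)) t - prim (\<lambda>x. blinfun_apply (g x) (w r)) s'"
      by (intro tendsto_diff P)
    ultimately show "(j (w t) - j (w s')) \<bullet> j (w r) =
        prim (\<lambda>x. blinfun_apply (g x) (w r)) t - prim (\<lambda>x. blinfun_apply (g x) (w r)) s'"
      using q by (auto intro: LIMSEQ_unique)
  qed
  moreover have "E \<subseteq> {0<..<T}" by (auto simp: E_def)
  ultimately show ?thesis using that by blast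
qed

lemma small_translation:
  assumes "e > 0"
  obtains d where "d > 0"
    "\<And>k. \<bar>k\<bar> < d \<Longrightarrow> (\<integral>\<^sup>+t. ennreal (norm (g t)) * ennreal (norm (w (t + k) - w t)) \<partial>lborel) \<le> ennreal e"
proof -
  define I where "I k = (\<integral>\<^sup>+t. ennreal (norm (g t)) * ennreal (norm (w (t + k) - w t)) \<partial>lborel)" for k
  define G where "G = (\<integral>\<^sup>+t. ennreal ((norm (g t))\<^sup>2) \<partial>lborel)"
  define W where "W k = (\<integral>\<^sup>+t. ennreal ((norm (w (t + k) - w t))\<^sup>2) \<partial>lborel)" for k
  have G: "G < \<infinity>" using g2 unfolding G_def by (simp add: nn_integral_eq_integral)
  have fw: "(\<integral>\<^sup>+t. ennreal ((norm (w t))\<^sup>2) \<partial>lborel) < \<infinity>" using w2 by (simp add: nn_integral_eq_integral)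
  have tr: "(\<lambda>t. t + h) \<in> borel_measurable borel" for h :: real by measurable
  have [measurable]: "(\<lambda>t. norm (w (t + k) - w t)) \<in> borel_measurable borel" for k
    by (intro simple_limit_norm_measurable simple_limit_diff simple_limit_comp[OF tr] wl)
  have IW: "(I k)\<^sup>2 \<le> G * W k" for k
    using Cauchy_Schwarz_nn_integral[of "\<lambda>t. ennreal (norm (g t))" lborel "\<lambda>t. ennreal (norm (w (t + k) - w t))"]
    unfolding I_def G_def W_def by (simp add: ennreal_power)
  have "W \<midarrow>0\<rightarrow> 0"
    unfolding LIMSEQ_SEQ_conv[symmetric] W_def using translate_L2[OF wl fw] by blast
  then have "(\<lambda>k. G * W k) \<midarrow>0\<rightarrow> G * 0" using G by (intro ennreal_tendsto_cmult) auto
  then have "\<forall>\<^sub>F k in at 0. G * W k \<le> ennreal (e\<^sup>2)"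
    using assms by (intro tendsto_ennreal_0D) auto
  then obtain d where d: "d > 0" "\<And>k. k \<noteq> 0 \<Longrightarrow> \<bar>k\<bar> < d \<Longrightarrow> G * W k \<le> ennreal (e\<^sup>2)"
    unfolding eventually_at by (auto simp: dist_real_def)
  have "I k \<le> ennreal e" if "\<bar>k\<bar> < d" for k
  proof (cases "k = 0")
    case False
    have "(I k)\<^sup>2 \<le> (ennreal e)\<^sup>2"
      using IW[of k] d(2)[OF False that] assms by (simp add: ennreal_power)
    then show ?thesis
    proof (cases "I k")
      case (real r)
      with \<open>(I k)\<^sup>2 \<le> (ennreal e)\<^sup>2\<close> assms have "r\<^sup>2 \<le> e\<^sup>2" by (simp add: ennreal_power)
      then show ?thesis using real assms by (auto intro!: ennreal_leI power2_le_imp_le)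
    next
      case top
      with \<open>(I k)\<^sup>2 \<le> (ennreal e)\<^sup>2\<close> assms show ?thesis by (simp add: ennreal_power top_unique)
    qed
  qed (simp add: I_def)
  with d(1) show ?thesis using that unfolding I_def by blast
qed

text \<open>This quantity, for \<open>a = 0\<close> and \<open>a = h\<close>, bounds the deviation from the energy identity over
  \<open>(t, t + h)\<close>.\<close>

definition window :: "real \<Rightarrow> real \<Rightarrow> real \<Rightarrow> ennreal" where
  "window h a t = (\<integral>\<^sup>+x. indicator {t<..t + h} x *
     (ennreal (norm (g x)) * ennreal (norm (w (t + a) - w x))) \<partial>lborel)"

lemma measurable_window: "window h a \<in> borel_measurable borel"
proof -
  have [measurable]: "(\<lambda>x. norm (w (fst x + a) - w (snd x))) \<in> borel_measurable (borel \<Otimes>\<^sub>M lborel)"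
    by (intro simple_limit_norm_measurable simple_limit_diff simple_limit_comp[OF _ wl]) measurable
  have "(\<lambda>(t, x). if t < x \<and> x \<le> t + h
        then ennreal (norm (g x)) * ennreal (norm (w (t + a) - w x)) else 0)
      \<in> borel_measurable (borel \<Otimes>\<^sub>M lborel)"
    unfolding split_beta by measurable
  moreover have "window h a = (\<lambda>t. \<integral>\<^sup>+x. (if t < x \<and> x \<le> t + h
        then ennreal (norm (g x)) * ennreal (norm (w (t + a) - w x)) else 0) \<partial>lborel)"
    unfolding window_def by (intro ext nn_integral_cong) simp
  ultimately show ?thesis
    by (simp only:) (rule lborel.borel_measurable_nn_integral)
qed

text \<open>After the substitution \<open>x = t + y\<close>, Tonelli's theorem permits integrating over \<open>t\<close> first, for
  fixed \<open>y \<in> (0, h]\<close>; then only values of \<open>w\<close> at points of fixed distance \<open>\<bar>a - y\<bar> \<le> h\<close> are compared.\<close>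

lemma window_integral_le:
  assumes h: "h > 0" and e: "e > 0" and a: "a = 0 \<or> a = h"
    and small: "\<And>k. \<bar>k\<bar> \<le> h \<Longrightarrow>
      (\<integral>\<^sup>+t. ennreal (norm (g t)) * ennreal (norm (w (t + k) - w t)) \<partial>lborel) \<le> ennreal e"
  shows "(\<integral>\<^sup>+t. window h a t \<partial>lborel) \<le> ennreal (h * e)"
proof -
  have [measurable]: "(\<lambda>x. norm (w (fst x + a) - w (fst x + snd x))) \<in> borel_measurable (lborel \<Otimes>\<^sub>M lborel)"
    by (intro simple_limit_norm_measurable simple_limit_diff simple_limit_comp[OF _ wl]) measurable
  have tr: "(\<lambda>t. t + h) \<in> borel_measurable borel" for h :: real by measurable
  have [measurable]: "(\<lambda>x. norm (w c - w x)) \<in> borel_measurable borel" for c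
    by (intro simple_limit_norm_measurable simple_limit_diff simple_limit_const wl)
  have [measurable]: "(\<lambda>t. norm (w (t + k) - w t)) \<in> borel_measurable borel" for k
    by (intro simple_limit_norm_measurable simple_limit_diff simple_limit_comp[OF tr] wl)
  have "(\<integral>\<^sup>+t. window h a t \<partial>lborel) = (\<integral>\<^sup>+t. \<integral>\<^sup>+y. indicator {0<..h} y * (ennreal (norm (g (t + y))) * ennreal (norm (w (t + a) - w (t + y)))) \<partial>lborel \<partial>lborel)"
  proof (rule nn_integral_cong)
    fix t
    have "(\<lambda>x. indicator {t<..t + h} x * (ennreal (norm (g x)) * ennreal (norm (w (t + a) - w x))))
        \<in> borel_measurable borel" by measurable
    from nn_integral_translate[OF this, of t, symmetric]
    show "window h a t = (\<integral>\<^sup>+y. indicator {0<..h} y * (ennreal (norm (g (t + y))) * ennreal (norm (w (t + a) - w (t + y)))) \<partial>lborel)"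
      unfolding window_def by (simp only:) (intro nn_integral_cong, auto simp: indicator_def add.commute)
  qed
  also have "\<dots> = (\<integral>\<^sup>+y. \<integral>\<^sup>+t. indicator {0<..h} y * (ennreal (norm (g (t + y))) * ennreal (norm (w (t + a) - w (t + y)))) \<partial>lborel \<partial>lborel)"
    by (rule lborel_pair.Fubini'[symmetric]) (simp add: split_beta')
  also have "\<dots> \<le> (\<integral>\<^sup>+y. indicator {0<..h} y * ennreal e \<partial>lborel)"
  proof (rule nn_integral_mono)
    fix y
    have "(\<integral>\<^sup>+t. ennreal (norm (g (t + y))) * ennreal (norm (w (t + a) - w (t + y))) \<partial>lborel) \<le> ennreal e"
      if "y \<in> {0<..h}"
    proof -
      have "(\<lambda>t. ennreal (norm (g t)) * ennreal (norm (w (t + (a - y)) - w t))) \<in> borel_measurable borel"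
        by measurable
      from nn_integral_translate[OF this, of y]
      have "(\<integral>\<^sup>+t. ennreal (norm (g (t + y))) * ennreal (norm (w (t + a) - w (t + y))) \<partial>lborel)
        = (\<integral>\<^sup>+t. ennreal (norm (g t)) * ennreal (norm (w (t + (a - y)) - w t)) \<partial>lborel)"
        by (simp add: add.assoc)
      also have "\<dots> \<le> ennreal e" using that a by (intro small) auto
      finally show ?thesis .
    qed
    then show "(\<integral>\<^sup>+t. indicator {0<..h} y * (ennreal (norm (g (t + y))) * ennreal (norm (w (t + a) - w (t + y)))) \<partial>lborel)
      \<le> indicator {0<..h} y * ennreal e"
      by (auto simp: indicator_def)
  qed
  also have "\<dots> = ennreal (h * e)"
    using h e by (subst mult.commute) (simp add: nn_integral_cmult_indicator ennreal_mult mult.commute)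
  finally show ?thesis .
qed

end

text \<open>The difference quotients of \<open>D\<close> converge weakly to its weak derivative. Here they are shifted to
  the test function, where they converge boundedly to \<open>- \<phi>'\<close>.\<close>

lemma difference_quotient_tendsto:
  fixes D :: "real \<Rightarrow> real"
  assumes D: "integrable lborel D" and \<phi>: "test_function T \<phi>"
    and h: "h \<longlonglongrightarrow> 0" "\<And>n. h n > 0"
  shows "(\<lambda>n. \<integral>t. (\<phi> (t - h n) - \<phi> t) / h n * D t \<partial>lborel) \<longlonglongrightarrow> - (\<integral>t. deriv \<phi> t * D t \<partial>lborel)"
proof -
  note [measurable] = borel_measurable_integrable[OF D]
    borel_measurable_integrable[OF test_function_integrable[OF \<phi>], simplified]
    borel_measurable_integrable[OF test_function_integrable[OF test_function_deriv[OF \<phi>]], simplified]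
  have s: "smooth \<phi>" using \<phi> by (simp add: test_function_iff)
  obtain B where B: "B > 0" "\<And>x. \<bar>deriv \<phi> x\<bar> \<le> B"
    using test_function_bounded[OF test_function_deriv[OF \<phi>]] by blast
  have "(\<lambda>n. \<integral>t. (\<phi> (t - h n) - \<phi> t) / h n * D t \<partial>lborel) \<longlonglongrightarrow> (\<integral>t. - deriv \<phi> t * D t \<partial>lborel)"
  proof (rule integral_dominated_convergence[where w = "\<lambda>t. B * \<bar>D t\<bar>"])
    show "AE t in lborel. (\<lambda>n. (\<phi> (t - h n) - \<phi> t) / h n * D t) \<longlonglongrightarrow> - deriv \<phi> t * D t"
    proof (intro AE_I2 tendsto_mult tendsto_const)
      fix t
      have "((\<lambda>k. (\<phi> (t + k) - \<phi> t) / k) \<longlongrightarrow> deriv \<phi> t) (at 0)"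
        using smooth_has_deriv[OF s, of t] by (simp add: DERIV_def)
      moreover have "filterlim (\<lambda>n. - h n) (at 0) sequentially"
        using tendsto_minus[OF h(1)] h(2) by (auto simp: filterlim_at intro!: always_eventually less_imp_neq[symmetric])
      ultimately have "(\<lambda>n. (\<phi> (t + - h n) - \<phi> t) / (- h n)) \<longlonglongrightarrow> deriv \<phi> t"
        by (rule filterlim_compose)
      from tendsto_minus[OF this] show "(\<lambda>n. (\<phi> (t - h n) - \<phi> t) / h n) \<longlonglongrightarrow> - deriv \<phi> t" by simp
    qed
    show "AE t in lborel. norm ((\<phi> (t - h n) - \<phi> t) / h n * D t) \<le> B * \<bar>D t\<bar>" for n
    proof (rule AE_I2)
      fix t
      have "\<bar>\<phi> t - \<phi> (t - h n)\<bar> \<le> B * \<bar>t - (t - h n)\<bar>"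
        using field_differentiable_bound[of UNIV \<phi> "deriv \<phi>" B t "t - h n"] smooth_has_deriv[OF s] B(2)
        by simp
      then have "\<bar>(\<phi> (t - h n) - \<phi> t) / h n\<bar> \<le> B"
        using h(2)[of n] by (simp add: abs_minus_commute field_simps)
      then show "norm ((\<phi> (t - h n) - \<phi> t) / h n * D t) \<le> B * \<bar>D t\<bar>"
        unfolding real_norm_def abs_mult by (rule mult_right_mono) simp
    qed
  qed (use D in auto)
  then show ?thesis by simp
qed

lemma difference_quotient_shift:
  fixes D :: "real \<Rightarrow> real"
  assumes D: "integrable lborel D" and \<phi>: "test_function T \<phi>" and h: "h > 0"
  shows "(\<integral>t. (\<phi> (t - h) - \<phi> t) / h * D t \<partial>lborel) = (\<integral>t. \<phi> t * (D (t + h) - D t) \<partial>lborel) / h"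
proof -
  have D': "integrable lborel (\<lambda>t. D (t + h))"
    using lborel_integrable_real_affine[OF D, of 1 h] by (simp add: add.commute)
  have i1: "integrable lborel (\<lambda>t. \<phi> t * D (t + h))" "integrable lborel (\<lambda>t. \<phi> t * D t)"
    using test_function_mult_integrable[OF \<phi>] D D' by auto
  have i2: "integrable lborel (\<lambda>t. \<phi> (t - h) * D t)"
    using lborel_integrable_real_affine[OF i1(1), of 1 "- h"] by (simp add: algebra_simps)
  have "(\<integral>t. \<phi> t * D (t + h) \<partial>lborel) = (\<integral>t. \<phi> (t - h) * D t \<partial>lborel)"
    using lborel_integral_real_affine[of 1 "\<lambda>t. \<phi> t * D (t + h)" "- h"] by (simp add: algebra_simps)
  moreover have "(\<integral>t. (\<phi> (t - h) - \<phi> t) / h * D t \<partial>lborel)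
      = (\<integral>t. (\<phi> (t - h) * D t - \<phi> t * D t) / h \<partial>lborel)"
    by (intro Bochner_Integration.integral_cong) (auto simp: field_simps)
  ultimately show ?thesis using i1 i2 h by (simp add: right_diff_distrib)
qed

context weak_pair
begin

text \<open>The deviation \<open>D\<close> of \<open>\<parallel>j w\<parallel>\<^sup>2\<close> from the primitive of \<open>2 g w\<close> has increments
  \<open>D (t + h) - D t\<close> which are integrals over \<open>(t, t + h)\<close> of \<open>g\<close> paired with differences of
  values of \<open>w\<close>. By continuity of translations their mean is \<open>o(h)\<close>, so that the weak derivative
  of \<open>D\<close> vanishes.\<close>

lemma energy_increment_bound:
  fixes D defines "D \<equiv> \<lambda>t. (norm (j (w t)))\<^sup>2 - prim (\<lambda>x. 2 * blinfun_apply (g x) (w x)) t"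
  assumes h: "h > 0"
    and inc: "increment_at t (t + h)"
  shows "ennreal \<bar>D (t + h) - D t\<bar> \<le> window h 0 t + window h h t"
proof -
  have [measurable]: "(\<lambda>x. norm (w c - w x)) \<in> borel_measurable borel" for c
    by (intro simple_limit_norm_measurable simple_limit_diff simple_limit_const wl)
  let ?I = "indicator {t<..t + h} :: real \<Rightarrow> real"
  have i: "integrable lborel (\<lambda>x. ?I x * blinfun_apply (g x) v)" for v
    using integrable_mult_indicator[OF _ integrable_g_const, of "{t<..t + h}" v] by simp
  have iw: "integrable lborel (\<lambda>x. ?I x * (2 * blinfun_apply (g x) (w x)))"
    using integrable_mult_indicator[OF _ integrable_gw, of "{t<..t + h}"]
      integrable_mult_right[of 2 lborel "\<lambda>x. ?I x * blinfun_apply (g x) (w x)"] by (simp add: mult.left_commute)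
  have "(norm (j (w (t + h))))\<^sup>2 - (norm (j (w t)))\<^sup>2
      = (j (w (t + h)) - j (w t)) \<bullet> j (w (t + h)) + (j (w (t + h)) - j (w t)) \<bullet> j (w t)"
    by (simp add: power2_norm_eq_inner inner_diff_left inner_diff_right inner_commute)
  also have "\<dots> = (\<integral>x. ?I x * blinfun_apply (g x) (w (t + h)) \<partial>lborel)
      + (\<integral>x. ?I x * blinfun_apply (g x) (w t) \<partial>lborel)"
    using inc h by (simp add: increment_at_def prim_diff[OF integrable_g_const])
  finally have "D (t + h) - D t = (\<integral>x. ?I x * blinfun_apply (g x) (w (t + h)) \<partial>lborel)
      + (\<integral>x. ?I x * blinfun_apply (g x) (w t) \<partial>lborel)
      - (\<integral>x. ?I x * (2 * blinfun_apply (g x) (w x)) \<partial>lborel)"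
    unfolding D_def using h prim_diff[of "\<lambda>x. 2 * blinfun_apply (g x) (w x)" t "t + h"] integrable_gw
    by simp
  also have "\<dots> = (\<integral>x. ?I x * blinfun_apply (g x) (w (t + h)) + ?I x * blinfun_apply (g x) (w t)
      - ?I x * (2 * blinfun_apply (g x) (w x)) \<partial>lborel)"
    using i iw by simp
  finally have "ennreal \<bar>D (t + h) - D t\<bar> \<le> (\<integral>\<^sup>+x. norm (?I x * blinfun_apply (g x) (w (t + h))
      + ?I x * blinfun_apply (g x) (w t) - ?I x * (2 * blinfun_apply (g x) (w x))) \<partial>lborel)"
    using integral_norm_bound_ennreal[OF Bochner_Integration.integrable_diff[OF
      Bochner_Integration.integrable_add[OF i i] iw], of "w (t + h)" "w t"] by simp
  also have "\<dots> \<le> (\<integral>\<^sup>+x. indicator {t<..t + h} x * (ennreal (norm (g x)) * ennreal (norm (w (t + 0) - w x)))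
      + indicator {t<..t + h} x * (ennreal (norm (g x)) * ennreal (norm (w (t + h) - w x))) \<partial>lborel)"
  proof (rule nn_integral_mono)
    fix x
    have "\<bar>blinfun_apply (g x) (w (t + h)) + blinfun_apply (g x) (w t) - 2 * blinfun_apply (g x) (w x)\<bar>
        = \<bar>blinfun_apply (g x) (w t - w x) + blinfun_apply (g x) (w (t + h) - w x)\<bar>"
      by (simp add: blinfun.diff_right)
    also have "\<dots> \<le> norm (g x) * norm (w t - w x) + norm (g x) * norm (w (t + h) - w x)"
      by (intro order_trans[OF abs_triangle_ineq] add_mono abs_blinfun_le)
    finally have "ennreal \<bar>blinfun_apply (g x) (w (t + h)) + blinfun_apply (g x) (w t) - 2 * blinfun_apply (g x) (w x)\<bar>
      \<le> ennreal (norm (g x) * norm (w t - w x) + norm (g x) * norm (w (t + h) - w x))"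
      by (rule ennreal_leI)
    also have "\<dots> = ennreal (norm (g x)) * ennreal (norm (w (t + 0) - w x))
        + ennreal (norm (g x)) * ennreal (norm (w (t + h) - w x))"
      by (simp add: ennreal_mult)
    finally show "ennreal (norm (?I x * blinfun_apply (g x) (w (t + h))
        + ?I x * blinfun_apply (g x) (w t) - ?I x * (2 * blinfun_apply (g x) (w x))))
      \<le> indicator {t<..t + h} x * (ennreal (norm (g x)) * ennreal (norm (w (t + 0) - w x)))
      + indicator {t<..t + h} x * (ennreal (norm (g x)) * ennreal (norm (w (t + h) - w x)))"
      by (cases "x \<in> {t<..t + h}") simp_all
  qed
  also have "\<dots> = window h 0 t + window h h t"
    unfolding window_def by (rule nn_integral_add) measurable
  finally show ?thesis .
qed

lemma energy_primitive:
  "\<exists>c. AE t in lborel. t \<in> {0<..<T} \<longrightarrow>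
     (norm (j (w t)))\<^sup>2 = c + prim (\<lambda>x. 2 * blinfun_apply (g x) (w x)) t"
proof -
  obtain E where E: "E \<in> sets borel" "E \<subseteq> {0<..<T}" "AE t in lborel. t \<in> {0<..<T} \<longrightarrow> t \<in> E"
    "\<And>s t. s \<in> E \<Longrightarrow> t \<in> E \<Longrightarrow> increment_at s t"
    using ex_increment_set by blast
  define P where "P = prim (\<lambda>x. 2 * blinfun_apply (g x) (w x))"
  define D where "D t = (norm (j (w t)))\<^sup>2 - P t" for t
  \<comment> \<open>\<open>P\<close> need not be integrable on the line, hence the truncation\<close>
  define D0 where "D0 t = (norm (j (w t)))\<^sup>2 - indicator {0<..<T} t * P t" for t
  have i2: "integrable lborel (\<lambda>x. 2 * blinfun_apply (g x) (w x))" using integrable_gw by simp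
  have [measurable]: "P \<in> borel_measurable borel" unfolding P_def by measurable
  have iD0: "integrable lborel D0"
  proof -
    have "integrable lborel (\<lambda>t. indicator {0<..<T} t * P t)"
    proof (rule Bochner_Integration.integrable_bound)
      show "integrable lborel (\<lambda>t. indicator {0<..<T} t * (\<integral>x. \<bar>2 * blinfun_apply (g x) (w x)\<bar> \<partial>lborel))"
        using T by simp
      show "AE t in lborel. norm (indicator {0<..<T} t * P t)
          \<le> norm (indicator {0<..<T} t * (\<integral>x. \<bar>2 * blinfun_apply (g x) (w x)\<bar> \<partial>lborel))"
        using prim_bound[OF i2] unfolding P_def by (auto simp: indicator_def)
    qed measurable
    then show ?thesis unfolding D0_def[abs_def] using integrable_jw_square by simp
  qed
  have D0: "D0 t = D t" if "t \<in> {0<..<T}" for t using that by (simp add: D_def D0_def)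
  have "\<exists>c. AE t in lborel. t \<in> {0<..<T} \<longrightarrow> D0 t = c"
  proof (rule du_Bois_Reymond[OF iD0 T])
    fix \<phi> assume \<phi>: "test_function T \<phi>"
    obtain a b where ab: "0 < a" "b < T" "\<And>x. x \<notin> {a..b} \<Longrightarrow> \<phi> x = 0"
      using \<phi> unfolding test_function_iff by blast
    obtain B where B: "B > 0" "\<And>x. \<bar>\<phi> x\<bar> \<le> B" using test_function_bounded[OF \<phi>] by blast
    \<comment> \<open>for \<open>t\<close> in the support of \<open>\<phi>\<close>, both \<open>t\<close> and \<open>t + h n\<close> lie in \<open>(0, T)\<close>\<close>
    define h where "h n = (T - b) / real (Suc (Suc n))" for n
    have h0: "h n > 0" for n using ab by (simp add: h_def)
    have hT: "h n < T - b" for n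
    proof -
      have "(T - b) * 1 < (T - b) * real (Suc (Suc n))"
        using ab by (intro mult_strict_left_mono) auto
      then show ?thesis unfolding h_def using ab by (subst pos_divide_less_eq) auto
    qed
    have hl: "h \<longlonglongrightarrow> 0" unfolding h_def
      using LIMSEQ_ignore_initial_segment[OF lim_const_over_n[of "T - b"], of 2] by simp
    have small: "\<forall>\<^sub>F n in sequentially. \<bar>\<integral>t. (\<phi> (t - h n) - \<phi> t) / h n * D0 t \<partial>lborel\<bar> \<le> 2 * B * e"
      if e: "e > 0" for e
    proof -
      obtain d where d: "d > 0"
        "\<And>k. \<bar>k\<bar> < d \<Longrightarrow> (\<integral>\<^sup>+t. ennreal (norm (g t)) * ennreal (norm (w (t + k) - w t)) \<partial>lborel) \<le> ennreal e"
        using small_translation[OF e] by blast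
      show ?thesis using order_tendstoD(2)[OF hl d(1)]
      proof eventually_elim
        case (elim n)
        let ?h = "h n"
        have X: "(\<integral>\<^sup>+t. window ?h c t \<partial>lborel) \<le> ennreal (?h * e)" if "c = 0 \<or> c = ?h" for c
          by (rule window_integral_le[OF h0 e that]) (use d(2) elim in auto)
        note [measurable] = measurable_window
        obtain N where N: "N \<in> null_sets lborel" "{t. \<not> (t \<in> {0<..<T} \<longrightarrow> t \<in> E)} \<subseteq> N"
          using E(3) by (auto elim!: AE_E simp: null_sets_def)
        have [measurable]: "N \<in> sets borel" using N(1) by (auto simp: null_sets_def)
        have "AE t in lborel. ?h + 1 * t \<notin> N"
          by (rule AE_borel_affine) (use AE_not_in[OF N(1)] in auto)
        then have "AE t in lborel. ennreal \<bar>\<phi> t * (D0 (t + ?h) - D0 t)\<bar> \<le> ennreal B * (window ?h 0 t + window ?h ?h t)"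
          using AE_not_in[OF N(1)]
        proof eventually_elim
          case (elim t)
          show ?case
          proof (cases "t \<in> {a..b}")
            case True
            then have tT: "t \<in> {0<..<T}" "t + ?h \<in> {0<..<T}" using ab h0[of n] hT[of n] by auto
            then have tE: "t \<in> E" "t + ?h \<in> E" using elim N(2) by (blast, force simp: add.commute)
            have "ennreal \<bar>D0 (t + ?h) - D0 t\<bar> \<le> window ?h 0 t + window ?h ?h t"
              using energy_increment_bound[OF h0 E(4)[OF tE(1) tE(2)]]
              unfolding D0[OF tT(1)] D0[OF tT(2)] D_def P_def .
            then have "ennreal \<bar>\<phi> t\<bar> * ennreal \<bar>D0 (t + ?h) - D0 t\<bar> \<le> ennreal B * (window ?h 0 t + window ?h ?h t)"
              using B(2) by (intro mult_mono ennreal_leI) auto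
            then show ?thesis by (simp add: abs_mult ennreal_mult)
          qed (simp add: ab(3))
        qed
        then have "(\<integral>\<^sup>+t. ennreal \<bar>\<phi> t * (D0 (t + ?h) - D0 t)\<bar> \<partial>lborel)
            \<le> (\<integral>\<^sup>+t. ennreal B * (window ?h 0 t + window ?h ?h t) \<partial>lborel)"
          by (rule nn_integral_mono_AE)
        also have "\<dots> = ennreal B * ((\<integral>\<^sup>+t. window ?h 0 t \<partial>lborel) + (\<integral>\<^sup>+t. window ?h ?h t \<partial>lborel))"
          by (simp add: nn_integral_cmult nn_integral_add)
        also have "\<dots> \<le> ennreal B * (ennreal (?h * e) + ennreal (?h * e))"
          by (intro mult_left_mono add_mono X) auto
        also have "\<dots> = ennreal (B * (?h * e + ?h * e))"
        proof -
          have he: "0 \<le> ?h * e" using e h0[of n] by simp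
          show ?thesis
            using B(1) by (simp only: ennreal_mult[OF less_imp_le[OF B(1)] add_nonneg_nonneg[OF he he]]
                ennreal_plus[OF he he])
        qed
        also have "B * (?h * e + ?h * e) = ?h * (2 * B * e)" by simp
        finally have 1: "(\<integral>\<^sup>+t. ennreal \<bar>\<phi> t * (D0 (t + ?h) - D0 t)\<bar> \<partial>lborel) \<le> ennreal (?h * (2 * B * e))" .
        have "integrable lborel (\<lambda>t. D0 (t + ?h))"
          using lborel_integrable_real_affine[OF iD0, of 1 ?h] by (simp add: add.commute)
        then have "integrable lborel (\<lambda>t. \<phi> t * (D0 (t + ?h) - D0 t))"
          using iD0 by (intro test_function_mult_integrable[OF \<phi>]) simp
        from integral_norm_bound_ennreal[OF this] 1
        have "ennreal \<bar>\<integral>t. \<phi> t * (D0 (t + ?h) - D0 t) \<partial>lborel\<bar> \<le> ennreal (?h * (2 * B * e))"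
          by (auto intro: order_trans)
        then have "\<bar>\<integral>t. \<phi> t * (D0 (t + ?h) - D0 t) \<partial>lborel\<bar> \<le> ?h * (2 * B * e)"
          using B(1) e h0[of n] by (subst (asm) ennreal_le_iff) auto
        then show ?case
          unfolding difference_quotient_shift[OF iD0 \<phi> h0] using h0[of n]
          by (simp add: abs_divide divide_le_eq mult.commute)
      qed
    qed
    have lim: "(\<lambda>n. \<bar>\<integral>t. (\<phi> (t - h n) - \<phi> t) / h n * D0 t \<partial>lborel\<bar>) \<longlonglongrightarrow> \<bar>\<integral>t. deriv \<phi> t * D0 t \<partial>lborel\<bar>"
      using tendsto_rabs[OF difference_quotient_tendsto[OF iD0 \<phi> hl h0]] by simp
    have "\<bar>\<integral>t. deriv \<phi> t * D0 t \<partial>lborel\<bar> \<le> 0 + e" if "e > 0" for e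
    proof -
      have "e / (2 * B) > 0" using that B by simp
      from small[OF this] have "\<bar>\<integral>t. deriv \<phi> t * D0 t \<partial>lborel\<bar> \<le> 2 * B * (e / (2 * B))"
        by (rule tendsto_upperbound[OF lim]) simp
      then show ?thesis using B by simp
    qed
    then have "\<bar>\<integral>t. deriv \<phi> t * D0 t \<partial>lborel\<bar> \<le> 0" by (rule field_le_epsilon)
    then show "(\<integral>t. deriv \<phi> t * D0 t \<partial>lborel) = 0" by simp
  qed
  then obtain c where "AE t in lborel. t \<in> {0<..<T} \<longrightarrow> D0 t = c" by blast
  then have "AE t in lborel. t \<in> {0<..<T} \<longrightarrow> (norm (j (w t)))\<^sup>2 = c + P t"
    by eventually_elim (auto simp: D0_def)
  then show ?thesis unfolding P_def by blast
qed

end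

context weak_pair
begin

text \<open>This is the energy identity for \<open>w - w s\<close>, whose weak derivative is \<open>g\<close> again.\<close>

lemma increment_norm_bound:
  assumes inc: "increment_at s t"
    and en: "\<And>r. r \<in> {s, t} \<Longrightarrow>
      (norm (j (w r)))\<^sup>2 = c + prim (\<lambda>x. 2 * blinfun_apply (g x) (w x)) r"
    and I: "{min s t<..max s t} \<subseteq> I" "I \<in> sets borel"
  shows "(norm (j (w t) - j (w s)))\<^sup>2 \<le>
    2 * (\<integral>x. indicator I x * (norm (g x) * norm (w x)) \<partial>lborel)
    + 2 * norm (w s) * (\<integral>x. indicator I x * norm (g x) \<partial>lborel)"
proof -
  let ?a = "min s t" and ?b = "max s t"
  have bound: "\<bar>prim f t - prim f s\<bar> \<le> (\<integral>x. indicator I x * \<bar>f x\<bar> \<partial>lborel)"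
    if f: "integrable lborel f" for f
  proof -
    have if1: "integrable lborel (\<lambda>x. indicator {?a<..?b} x * f x)"
      using integrable_mult_indicator[OF _ f, of "{?a<..?b}"] by simp
    have "\<bar>prim f t - prim f s\<bar> = \<bar>prim f ?b - prim f ?a\<bar>" by (cases "s \<le> t") auto
    also have "\<dots> = \<bar>\<integral>x. indicator {?a<..?b} x * f x \<partial>lborel\<bar>" using prim_diff[OF f, of ?a ?b] by simp
    also have "\<dots> \<le> (\<integral>x. \<bar>indicator {?a<..?b} x * f x\<bar> \<partial>lborel)"
      using integral_norm_bound[of lborel "\<lambda>x. indicator {?a<..?b} x * f x"] by simp
    also have "\<dots> \<le> (\<integral>x. indicator I x * \<bar>f x\<bar> \<partial>lborel)"
    proof (rule integral_mono)
      show "integrable lborel (\<lambda>x. \<bar>indicator {?a<..?b} x * f x\<bar>)" using if1 by simp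
      show "integrable lborel (\<lambda>x. indicator I x * \<bar>f x\<bar>)"
        using integrable_mult_indicator[of I lborel "\<lambda>x. \<bar>f x\<bar>"] f I(2) by simp
      show "\<bar>indicator {?a<..?b} x * f x\<bar> \<le> indicator I x * \<bar>f x\<bar>" for x
        using I(1) by (auto simp: indicator_def abs_mult)
    qed
    finally show ?thesis .
  qed
  let ?p = "\<lambda>x. blinfun_apply (g x) (w x)"
  let ?q = "\<lambda>x. blinfun_apply (g x) (w s)"
  have "(norm (j (w t) - j (w s)))\<^sup>2
      = (norm (j (w t)))\<^sup>2 - (norm (j (w s)))\<^sup>2 - 2 * ((j (w t) - j (w s)) \<bullet> j (w s))"
    by (simp add: power2_norm_eq_inner inner_diff_left inner_diff_right inner_commute)
  also have "\<dots> = (prim (\<lambda>x. 2 * ?p x) t - prim (\<lambda>x. 2 * ?p x) s) - 2 * (prim ?q t - prim ?q s)"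
    using en[of s] en[of t] inc by (simp add: increment_at_def)
  also have "\<dots> \<le> (\<integral>x. indicator I x * \<bar>2 * ?p x\<bar> \<partial>lborel) + 2 * (\<integral>x. indicator I x * \<bar>?q x\<bar> \<partial>lborel)"
    using bound[of "\<lambda>x. 2 * ?p x"] bound[of ?q] integrable_gw integrable_g_const by simp
  also have "(\<integral>x. indicator I x * \<bar>2 * ?p x\<bar> \<partial>lborel)
      \<le> (\<integral>x. 2 * (indicator I x * (norm (g x) * norm (w x))) \<partial>lborel)"
  proof (rule integral_mono)
    show "integrable lborel (\<lambda>x. indicator I x * \<bar>2 * ?p x\<bar>)"
      using integrable_mult_indicator[of I lborel "\<lambda>x. \<bar>2 * ?p x\<bar>"] integrable_gw I(2) by simp
    show "integrable lborel (\<lambda>x. 2 * (indicator I x * (norm (g x) * norm (w x))))"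
      using integrable_mult_indicator[OF _ integrable_norm_gw, of I] I(2) by simp
    show "indicator I x * \<bar>2 * ?p x\<bar> \<le> 2 * (indicator I x * (norm (g x) * norm (w x)))" for x
      using abs_blinfun_le[of "g x" "w x"] by (auto simp: indicator_def abs_mult mult.commute)
  qed
  also have "(\<integral>x. indicator I x * \<bar>?q x\<bar> \<partial>lborel) \<le> (\<integral>x. norm (w s) * (indicator I x * norm (g x)) \<partial>lborel)"
  proof (rule integral_mono)
    show "integrable lborel (\<lambda>x. indicator I x * \<bar>?q x\<bar>)"
      using integrable_mult_indicator[of I lborel "\<lambda>x. \<bar>?q x\<bar>"] integrable_g_const I(2) by simp
    show "integrable lborel (\<lambda>x. norm (w s) * (indicator I x * norm (g x)))"
      using integrable_mult_indicator[OF _ integrable_norm_g, of I] I(2) by simp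
    show "indicator I x * \<bar>?q x\<bar> \<le> norm (w s) * (indicator I x * norm (g x))" for x
      using abs_blinfun_le[of "g x" "w s"] by (auto simp: indicator_def mult.commute)
  qed
  finally show ?thesis by simp
qed

text \<open>A function cannot exceed its mean almost everywhere.\<close>

lemma ex_point_below_mean:
  assumes ab: "a < b" and E: "AE t in lborel. t \<in> {a<..<b} \<longrightarrow> t \<in> E"
  shows "\<exists>s\<in>E \<inter> {a<..<b}. (norm (w s))\<^sup>2 * (b - a) \<le> (\<integral>x. indicator {a..b} x * (norm (w x))\<^sup>2 \<partial>lborel)"
proof (rule ccontr)
  let ?W = "\<integral>x. indicator {a..b} x * (norm (w x))\<^sup>2 \<partial>lborel"
  assume *: "\<not> ?thesis"
  have i1: "integrable lborel (\<lambda>x. indicator {a..b} x * (norm (w x))\<^sup>2)"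
    using integrable_mult_indicator[OF _ w2, of "{a..b}"] by simp
  have i2: "integrable lborel (\<lambda>x. indicator {a..b} x * (?W / (b - a)))" using ab by simp
  let ?f = "\<lambda>x. indicator {a..b} x * (norm (w x))\<^sup>2 - indicator {a..b} x * (?W / (b - a))"
  have pos: "?f x > 0" if "x \<in> E" "x \<in> {a<..<b}" for x
    using * that ab by (auto simp: not_le field_simps)
  have "(\<integral>x. ?f x \<partial>lborel) = 0" using i1 i2 ab by simp
  moreover have "AE x in lborel. 0 \<le> ?f x"
    using E AE_lborel_singleton[of a] AE_lborel_singleton[of b]
  proof eventually_elim
    case (elim x)
    then show ?case using pos[of x] by (cases "x \<in> {a<..<b}") (auto simp: indicator_def)
  qed
  ultimately have "AE x in lborel. ?f x = 0"
    using i1 i2 by (subst (asm) integral_nonneg_eq_0_iff_AE) auto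
  with E have "AE x in lborel. (x \<in> {a<..<b} \<longrightarrow> x \<in> E) \<and> ?f x = 0" by eventually_elim auto
  from AE_ex_in_interval[OF ab this] obtain x where "x \<in> {a<..<b}" "x \<in> E" "?f x = 0" by auto
  with pos show False by fastforce
qed

text \<open>For \<open>t < t'\<close> an intermediate point \<open>s\<close> is chosen where \<open>\<parallel>w s\<parallel>\<^sup>2\<close> is at most its mean over
  \<open>(t, t')\<close>; comparing both end points with \<open>s\<close> bounds \<open>\<parallel>j (w t') - j (w t)\<parallel>\<close> by the norms of \<open>w\<close> and
  \<open>g\<close> over the short interval.\<close>

lemma interval_norm_bound:
  assumes inc: "\<And>s t. s \<in> E \<Longrightarrow> t \<in> E \<Longrightarrow> increment_at s t"
    and en: "\<And>t. t \<in> E \<Longrightarrow> (norm (j (w t)))\<^sup>2 = c + prim (\<lambda>x. 2 * blinfun_apply (g x) (w x)) t"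
    and E: "E \<subseteq> {0<..<T}" "AE t in lborel. t \<in> {0<..<T} \<longrightarrow> t \<in> E"
    and t: "t \<in> E" "t' \<in> E" "t < t'"
  shows "norm (j (w t') - j (w t)) \<le> 4 * sqrt (sqrt ((\<integral>x. (norm (g x))\<^sup>2 \<partial>lborel) *
    (prim (\<lambda>x. (norm (w x))\<^sup>2) t' - prim (\<lambda>x. (norm (w x))\<^sup>2) t)))"
proof -
  define G where "G = (\<integral>x. (norm (g x))\<^sup>2 \<partial>lborel)"
  define W where "W = (\<integral>x. indicator {t..t'} x * (norm (w x))\<^sup>2 \<partial>lborel)"
  let ?J = "indicator {t..t'} :: real \<Rightarrow> real"
  have G0: "G \<ge> 0" and W0: "W \<ge> 0" unfolding G_def W_def by simp_all
  have W: "prim (\<lambda>x. (norm (w x))\<^sup>2) t' - prim (\<lambda>x. (norm (w x))\<^sup>2) t = W"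
  proof -
    have "(\<integral>x. indicator {t<..t'} x * (norm (w x))\<^sup>2 \<partial>lborel) = W"
      unfolding W_def
    proof (rule Bochner_Integration.integral_cong_AE)
      show "AE x in lborel. indicator {t<..t'} x * (norm (w x))\<^sup>2 = ?J x * (norm (w x))\<^sup>2"
        using AE_lborel_singleton[of t] by eventually_elim (auto simp: indicator_def)
    qed measurable
    then show ?thesis using prim_diff[OF w2, of t t'] t(3) by simp
  qed
  have Jw: "(?J x * norm (w x))\<^sup>2 = ?J x * (norm (w x))\<^sup>2" for x by (simp add: indicator_def)
  have iw: "integrable lborel (\<lambda>x. (?J x * norm (w x))\<^sup>2)"
    unfolding Jw using integrable_mult_indicator[OF _ w2, of "{t..t'}"] by simp
  have JW: "(\<integral>x. (?J x * norm (w x))\<^sup>2 \<partial>lborel) = W"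
    unfolding W_def Jw ..
  have gw: "(\<integral>x. ?J x * (norm (g x) * norm (w x)) \<partial>lborel) \<le> sqrt (G * W)"
  proof -
    have "\<bar>norm (g x)\<bar> * \<bar>?J x * norm (w x)\<bar> = ?J x * (norm (g x) * norm (w x))" for x
      by (simp add: indicator_def)
    with Cauchy_Schwarz_integral[OF _ _ g2 iw] show ?thesis
      unfolding JW G_def[symmetric] by (simp only:) simp
  qed
  have ij: "integrable lborel (\<lambda>x. (?J x)\<^sup>2)"
    using t(3) by (simp add: power2_eq_square indicator_inter_arith[symmetric])
  have JJ: "(\<integral>x. (?J x)\<^sup>2 \<partial>lborel) = t' - t"
    using t(3) by (simp add: power2_eq_square indicator_inter_arith[symmetric])
  have g: "(\<integral>x. ?J x * norm (g x) \<partial>lborel) \<le> sqrt (G * (t' - t))"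
  proof -
    have "\<bar>norm (g x)\<bar> * \<bar>?J x\<bar> = ?J x * norm (g x)" for x
      by (simp add: indicator_def)
    with Cauchy_Schwarz_integral[OF _ _ g2 ij] show ?thesis
      unfolding JJ G_def[symmetric] by (simp only:) simp
  qed
  have "AE x in lborel. x \<in> {t<..<t'} \<longrightarrow> x \<in> E"
    using E(2) by eventually_elim (use t E(1) in auto)
  from ex_point_below_mean[OF t(3) this] obtain s where
    s: "s \<in> E" "t < s" "s < t'" "(norm (w s))\<^sup>2 * (t' - t) \<le> W" unfolding W_def by auto
  have ws: "norm (w s) * sqrt (G * (t' - t)) \<le> sqrt (G * W)"
  proof (rule real_le_rsqrt)
    have "(norm (w s) * sqrt (G * (t' - t)))\<^sup>2 = G * ((norm (w s))\<^sup>2 * (t' - t))"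
      using G0 t(3) by (simp add: power_mult_distrib)
    also have "\<dots> \<le> G * W" using s(4) G0 by (rule mult_left_mono)
    finally show "(norm (w s) * sqrt (G * (t' - t)))\<^sup>2 \<le> G * W" .
  qed
  have near: "norm (j (w r) - j (w s)) \<le> 2 * sqrt (sqrt (G * W))" if r: "r \<in> E" "r \<in> {t..t'}" for r
  proof -
    have "(norm (j (w r) - j (w s)))\<^sup>2 \<le> 2 * (\<integral>x. ?J x * (norm (g x) * norm (w x)) \<partial>lborel)
      + 2 * norm (w s) * (\<integral>x. ?J x * norm (g x) \<partial>lborel)"
      by (rule increment_norm_bound[OF inc[OF s(1) r(1)]]) (use r s en in auto)
    also have "\<dots> \<le> 2 * sqrt (G * W) + 2 * norm (w s) * sqrt (G * (t' - t))"
      using gw g by (intro add_mono mult_left_mono) auto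
    also have "\<dots> \<le> 4 * sqrt (G * W)" using ws by simp
    also have "\<dots> = (2 * sqrt (sqrt (G * W)))\<^sup>2" using G0 W0 by (simp add: power_mult_distrib)
    finally show ?thesis by (rule power2_le_imp_le) (use G0 W0 in simp)
  qed
  have "norm (j (w t') - j (w t)) \<le> norm (j (w t') - j (w s)) + norm (j (w t) - j (w s))"
    using norm_triangle_ineq4[of "j (w t') - j (w s)" "j (w t) - j (w s)"] by simp
  also have "\<dots> \<le> 2 * sqrt (sqrt (G * W)) + 2 * sqrt (sqrt (G * W))"
    using t by (intro add_mono near) auto
  finally show ?thesis unfolding W G_def[symmetric] by simp
qed

text \<open>By \<open>interval_norm_bound\<close>, \<open>j w\<close> is uniformly continuous on a set of full measure, which is dense
  in \<open>[0, T]\<close>; as \<open>H\<close> is complete, it extends continuously, and with it the energy identity.\<close>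

theorem continuous_representative:
  "\<exists>c. continuous_on {0..T} c \<and> (AE t in lborel. t \<in> {0<..<T} \<longrightarrow> c t = j (w t)) \<and>
     (norm (c T))\<^sup>2 - (norm (c 0))\<^sup>2 = 2 * (\<integral>t. blinfun_apply (g t) (w t) \<partial>lborel)"
proof -
  obtain E0 where E0: "E0 \<in> sets borel" "E0 \<subseteq> {0<..<T}" "AE t in lborel. t \<in> {0<..<T} \<longrightarrow> t \<in> E0"
    "\<And>s t. s \<in> E0 \<Longrightarrow> t \<in> E0 \<Longrightarrow> increment_at s t"
    using ex_increment_set by blast
  let ?P = "prim (\<lambda>x. 2 * blinfun_apply (g x) (w x))"
  obtain d where d: "AE t in lborel. t \<in> {0<..<T} \<longrightarrow> (norm (j (w t)))\<^sup>2 = d + ?P t"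
    using energy_primitive by blast
  define E where "E = {t \<in> E0. (norm (j (w t)))\<^sup>2 = d + ?P t}"
  have E: "E \<subseteq> {0<..<T}" "AE t in lborel. t \<in> {0<..<T} \<longrightarrow> t \<in> E"
  proof -
    show "E \<subseteq> {0<..<T}" using E0(2) by (auto simp: E_def)
    show "AE t in lborel. t \<in> {0<..<T} \<longrightarrow> t \<in> E"
      using E0(3) d by eventually_elim (auto simp: E_def)
  qed
  have en: "(norm (j (w t)))\<^sup>2 = d + ?P t" if "t \<in> E" for t using that by (simp add: E_def)
  have inc: "increment_at s t" if "s \<in> E" "t \<in> E" for s t
    using that by (intro E0(4)) (simp_all add: E_def)
  define G where "G = (\<integral>x. (norm (g x))\<^sup>2 \<partial>lborel)"
  define Q where "Q = prim (\<lambda>x. (norm (w x))\<^sup>2)"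
  have close: "norm (j (w t) - j (w s)) \<le> 4 * sqrt (sqrt (G * \<bar>Q t - Q s\<bar>))"
    if "s \<in> E" "t \<in> E" for s t
  proof -
    have *: "norm (j (w t) - j (w s)) \<le> 4 * sqrt (sqrt (G * (Q t - Q s)))" if "s \<in> E" "t \<in> E" "s < t" for s t
      unfolding G_def Q_def by (rule interval_norm_bound[OF inc en E that])
    have "G \<ge> 0" by (simp add: G_def)
    then have **: "4 * sqrt (sqrt (G * x)) \<le> 4 * sqrt (sqrt (G * \<bar>x\<bar>))" for x
      by (simp add: mult_left_mono)
    consider "s < t" | "t < s" | "s = t" by linarith
    then show ?thesis
    proof cases
      case 1
      from order_trans[OF *[OF that 1] **] show ?thesis .
    next
      case 2
      from order_trans[OF *[OF that(2,1) 2] **] show ?thesis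
        by (simp add: norm_minus_commute abs_minus_commute)
    qed simp
  qed
  have uQ: "uniformly_continuous_on {0..T} Q"
    unfolding Q_def by (intro compact_uniformly_continuous continuous_on_subset[OF continuous_prim[OF w2]]) auto
  have "uniformly_continuous_on E (\<lambda>t. j (w t))"
    unfolding uniformly_continuous_on_def
  proof (intro allI impI)
    fix e :: real assume e: "e > 0"
    \<comment> \<open>makes the bound of \<open>close\<close> at most \<open>4 e / 5\<close>\<close>
    define k where "k = ((e / 5)\<^sup>2)\<^sup>2 / (G + 1)"
    have G0: "G \<ge> 0" by (simp add: G_def)
    have k: "k > 0" using e G0 by (simp add: k_def)
    then obtain r where r: "r > 0" "\<And>s t. s \<in> {0..T} \<Longrightarrow> t \<in> {0..T} \<Longrightarrow> dist t s < r \<Longrightarrow> dist (Q t) (Q s) < k"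
      using uQ unfolding uniformly_continuous_on_def by blast
    show "\<exists>r>0. \<forall>s\<in>E. \<forall>t\<in>E. dist t s < r \<longrightarrow> dist (j (w t)) (j (w s)) < e"
    proof (intro exI[of _ r] conjI ballI impI r(1))
      fix s t assume st: "s \<in> E" "t \<in> E" "dist t s < r"
      then have "\<bar>Q t - Q s\<bar> < k" using r(2)[of s t] E(1) by (auto simp: dist_real_def subset_eq less_imp_le)
      then have "G * \<bar>Q t - Q s\<bar> \<le> (G + 1) * k" using G0 by (intro mult_mono) auto
      also have "\<dots> = ((e / 5)\<^sup>2)\<^sup>2" using G0 unfolding k_def by simp
      finally have "sqrt (G * \<bar>Q t - Q s\<bar>) \<le> (e / 5)\<^sup>2"
        by (rule real_le_lsqrt[OF zero_le_power2])
      then have "sqrt (sqrt (G * \<bar>Q t - Q s\<bar>)) \<le> e / 5"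
        by (rule real_le_lsqrt[rotated]) (use e in simp)
      with close[OF st(1,2)] e show "dist (j (w t)) (j (w s)) < e"
        unfolding dist_norm by linarith
    qed
  qed
  then obtain c where c: "uniformly_continuous_on (closure E) c" "\<And>t. t \<in> E \<Longrightarrow> c t = j (w t)"
  proof (rule uniformly_continuous_on_extension_on_closure)
    fix c' assume "uniformly_continuous_on (closure E) c'" "\<And>t. t \<in> E \<Longrightarrow> j (w t) = c' t"
    then show thesis by (intro that[of c']) simp_all
  qed
  have dense: "{0..T} \<subseteq> closure E"
  proof
    fix t assume t: "t \<in> {0..T}"
    show "t \<in> closure E" unfolding closure_approachable
    proof (intro allI impI)
      fix e :: real assume e: "e > 0"
      define a where "a = max 0 (t - e)"
      define b where "b = min T (t + e)"
      have ab: "a < b" "0 \<le> a" "b \<le> T" "t - e \<le> a" "b \<le> t + e"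
        using t e T unfolding a_def b_def atLeastAtMost_iff by linarith+
      from AE_ex_in_interval[OF ab(1) E(2)]
      obtain x where x: "a < x" "x < b" "x \<in> {0<..<T} \<longrightarrow> x \<in> E"
        unfolding Bex_def greaterThanLessThan_iff by blast
      have "x \<in> E" using x ab unfolding greaterThanLessThan_iff by linarith
      moreover have "dist x t < e" using x ab unfolding dist_real_def by linarith
      ultimately show "\<exists>y\<in>E. dist y t < e" by blast
    qed
  qed
  have cont: "continuous_on {0..T} c"
    using continuous_on_subset[OF uniformly_continuous_imp_continuous[OF c(1)] dense] .
  have energy: "(norm (c t))\<^sup>2 - ?P t - d = 0" if "t \<in> {0..T}" for t
  proof (rule continuous_constant_on_closure[of E "\<lambda>t. (norm (c t))\<^sup>2 - ?P t - d" 0])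
    show "continuous_on (closure E) (\<lambda>t. (norm (c t))\<^sup>2 - ?P t - d)"
    proof -
      have "continuous_on (closure E) ?P"
        using integrable_gw by (intro continuous_on_subset[OF continuous_prim]) simp_all
      then show ?thesis
        by (intro continuous_on_diff continuous_on_power continuous_on_norm continuous_on_const
            uniformly_continuous_imp_continuous[OF c(1)])
    qed
    show "(norm (c t))\<^sup>2 - ?P t - d = 0" if "t \<in> E" for t
      using en[OF that] c(2)[OF that] by simp
  qed (use that dense in blast)
  have "(norm (c T))\<^sup>2 - (norm (c 0))\<^sup>2 = ?P T - ?P 0"
    using energy[of T] energy[of 0] T by simp
  also have "\<dots> = (\<integral>x. indicator {0<..T} x * (2 * blinfun_apply (g x) (w x)) \<partial>lborel)"
    by (rule prim_diff) (use T integrable_gw in auto)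
  also have "\<dots> = (\<integral>x. 2 * blinfun_apply (g x) (w x) \<partial>lborel)"
  proof (rule Bochner_Integration.integral_cong[OF refl])
    show "indicator {0<..T} x * (2 * blinfun_apply (g x) (w x)) = 2 * blinfun_apply (g x) (w x)" for x
      using w0[of x] by (cases "x \<in> {0<..<T}") auto
  qed
  also have "\<dots> = 2 * (\<integral>x. blinfun_apply (g x) (w x) \<partial>lborel)" by simp
  finally have "(norm (c T))\<^sup>2 - (norm (c 0))\<^sup>2 = 2 * (\<integral>x. blinfun_apply (g x) (w x) \<partial>lborel)" .
  moreover have "AE t in lborel. t \<in> {0<..<T} \<longrightarrow> c t = j (w t)"
    using E(2) by eventually_elim (use c(2) in auto)
  ultimately show ?thesis using cont by blast
qed

end

section \<open>Representatives of elements of Bochner spaces\<close>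

lemma L2_rel_rep: "L2_rel (rep_L2 w) (rep_L2 w)"
  using Quotient_rep_reflp[OF Quotient_L2] .

lemma sq_integrable_rep: "sq_integrable (rep_L2 w)"
  using L2_rel_rep[of w] by (simp add: L2_rel_def)

lemma L2_eq_iff: "v = w \<longleftrightarrow> (AE t in lebesgue. rep_L2 v t = rep_L2 w t)"
  using Quotient_rel_rep[OF Quotient_L2, of v w] sq_integrable_rep by (auto simp: L2_rel_def)

lemma rep_abs_L2:
  assumes "sq_integrable f"
  shows "AE t in lebesgue. rep_L2 (abs_L2 f) t = f t"
proof -
  have "L2_rel f f" using assms by (simp add: L2_rel_def)
  then have "L2_rel (rep_L2 (abs_L2 f)) f" by (rule Quotient_rep_abs[OF Quotient_L2])
  then show ?thesis by (simp add: L2_rel_def)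
qed

lemma rep_zero_L2: "AE t in lebesgue. rep_L2 0 t = 0"
  unfolding zero_L2_def by (rule rep_abs_L2) (rule sq_integrable_zero)

lemma rep_add_L2: "AE t in lebesgue. rep_L2 (v + w) t = rep_L2 v t + rep_L2 w t"
proof -
  have "v + w = abs_L2 (\<lambda>t. rep_L2 v t + rep_L2 w t)"
    by (simp add: plus_L2_def)
  then show ?thesis using rep_abs_L2[OF sq_integrable_add[OF sq_integrable_rep sq_integrable_rep]] by simp
qed

lemma rep_scaleR_L2: "AE t in lebesgue. rep_L2 (c *\<^sub>R v) t = c *\<^sub>R rep_L2 v t"
proof -
  have "c *\<^sub>R v = abs_L2 (\<lambda>t. c *\<^sub>R rep_L2 v t)"
    by (simp add: scaleR_L2_def)
  then show ?thesis using rep_abs_L2[OF sq_integrable_scaleR[OF sq_integrable_rep]] by simp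
qed

lemma rep_lincomb_L2: "AE t in lebesgue. rep_L2 (v + c *\<^sub>R w) t = rep_L2 v t + c *\<^sub>R rep_L2 w t"
  using rep_add_L2[of v "c *\<^sub>R w"] rep_scaleR_L2[of c w] by eventually_elim simp

lemma norm_L2_eq: "norm w = sqrt (\<integral>t. (norm (rep_L2 w t))\<^sup>2 \<partial>lebesgue)"
  by (simp add: norm_L2_def L2_norm_fun_def)

lemma subspace_L2_on: "subspace (L2_on S)"
proof (rule subspaceI)
  show "0 \<in> L2_on S" unfolding L2_on_def using rep_zero_L2 by (auto elim: eventually_mono)
  show "v + w \<in> L2_on S" if "v \<in> L2_on S" "w \<in> L2_on S" for v w
  proof -
    have "AE t in lebesgue. t \<notin> S \<longrightarrow> rep_L2 (v + w) t = 0"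
      using rep_add_L2[of v w] that[unfolded L2_on_def mem_Collect_eq]
      by eventually_elim auto
    then show ?thesis by (simp add: L2_on_def)
  qed
  show "c *\<^sub>R v \<in> L2_on S" if "v \<in> L2_on S" for c v
  proof -
    have "AE t in lebesgue. t \<notin> S \<longrightarrow> rep_L2 (c *\<^sub>R v) t = 0"
      using rep_scaleR_L2[of c v] that[unfolded L2_on_def mem_Collect_eq]
      by eventually_elim auto
    then show ?thesis by (simp add: L2_on_def)
  qed
qed

lemma subspace_Y_space: "subspace (Y_space T)"
  unfolding Y_space_def by (rule subspace_L2_on)

lemma L2_on_borel_representative:
  assumes "w \<in> L2_on {0<..<T}"
  obtains w' where "simple_limit borel w'" "AE t in lebesgue. rep_L2 w t = w' t"
    "\<And>t. t \<notin> {0<..<T} \<Longrightarrow> w' t = 0" "integrable lborel (\<lambda>t. (norm (w' t))\<^sup>2)"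
  using ex_borel_representative[OF sq_integrable_rep, of "{0<..<T}" w] assms
  unfolding L2_on_def by auto

lemma lebesgue_integral_representative:
  fixes F F' :: "real \<Rightarrow> real"
  assumes m: "F' \<in> borel_measurable borel" and ae: "AE t in lebesgue. F t = F' t"
  shows "F \<in> borel_measurable lebesgue" "(\<integral>t. F t \<partial>lebesgue) = (\<integral>t. F' t \<partial>lborel)"
    "integrable lebesgue F \<longleftrightarrow> integrable lborel F'"
proof -
  have m': "F' \<in> borel_measurable lebesgue" using m by (auto intro: measurable_completion)
  have ae': "AE t in lebesgue. F' t = F t" using ae by eventually_elim simp
  from borel_measurable_AE[OF m' ae'] show F: "F \<in> borel_measurable lebesgue" .
  have "(\<integral>t. F t \<partial>lebesgue) = (\<integral>t. F' t \<partial>lebesgue)"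
    by (rule Bochner_Integration.integral_cong_AE[OF F m' ae])
  also have "\<dots> = (\<integral>t. F' t \<partial>lborel)" using m by (intro integral_completion) simp
  finally show "(\<integral>t. F t \<partial>lebesgue) = (\<integral>t. F' t \<partial>lborel)" .
  have "integrable lebesgue F \<longleftrightarrow> integrable lebesgue F'"
    by (rule integrable_cong_AE[OF F m' ae])
  also have "\<dots> \<longleftrightarrow> integrable lborel F'" using m by (intro integrable_completion) simp
  finally show "integrable lebesgue F \<longleftrightarrow> integrable lborel F'" .
qed

text \<open>The duality pairing of \<open>L\<^sub>2(0,T;V')\<close> with \<open>L\<^sub>2(0,T;V)\<close>.\<close>

definition pairing :: "real \<Rightarrow> ('v::real_normed_vector \<Rightarrow>\<^sub>L real) L2 \<Rightarrow> 'v L2 \<Rightarrow> real" where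
  "pairing T g v = (LINT t:{0<..<T}|lebesgue. blinfun_apply (rep_L2 g t) (rep_L2 v t))"

lemma ex_L2_borel_representative:
  obtains w' where "simple_limit borel w'" "AE t in lebesgue. rep_L2 w t = w' t"
    "integrable lborel (\<lambda>t. (norm (w' t))\<^sup>2)"
  using ex_borel_representative[OF sq_integrable_rep, of UNIV w] by auto

lemma pairing_integrable:
  fixes g :: "('v::real_normed_vector \<Rightarrow>\<^sub>L real) L2"
  shows "integrable lebesgue (\<lambda>t. norm (rep_L2 g t) * norm (rep_L2 v t))"
  "integrable lebesgue (\<lambda>t. blinfun_apply (rep_L2 g t) (rep_L2 v t))"
proof -
  obtain g' where g': "simple_limit borel g'" "AE t in lebesgue. rep_L2 g t = g' t"
    "integrable lborel (\<lambda>t. (norm (g' t))\<^sup>2)" using ex_L2_borel_representative[of g] .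
  obtain v' where v': "simple_limit borel v'" "AE t in lebesgue. rep_L2 v t = v' t"
    "integrable lborel (\<lambda>t. (norm (v' t))\<^sup>2)" using ex_L2_borel_representative[of v] .
  note [measurable] = simple_limit_norm_measurable[OF g'(1)] simple_limit_norm_measurable[OF v'(1)]
    simple_limit_pairing_measurable[OF g'(1) v'(1)]
  have "integrable lborel (\<lambda>t. norm (g' t) * norm (v' t))"
    by (rule integrable_product_of_squares) (use g'(3) v'(3) in auto)
  moreover have "AE t in lebesgue. norm (rep_L2 g t) * norm (rep_L2 v t) = norm (g' t) * norm (v' t)"
    using g'(2) v'(2) by eventually_elim simp
  ultimately show 1: "integrable lebesgue (\<lambda>t. norm (rep_L2 g t) * norm (rep_L2 v t))"
    by (subst lebesgue_integral_representative(3)) auto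
  have "AE t in lebesgue. blinfun_apply (rep_L2 g t) (rep_L2 v t) = blinfun_apply (g' t) (v' t)"
    using g'(2) v'(2) by eventually_elim simp
  then have "(\<lambda>t. blinfun_apply (rep_L2 g t) (rep_L2 v t)) \<in> borel_measurable lebesgue"
    by (rule lebesgue_integral_representative(1)[rotated]) measurable
  then show "integrable lebesgue (\<lambda>t. blinfun_apply (rep_L2 g t) (rep_L2 v t))"
    by (rule Bochner_Integration.integrable_bound[OF 1]) (use abs_blinfun_le in auto)
qed

lemma pairing_measurable:
  fixes g :: "('v::real_normed_vector \<Rightarrow>\<^sub>L real) L2"
  shows "(\<lambda>t. blinfun_apply (rep_L2 g t) (rep_L2 v t)) \<in> borel_measurable lebesgue"
  using pairing_integrable(2) by (rule borel_measurable_integrable)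

lemma pairing_set_integrable:
  fixes g :: "('v::real_normed_vector \<Rightarrow>\<^sub>L real) L2"
  shows "set_integrable lebesgue {0<..<T} (\<lambda>t. blinfun_apply (rep_L2 g t) (rep_L2 v t))"
  unfolding set_integrable_def by (rule integrable_mult_indicator[OF _ pairing_integrable(2)]) simp

lemma pairing_lincomb_left: "pairing T (g + c *\<^sub>R h) v = pairing T g v + c * pairing T h v"
proof -
  have "pairing T (g + c *\<^sub>R h) v = (LINT t:{0<..<T}|lebesgue.
      blinfun_apply (rep_L2 g t) (rep_L2 v t) + c * blinfun_apply (rep_L2 h t) (rep_L2 v t))"
    unfolding pairing_def
  proof (rule set_lebesgue_integral_cong_AE)
    show "AE t\<in>{0<..<T} in lebesgue. blinfun_apply (rep_L2 (g + c *\<^sub>R h) t) (rep_L2 v t) =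
        blinfun_apply (rep_L2 g t) (rep_L2 v t) + c * blinfun_apply (rep_L2 h t) (rep_L2 v t)"
      using rep_lincomb_L2[of g c h] by eventually_elim (simp add: blinfun.add_left blinfun.scaleR_left)
  qed (auto intro!: borel_measurable_add borel_measurable_times pairing_measurable)
  then show ?thesis
    unfolding pairing_def
    by (simp add: set_integral_add(2)[OF pairing_set_integrable set_integrable_mult_right] pairing_set_integrable)
qed

lemma pairing_bound: "\<bar>pairing T g v\<bar> \<le> norm g * norm v"
proof -
  have sq: "integrable lebesgue (\<lambda>t. (norm (rep_L2 f t))\<^sup>2)" "(\<lambda>t. norm (rep_L2 f t)) \<in> borel_measurable lebesgue"
    for f :: "'x::real_normed_vector L2"
    using sq_integrable_rep[of f] strongly_measurable_norm unfolding sq_integrable_def by auto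
  have "\<bar>pairing T g v\<bar> \<le> (\<integral>t. \<bar>indicator {0<..<T} t * blinfun_apply (rep_L2 g t) (rep_L2 v t)\<bar> \<partial>lebesgue)"
    unfolding pairing_def set_lebesgue_integral_def
    using integral_norm_bound[of lebesgue "\<lambda>t. indicator {0<..<T} t * blinfun_apply (rep_L2 g t) (rep_L2 v t)"]
    by simp
  also have "\<dots> \<le> (\<integral>t. norm (rep_L2 g t) * norm (rep_L2 v t) \<partial>lebesgue)"
  proof (rule integral_mono)
    show "integrable lebesgue (\<lambda>t. \<bar>indicator {0<..<T} t * blinfun_apply (rep_L2 g t) (rep_L2 v t)\<bar>)"
      using pairing_set_integrable[of T g v] unfolding set_integrable_def by simp
    show "\<bar>indicator {0<..<T} t * blinfun_apply (rep_L2 g t) (rep_L2 v t)\<bar>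
        \<le> norm (rep_L2 g t) * norm (rep_L2 v t)" for t
      using abs_blinfun_le[of "rep_L2 g t" "rep_L2 v t"] by (simp add: indicator_def)
  qed (rule pairing_integrable)
  also have "\<dots> \<le> norm g * norm v"
    using Cauchy_Schwarz_integral[OF sq(2) sq(2) sq(1) sq(1), of g v]
    unfolding norm_L2_eq by (simp add: real_sqrt_mult)
  finally show ?thesis .
qed

section \<open>Uniqueness and linearity of the weak derivative\<close>

text \<open>The norm of a functional need not be attained, but half of it is reached on the unit ball.\<close>

lemma ex_almost_norming:
  fixes f :: "'v::real_normed_vector \<Rightarrow>\<^sub>L real"
  shows "\<exists>v. norm v \<le> 1 \<and> norm f \<le> 2 * \<bar>blinfun_apply f v\<bar>"
proof (cases "f = 0")
  case False
  have "\<exists>x. norm f / 2 * norm x < \<bar>blinfun_apply f x\<bar>"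
  proof (rule ccontr)
    assume "\<not> ?thesis"
    then have "norm f \<le> norm f / 2" by (intro norm_blinfun_bound) (auto simp: not_less)
    then show False using False by simp
  qed
  then obtain x where x: "norm f / 2 * norm x < \<bar>blinfun_apply f x\<bar>" by blast
  then have "x \<noteq> 0" by auto
  then have "norm f \<le> 2 * \<bar>blinfun_apply f (x /\<^sub>R norm x)\<bar>"
    using x by (simp add: blinfun.scaleR_right abs_mult field_simps)
  moreover have "norm (x /\<^sub>R norm x) \<le> 1" using \<open>x \<noteq> 0\<close> by simp
  ultimately show ?thesis by blast
qed (auto intro: exI[of _ 0])

text \<open>Up to a factor of two, countably many vectors norm all values of the approximating simple
  functions. So it suffices to combine countably many of the exceptional null sets, which depend on
  the vector.\<close>

lemma weakly_zero_imp_zero: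
  fixes D :: "real \<Rightarrow> 'v::real_normed_vector \<Rightarrow>\<^sub>L real"
  assumes D: "simple_limit borel D"
    and 0: "\<And>v. AE t in lborel. blinfun_apply (D t) v = 0"
  shows "AE t in lborel. D t = 0"
proof -
  obtain s where s: "\<And>n::nat. simple_function borel (s n)" "\<And>t. (\<lambda>n. s n t) \<longlonglongrightarrow> D t"
    using D unfolding simple_limit_def by auto
  define Q where "Q = (\<Union>n. range (s n))"
  have "finite (range (s n))" for n using s(1)[of n] by (simp add: simple_function_def)
  then have cQ: "countable Q" unfolding Q_def by (intro countable_UN) (auto intro: countable_finite)
  obtain V where V: "\<And>f :: 'v \<Rightarrow>\<^sub>L real. norm (V f) \<le> 1" "\<And>f. norm f \<le> 2 * \<bar>blinfun_apply f (V f)\<bar>"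
    using ex_almost_norming by metis
  have "AE t in lborel. \<forall>q\<in>Q. blinfun_apply (D t) (V q) = 0"
    unfolding AE_ball_countable[OF cQ] using 0 by blast
  then show ?thesis
  proof eventually_elim
    case (elim t)
    have le: "norm (s n t) \<le> 2 * norm (s n t - D t)" for n
    proof -
      have "s n t \<in> Q" unfolding Q_def by blast
      then have "blinfun_apply (s n t) (V (s n t)) = blinfun_apply (s n t - D t) (V (s n t))"
        using elim by (simp add: blinfun.diff_left)
      also have "\<bar>\<dots>\<bar> \<le> norm (s n t - D t) * norm (V (s n t))" by (rule abs_blinfun_le)
      also have "\<dots> \<le> norm (s n t - D t) * 1" by (intro mult_left_mono V) simp
      finally show ?thesis using V(2)[of "s n t"] by simp
    qed
    have "(\<lambda>n. norm (s n t)) \<longlonglongrightarrow> norm (D t)" by (intro tendsto_norm s(2))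
    moreover have "(\<lambda>n. 2 * norm (s n t - D t)) \<longlonglongrightarrow> 2 * norm (D t - D t)" by (intro tendsto_intros s(2))
    ultimately have "norm (D t) \<le> 2 * norm (D t - D t)" by (rule LIMSEQ_le) (use le in blast)
    then show ?case by simp
  qed
qed

text \<open>Both sides of the identity defining the weak derivative are of the following form.\<close>

lemma moment_integral:
  fixes f :: "'a::real_normed_vector L2"
  assumes f': "simple_limit borel f'" "AE t in lebesgue. rep_L2 f t = f' t"
      "\<And>t. t \<notin> {0<..<T} \<Longrightarrow> f' t = 0" "integrable lborel (\<lambda>t. (norm (f' t))\<^sup>2)"
    and \<phi>: "test_function T \<phi>" and L: "bounded_linear L"
  shows "(LINT t:{0<..<T}|lebesgue. \<phi> t * L (rep_L2 f t)) = (\<integral>t. \<phi> t * L (f' t) \<partial>lborel)"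
    "set_integrable lebesgue {0<..<T} (\<lambda>t. \<phi> t * L (rep_L2 f t))"
proof -
  have [measurable]: "(\<lambda>t. L (f' t)) \<in> borel_measurable borel" by (rule measurable_functional[OF f'(1) L])
  have [measurable]: "\<phi> \<in> borel_measurable borel"
    by (intro borel_measurable_continuous_onI test_function_continuous[OF \<phi>])
  have 0: "L 0 = 0" using L by (simp add: linear_simps)
  have ae: "AE t in lebesgue. indicator {0<..<T} t *\<^sub>R (\<phi> t * L (rep_L2 f t)) = \<phi> t * L (f' t)"
    using f'(2)
  proof eventually_elim
    case (elim t)
    then show ?case using f'(3)[of t] 0 by (cases "t \<in> {0<..<T}") auto
  qed
  show "(LINT t:{0<..<T}|lebesgue. \<phi> t * L (rep_L2 f t)) = (\<integral>t. \<phi> t * L (f' t) \<partial>lborel)"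
    unfolding set_lebesgue_integral_def by (rule lebesgue_integral_representative(2)[OF _ ae]) measurable
  have "simple_limit lborel f'" using f'(1) unfolding simple_limit_def simple_function_def by simp
  then have "integrable lborel (\<lambda>t. L (f' t))"
    by (rule integrable_functional[OF _ integrable_norm_of_square[OF f'(1,4,3)] L])
  then have "integrable lborel (\<lambda>t. \<phi> t * L (f' t))" by (rule test_function_mult_integrable[OF \<phi>])
  then show "set_integrable lebesgue {0<..<T} (\<lambda>t. \<phi> t * L (rep_L2 f t))"
    unfolding set_integrable_def by (subst lebesgue_integral_representative(3)[OF _ ae]) measurable
qed

lemma moment_integrable:
  assumes "f \<in> L2_on {0<..<T}" "test_function T \<phi>" "bounded_linear L"
  shows "set_integrable lebesgue {0<..<T} (\<lambda>t. \<phi> t * L (rep_L2 f t))"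
proof -
  obtain f' where "simple_limit borel f'" "AE t in lebesgue. rep_L2 f t = f' t"
    "\<And>t. t \<notin> {0<..<T} \<Longrightarrow> f' t = 0" "integrable lborel (\<lambda>t. (norm (f' t))\<^sup>2)"
    using L2_on_borel_representative[OF assms(1)] by blast
  from moment_integral(2)[OF this assms(2,3)] show ?thesis .
qed

lemma moment_lincomb:
  assumes f: "f \<in> L2_on {0<..<T}" and h: "h \<in> L2_on {0<..<T}"
    and \<phi>: "test_function T \<phi>" and L: "bounded_linear L"
  shows "(LINT t:{0<..<T}|lebesgue. \<phi> t * L (rep_L2 (f + c *\<^sub>R h) t)) =
    (LINT t:{0<..<T}|lebesgue. \<phi> t * L (rep_L2 f t))
    + c * (LINT t:{0<..<T}|lebesgue. \<phi> t * L (rep_L2 h t))"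
proof -
  note i = moment_integrable[OF f \<phi> L]
    set_integrable_mult_right[of c lebesgue "{0<..<T}", OF moment_integrable[OF h \<phi> L]]
    moment_integrable[OF subspace_add[OF subspace_L2_on f subspace_scale[OF subspace_L2_on h]] \<phi> L]
  have "(LINT t:{0<..<T}|lebesgue. \<phi> t * L (rep_L2 (f + c *\<^sub>R h) t)) =
    (LINT t:{0<..<T}|lebesgue. \<phi> t * L (rep_L2 f t) + c * (\<phi> t * L (rep_L2 h t)))"
    unfolding set_lebesgue_integral_def
  proof (rule Bochner_Integration.integral_cong_AE)
    show "AE t in lebesgue. indicat_real {0<..<T} t *\<^sub>R (\<phi> t * L (rep_L2 (f + c *\<^sub>R h) t)) =
      indicat_real {0<..<T} t *\<^sub>R (\<phi> t * L (rep_L2 f t) + c * (\<phi> t * L (rep_L2 h t)))"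
      using rep_lincomb_L2[of f c h]
      by eventually_elim (use L in \<open>simp add: linear_simps distrib_left mult.left_commute\<close>)
    show "(\<lambda>t. indicat_real {0<..<T} t *\<^sub>R (\<phi> t * L (rep_L2 (f + c *\<^sub>R h) t))) \<in> borel_measurable lebesgue"
      using i(3) unfolding set_integrable_def by (rule borel_measurable_integrable)
    show "(\<lambda>t. indicat_real {0<..<T} t *\<^sub>R (\<phi> t * L (rep_L2 f t) + c * (\<phi> t * L (rep_L2 h t))))
        \<in> borel_measurable lebesgue"
      using set_integral_add(1)[OF i(1,2)] unfolding set_integrable_def by (rule borel_measurable_integrable)
  qed
  then show ?thesis using set_integral_add(2)[OF i(1,2)] by simp
qed

lemma has_weak_derivative_lincomb:
  assumes j: "bounded_linear j" and w: "w \<in> Y_space T" "has_weak_derivative T j w g"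
    and v: "v \<in> Y_space T" "has_weak_derivative T j v h"
  shows "has_weak_derivative T j (w + c *\<^sub>R v) (g + c *\<^sub>R h)"
proof -
  have L: "bounded_linear (\<lambda>x. j x \<bullet> j z)" for z
    by (rule bounded_linear_compose[OF bounded_linear_inner_left j])
  have gh: "g \<in> L2_on {0<..<T}" "h \<in> L2_on {0<..<T}" using w v by (auto simp: has_weak_derivative_def)
  have wv: "w \<in> L2_on {0<..<T}" "v \<in> L2_on {0<..<T}" using w v by (auto simp: Y_space_def)
  show ?thesis
    unfolding has_weak_derivative_def
  proof (intro conjI allI impI)
    show "g + c *\<^sub>R h \<in> L2_on {0<..<T}"
      using gh by (intro subspace_add[OF subspace_L2_on] subspace_scale[OF subspace_L2_on])
    fix \<phi> z assume \<phi>: "test_function T \<phi>"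
    show "(LINT t:{0<..<T}|lebesgue. deriv \<phi> t * (j (rep_L2 (w + c *\<^sub>R v) t) \<bullet> j z)) =
       - (LINT t:{0<..<T}|lebesgue. \<phi> t * blinfun_apply (rep_L2 (g + c *\<^sub>R h) t) z)"
      using moment_lincomb[OF wv test_function_deriv[OF \<phi>] L, of c z]
        moment_lincomb[OF gh \<phi> blinfun.bounded_linear_left, of c z] w(2) v(2) \<phi>
      unfolding has_weak_derivative_def by simp
  qed
qed

text \<open>The fundamental lemma is applied to \<open>t \<mapsto> (g t - h t) v\<close> for each \<open>v\<close>.\<close>

lemma has_weak_derivative_unique:
  assumes g: "has_weak_derivative T j w g" and h: "has_weak_derivative T j w h"
  shows "g = h"
proof -
  have gh: "g \<in> L2_on {0<..<T}" "h \<in> L2_on {0<..<T}" using g h by (auto simp: has_weak_derivative_def)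
  obtain g' where g': "simple_limit borel g'" "AE t in lebesgue. rep_L2 g t = g' t"
    "\<And>t. t \<notin> {0<..<T} \<Longrightarrow> g' t = 0" "integrable lborel (\<lambda>t. (norm (g' t))\<^sup>2)"
    using L2_on_borel_representative[OF gh(1)] by blast
  obtain h' where h': "simple_limit borel h'" "AE t in lebesgue. rep_L2 h t = h' t"
    "\<And>t. t \<notin> {0<..<T} \<Longrightarrow> h' t = 0" "integrable lborel (\<lambda>t. (norm (h' t))\<^sup>2)"
    using L2_on_borel_representative[OF gh(2)] by blast
  have bl: "bounded_linear (\<lambda>G. blinfun_apply G v)" for v :: 'a by (rule blinfun.bounded_linear_left)
  have sl: "simple_limit lborel g'" "simple_limit lborel h'"
    using g'(1) h'(1) unfolding simple_limit_def simple_function_def by simp_all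
  have i: "integrable lborel (\<lambda>t. blinfun_apply (g' t) v)" "integrable lborel (\<lambda>t. blinfun_apply (h' t) v)" for v
    using integrable_functional[OF sl(1) integrable_norm_of_square[OF g'(1,4,3)] bl]
      integrable_functional[OF sl(2) integrable_norm_of_square[OF h'(1,4,3)] bl] by auto
  have "AE t in lborel. blinfun_apply (g' t - h' t) v = 0" for v
  proof -
    have "AE t in lborel. t \<in> {0<..<T} \<longrightarrow> blinfun_apply (g' t) v - blinfun_apply (h' t) v = 0"
    proof (rule fundamental_lemma)
      show "integrable lborel (\<lambda>t. blinfun_apply (g' t) v - blinfun_apply (h' t) v)" using i by simp
      fix \<phi> assume \<phi>: "test_function T \<phi>"
      have "(\<integral>t. \<phi> t * blinfun_apply (g' t) v \<partial>lborel) = (\<integral>t. \<phi> t * blinfun_apply (h' t) v \<partial>lborel)"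
      proof -
        have "(LINT t:{0<..<T}|lebesgue. deriv \<phi> t * (j (rep_L2 w t) \<bullet> j v)) =
            - (LINT t:{0<..<T}|lebesgue. \<phi> t * blinfun_apply (rep_L2 g t) v)"
          "(LINT t:{0<..<T}|lebesgue. deriv \<phi> t * (j (rep_L2 w t) \<bullet> j v)) =
            - (LINT t:{0<..<T}|lebesgue. \<phi> t * blinfun_apply (rep_L2 h t) v)"
          using g h \<phi> unfolding has_weak_derivative_def by blast+
        then show ?thesis
          using moment_integral(1)[OF g' \<phi> bl, of v] moment_integral(1)[OF h' \<phi> bl, of v] by simp
      qed
      then show "(\<integral>t. \<phi> t * (blinfun_apply (g' t) v - blinfun_apply (h' t) v) \<partial>lborel) = 0"
        using test_function_mult_integrable[OF \<phi> i(1)] test_function_mult_integrable[OF \<phi> i(2)]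
        by (simp add: right_diff_distrib)
    qed
    then show ?thesis
    proof eventually_elim
      case (elim t)
      then show ?case using g'(3)[of t] h'(3)[of t]
        by (cases "t \<in> {0<..<T}") (auto simp: blinfun.diff_left)
    qed
  qed
  then have "AE t in lborel. g' t - h' t = 0"
    by (intro weakly_zero_imp_zero simple_limit_diff g' h')
  then have "AE t in lebesgue. g' t - h' t = 0" by (rule AE_completion)
  with g'(2) h'(2) have "AE t in lebesgue. rep_L2 g t = rep_L2 h t" by eventually_elim simp
  then show ?thesis by (simp add: L2_eq_iff)
qed

lemma weak_derivative_eqI: "has_weak_derivative T j w g \<Longrightarrow> weak_derivative T j w = g"
  unfolding weak_derivative_def by (rule the_equality) (auto intro: has_weak_derivative_unique)

lemma has_weak_derivative_weak_derivative:
  assumes "w \<in> X_space T j"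
  shows "has_weak_derivative T j w (weak_derivative T j w)"
proof -
  obtain g where "has_weak_derivative T j w g" using assms unfolding X_space_def by blast
  then show ?thesis by (simp only: weak_derivative_eqI)
qed

lemma d_t_eq_pairing: "d_t T j w v = pairing T (weak_derivative T j w) v"
  unfolding d_t_def pairing_def ..

lemma X_space_subset: "X_space T j \<subseteq> Y_space T"
  by (auto simp: X_space_def)

lemma subspace_X_space:
  assumes j: "bounded_linear j"
  shows "subspace (X_space T j)"
proof (rule subspaceI)
  have "has_weak_derivative T j 0 0"
  proof -
    have z: "AE t in lebesgue. \<psi> t * (j (rep_L2 0 t) \<bullet> j v) = 0"
      "AE t in lebesgue. \<psi> t * blinfun_apply (rep_L2 (0 :: ('a \<Rightarrow>\<^sub>L real) L2) t) v = 0" for v and \<psi> :: "real \<Rightarrow> real"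
      using rep_zero_L2[where ?'a = 'a] rep_zero_L2[where ?'a = "'a \<Rightarrow>\<^sub>L real"]
      by (eventually_elim, use j in \<open>simp add: linear_simps\<close>)+
    have "(LINT t:{0<..<T}|lebesgue. f t) = 0" if "AE t in lebesgue. f t = 0" for f :: "real \<Rightarrow> real"
      unfolding set_lebesgue_integral_def
      by (rule integral_eq_zero_AE) (use that in eventually_elim, simp)
    with z show ?thesis unfolding has_weak_derivative_def by (simp add: subspace_0[OF subspace_L2_on])
  qed
  then show 0: "0 \<in> X_space T j" using subspace_0[OF subspace_Y_space] by (auto simp: X_space_def)
  have lincomb: "v + c *\<^sub>R w \<in> X_space T j" if "v \<in> X_space T j" "w \<in> X_space T j" for v w c
    using that has_weak_derivative_lincomb[OF j] subspace_add[OF subspace_Y_space]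
      subspace_scale[OF subspace_Y_space] unfolding X_space_def by blast
  show "v + w \<in> X_space T j" if "v \<in> X_space T j" "w \<in> X_space T j" for v w
    using lincomb[OF that, of 1] by simp
  show "c *\<^sub>R v \<in> X_space T j" if "v \<in> X_space T j" for c v
    using lincomb[OF 0 that, of c] by simp
qed

lemma weak_derivative_lincomb:
  assumes "bounded_linear j" "w \<in> X_space T j" "v \<in> X_space T j"
  shows "weak_derivative T j (w + c *\<^sub>R v) = weak_derivative T j w + c *\<^sub>R weak_derivative T j v"
  using assms
  by (intro weak_derivative_eqI has_weak_derivative_lincomb has_weak_derivative_weak_derivative
      subsetD[OF X_space_subset])

lemma d_t_lincomb:
  assumes "bounded_linear j" "w \<in> X_space T j" "v \<in> X_space T j"
  shows "d_t T j (w + c *\<^sub>R v) z = d_t T j w z + c * d_t T j v z"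
  unfolding d_t_eq_pairing by (simp only: weak_derivative_lincomb[OF assms] pairing_lincomb_left)

section \<open>Traces\<close>

definition continuous_version :: "real \<Rightarrow> ('v::real_inner \<Rightarrow> 'h::real_inner) \<Rightarrow> 'v L2 \<Rightarrow> (real \<Rightarrow> 'h) \<Rightarrow> bool" where
  "continuous_version T j w c \<longleftrightarrow> continuous_on {0..T} c \<and>
     (AE s in lebesgue. s \<in> {0<..<T} \<longrightarrow> c s = j (rep_L2 w s))"

lemma continuous_version_unique:
  assumes T: "T > 0" and c: "continuous_version T j w c" and d: "continuous_version T j w d"
    and t: "t \<in> {0..T}"
  shows "c t = d t"
proof (rule ccontr)
  assume ne: "c t \<noteq> d t"
  have cont: "continuous_on {0..T} (\<lambda>s. norm (c s - d s))"
    using c d by (auto simp: continuous_version_def intro!: continuous_intros)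
  then obtain e where e: "e > 0"
    "\<And>s. s \<in> {0..T} \<Longrightarrow> dist s t < e \<Longrightarrow> dist (norm (c s - d s)) (norm (c t - d t)) < norm (c t - d t)"
    using t ne unfolding continuous_on_iff by (metis right_minus_eq zero_less_norm_iff)
  have ae: "AE s in lborel. s \<in> {0<..<T} \<longrightarrow> c s = d s"
  proof -
    have "AE s in lebesgue. s \<in> {0<..<T} \<longrightarrow> c s = d s"
      using c[unfolded continuous_version_def, THEN conjunct2] d[unfolded continuous_version_def, THEN conjunct2]
      by eventually_elim simp
    then show ?thesis by (simp add: AE_completion_iff)
  qed
  define a where "a = max 0 (t - e)"
  define b where "b = min T (t + e)"
  have ab: "a < b" "0 \<le> a" "b \<le> T" "t - e \<le> a" "b \<le> t + e"
    using t e(1) T unfolding a_def b_def atLeastAtMost_iff by linarith+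
  from AE_ex_in_interval[OF ab(1) ae] obtain s where s: "a < s" "s < b" "s \<in> {0<..<T} \<longrightarrow> c s = d s"
    unfolding Bex_def greaterThanLessThan_iff by blast
  have "c s = d s" using s ab unfolding greaterThanLessThan_iff by linarith
  moreover have "s \<in> {0..T}" "dist s t < e" using s ab by (auto simp: dist_real_def)
  ultimately show False using e(2)[of s] by simp
qed

lemma time_trace_eqI:
  assumes "T > 0" "continuous_version T j w c" "t \<in> {0..T}"
  shows "time_trace T j t w = c t"
  unfolding time_trace_def
proof (rule the_equality)
  show "\<exists>c'. continuous_on {0..T} c' \<and> (AE s in lebesgue. s \<in> {0<..<T} \<longrightarrow> c' s = j (rep_L2 w s)) \<and> c' t = c t"
    using assms(2) unfolding continuous_version_def by blast
next
  fix h assume "\<exists>c'. continuous_on {0..T} c' \<and> (AE s in lebesgue. s \<in> {0<..<T} \<longrightarrow> c' s = j (rep_L2 w s)) \<and> c' t = h"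
  then show "h = c t"
    using continuous_version_unique[OF assms(1) _ assms(2,3)] unfolding continuous_version_def by metis
qed

lemma ex_continuous_version:
  fixes j :: "'v::real_inner \<Rightarrow> 'h::{real_inner,complete_space}"
  assumes j: "bounded_linear j" and T: "T > 0" and w: "w \<in> X_space T j"
  obtains c where "continuous_version T j w c" "(norm (c T))\<^sup>2 - (norm (c 0))\<^sup>2 = 2 * d_t T j w w"
proof -
  define g where "g = weak_derivative T j w"
  have g: "has_weak_derivative T j w g"
    unfolding g_def using w by (rule has_weak_derivative_weak_derivative)
  have wL: "w \<in> L2_on {0<..<T}" using w X_space_subset unfolding Y_space_def by blast
  have gL: "g \<in> L2_on {0<..<T}" using g by (simp add: has_weak_derivative_def)
  obtain w' where w': "simple_limit borel w'" "AE t in lebesgue. rep_L2 w t = w' t"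
    "\<And>t. t \<notin> {0<..<T} \<Longrightarrow> w' t = 0" "integrable lborel (\<lambda>t. (norm (w' t))\<^sup>2)"
    using L2_on_borel_representative[OF wL] by blast
  obtain g' where g': "simple_limit borel g'" "AE t in lebesgue. rep_L2 g t = g' t"
    "\<And>t. t \<notin> {0<..<T} \<Longrightarrow> g' t = 0" "integrable lborel (\<lambda>t. (norm (g' t))\<^sup>2)"
    using L2_on_borel_representative[OF gL] by blast
  have L: "bounded_linear (\<lambda>x. j x \<bullet> j z)" for z
    by (rule bounded_linear_compose[OF bounded_linear_inner_left j])
  have weak: "(\<integral>t. deriv \<phi> t * (j (w' t) \<bullet> j v) \<partial>lborel) = - (\<integral>t. \<phi> t * blinfun_apply (g' t) v \<partial>lborel)"
    if \<phi>: "test_function T \<phi>" for \<phi> v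
    using moment_integral(1)[OF w' test_function_deriv[OF \<phi>] L, of v]
      moment_integral(1)[OF g' \<phi> blinfun.bounded_linear_left, of v] g \<phi>
    unfolding has_weak_derivative_def by simp
  interpret weak_pair j T w' g'
    by (rule weak_pair.intro[OF j T w'(1) g'(1) w'(4) g'(4) w'(3) g'(3) weak])
  obtain c where c: "continuous_on {0..T} c" "AE t in lborel. t \<in> {0<..<T} \<longrightarrow> c t = j (w' t)"
    "(norm (c T))\<^sup>2 - (norm (c 0))\<^sup>2 = 2 * (\<integral>t. blinfun_apply (g' t) (w' t) \<partial>lborel)"
    using continuous_representative by blast
  have "AE t in lebesgue. t \<in> {0<..<T} \<longrightarrow> c t = j (rep_L2 w t)"
    using AE_completion[OF c(2)] w'(2) by eventually_elim simp
  with c(1) have "continuous_version T j w c" by (simp add: continuous_version_def)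
  moreover have "d_t T j w w = (\<integral>t. blinfun_apply (g' t) (w' t) \<partial>lborel)"
    unfolding d_t_eq_pairing pairing_def set_lebesgue_integral_def g_def[symmetric]
  proof (rule lebesgue_integral_representative(2))
    show "(\<lambda>t. blinfun_apply (g' t) (w' t)) \<in> borel_measurable borel"
      by (rule simple_limit_pairing_measurable[OF g'(1) w'(1)])
    show "AE t in lebesgue. indicat_real {0<..<T} t *\<^sub>R blinfun_apply (rep_L2 g t) (rep_L2 w t)
        = blinfun_apply (g' t) (w' t)"
      using g'(2) w'(2)
    proof eventually_elim
      case (elim t)
      then show ?case using g'(3)[of t] by (cases "t \<in> {0<..<T}") auto
    qed
  qed
  ultimately show ?thesis using that c(3) by simp
qed

lemma time_trace_lincomb:
  fixes j :: "'v::real_inner \<Rightarrow> 'h::{real_inner,complete_space}"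
  assumes j: "bounded_linear j" and T: "T > 0" and w: "w \<in> X_space T j" and v: "v \<in> X_space T j"
    and t: "t \<in> {0..T}"
  shows "time_trace T j t (w + k *\<^sub>R v) = time_trace T j t w + k *\<^sub>R time_trace T j t v"
proof -
  obtain c where c: "continuous_version T j w c" using ex_continuous_version[OF j T w] by blast
  obtain d where d: "continuous_version T j v d" using ex_continuous_version[OF j T v] by blast
  have "AE s in lebesgue. s \<in> {0<..<T} \<longrightarrow> c s + k *\<^sub>R d s = j (rep_L2 (w + k *\<^sub>R v) s)"
    using c[unfolded continuous_version_def, THEN conjunct2] d[unfolded continuous_version_def, THEN conjunct2]
      rep_lincomb_L2[of w k v]
    by eventually_elim (use j in \<open>simp add: linear_simps\<close>)
  then have "continuous_version T j (w + k *\<^sub>R v) (\<lambda>s. c s + k *\<^sub>R d s)"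
    using c d by (auto simp: continuous_version_def intro!: continuous_intros)
  then show ?thesis using time_trace_eqI[OF T _ t] c d by metis
qed

lemma energy_identity:
  fixes j :: "'v::real_inner \<Rightarrow> 'h::{real_inner,complete_space}"
  assumes j: "bounded_linear j" and T: "T > 0" and w: "w \<in> X_space T j"
  shows "(norm (time_trace T j T w))\<^sup>2 - (norm (time_trace T j 0 w))\<^sup>2 = 2 * d_t T j w w"
proof -
  obtain c where c: "continuous_version T j w c" "(norm (c T))\<^sup>2 - (norm (c 0))\<^sup>2 = 2 * d_t T j w w"
    using ex_continuous_version[OF j T w] .
  then show ?thesis using T by (simp add: time_trace_eqI[OF T c(1)])
qed

section \<open>Finite dimensional subspaces of normed spaces\<close>

lemma closed_of_bounded_subsequences:
  fixes S :: "'a::real_normed_vector set"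
  assumes S: "\<And>x :: nat \<Rightarrow> 'a. range x \<subseteq> S \<Longrightarrow> bounded (range x) \<Longrightarrow>
    \<exists>l\<in>S. \<exists>r. strict_mono r \<and> (x \<circ> r) \<longlonglongrightarrow> l"
  shows "closed S"
  unfolding closed_sequential_limits
proof (intro allI impI, elim conjE)
  fix x l assume x: "\<forall>n. x n \<in> S" "x \<longlonglongrightarrow> l"
  then have "range x \<subseteq> S" "bounded (range x)" by (auto intro: convergent_imp_bounded)
  from S[OF this] obtain l' r where l': "l' \<in> S" "strict_mono r" "(x \<circ> r) \<longlonglongrightarrow> l'" by blast
  have "(x \<circ> r) \<longlonglongrightarrow> l" using x(2) l'(2) by (rule LIMSEQ_subseq_LIMSEQ)
  with l'(3) have "l' = l" by (rule LIMSEQ_unique)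
  with l'(1) show "l \<in> S" by simp
qed

text \<open>The number \<open>d\<close> is a lower bound for the distance of \<open>b\<close> from \<open>S\<close>.\<close>

lemma coefficient_bound:
  fixes b :: "'a::real_normed_vector"
  assumes S: "subspace S" "closed S" and b: "b \<notin> S"
  obtains d where "d > 0" "\<And>a y. y \<in> S \<Longrightarrow> \<bar>a\<bar> * d \<le> norm (a *\<^sub>R b + y)"
proof -
  have "open (- S)" "b \<in> - S" using S b by auto
  then obtain d where d: "d > 0" "ball b d \<subseteq> - S" unfolding open_contains_ball by blast
  have "\<bar>a\<bar> * d \<le> norm (a *\<^sub>R b + y)" if y: "y \<in> S" for a y
  proof (cases "a = 0")
    case False
    have "(- (1 / a)) *\<^sub>R y \<in> S" by (rule subspace_scale[OF S(1) y])
    then have "(- (1 / a)) *\<^sub>R y \<notin> ball b d" using d(2) by blast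
    then have "d \<le> norm (b - (- (1 / a)) *\<^sub>R y)" by (simp add: dist_norm)
    then have "\<bar>a\<bar> * d \<le> \<bar>a\<bar> * norm (b - (- (1 / a)) *\<^sub>R y)" by (rule mult_left_mono) simp
    also have "\<dots> = norm (a *\<^sub>R (b - (- (1 / a)) *\<^sub>R y))" by simp
    also have "a *\<^sub>R (b - (- (1 / a)) *\<^sub>R y) = a *\<^sub>R b + y" using False by (simp add: algebra_simps)
    finally show ?thesis .
  qed simp
  with d(1) show ?thesis using that by blast
qed

text \<open>By induction on the number of generators. The coefficients of an additional generator \<open>b\<close> are
  bounded by \<open>coefficient_bound\<close>, which applies because the span of the other generators is closed by
  the induction hypothesis.\<close>

lemma span_bounded_subsequence:
  fixes B :: "'a::real_normed_vector set" and x :: "nat \<Rightarrow> 'a"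
  assumes "finite B" "range x \<subseteq> span B" "bounded (range x)"
  shows "\<exists>l\<in>span B. \<exists>r. strict_mono r \<and> (x \<circ> r) \<longlonglongrightarrow> l"
  using assms
proof (induction B arbitrary: x rule: finite_induct)
  case empty
  then have "x = (\<lambda>n. 0)" by auto
  then show ?case by (intro bexI[of _ 0] exI[of _ id]) (auto simp: strict_mono_def o_def)
next
  case (insert b B)
  show ?case
  proof (cases "b \<in> span B")
    case True
    then have "span (insert b B) = span B" by (rule span_redundant)
    then show ?thesis using insert by simp
  next
    case False
    have "closed (span B)" using insert.IH by (rule closed_of_bounded_subsequences)
    then obtain d where d: "d > 0" "\<And>a y. y \<in> span B \<Longrightarrow> \<bar>a\<bar> * d \<le> norm (a *\<^sub>R b + y)"
      using coefficient_bound[OF subspace_span _ False] by blast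
    have "\<forall>n. \<exists>k. x n - k *\<^sub>R b \<in> span B"
      using insert.prems(1) span_breakdown_eq[of _ b B] by blast
    then obtain a where a: "\<And>n. x n - a n *\<^sub>R b \<in> span B" by metis
    obtain M where M: "\<And>n. norm (x n) \<le> M" using insert.prems(2) unfolding bounded_iff by auto
    have aM: "\<bar>a n\<bar> \<le> M / d" for n
      using d(2)[OF a[of n], of "a n"] M[of n] d(1) by (simp add: field_simps)
    then have "bounded (range a)" unfolding bounded_iff by auto
    then obtain a' r1 where r1: "strict_mono r1" "(a \<circ> r1) \<longlonglongrightarrow> a'"
      using bounded_imp_convergent_subsequence by blast
    define y where "y n = x (r1 n) - a (r1 n) *\<^sub>R b" for n
    have "range y \<subseteq> span B" using a by (auto simp: y_def)
    moreover have "bounded (range y)"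
    proof -
      have "norm (y n) \<le> M + M / d * norm b" for n
      proof -
        have "norm (y n) \<le> norm (x (r1 n)) + norm (a (r1 n) *\<^sub>R b)"
          unfolding y_def by (rule norm_triangle_ineq4)
        also have "\<dots> \<le> M + M / d * norm b"
          unfolding norm_scaleR by (intro add_mono mult_right_mono M aM) simp
        finally show ?thesis .
      qed
      then show ?thesis unfolding bounded_iff by auto
    qed
    ultimately obtain l r2 where r2: "l \<in> span B" "strict_mono r2" "(y \<circ> r2) \<longlonglongrightarrow> l"
      using insert.IH by blast
    have "(\<lambda>n. a (r1 (r2 n))) \<longlonglongrightarrow> a'"
      using LIMSEQ_subseq_LIMSEQ[OF r1(2) r2(2)] by (simp add: o_def)
    then have "(\<lambda>n. a (r1 (r2 n)) *\<^sub>R b + y (r2 n)) \<longlonglongrightarrow> a' *\<^sub>R b + l"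
      using r2(3) by (intro tendsto_intros) (simp_all add: o_def)
    then have "(x \<circ> (r1 \<circ> r2)) \<longlonglongrightarrow> a' *\<^sub>R b + l" by (simp add: y_def o_def)
    moreover have "a' *\<^sub>R b + l \<in> span (insert b B)"
    proof (rule span_add)
      show "a' *\<^sub>R b \<in> span (insert b B)" by (intro span_scale span_base) simp
      show "l \<in> span (insert b B)" using r2(1) span_mono[of B "insert b B"] by blast
    qed
    moreover have "strict_mono (r1 \<circ> r2)" using r1(1) r2(2) by (rule strict_mono_o)
    ultimately show ?thesis by blast
  qed
qed

lemma span_linear_bounded:
  fixes B :: "'a::real_normed_vector set" and f :: "'a \<Rightarrow> 'b::real_normed_vector"
  assumes "finite B"
    and "\<And>x y c. x \<in> span B \<Longrightarrow> y \<in> span B \<Longrightarrow> f (x + c *\<^sub>R y) = f x + c *\<^sub>R f y"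
  shows "\<exists>K\<ge>0. \<forall>x\<in>span B. norm (f x) \<le> K * norm x"
  using assms
proof (induction B rule: finite_induct)
  case empty
  have "f 0 = 0" using empty[of 0 0 1] by simp
  then show ?case by (intro exI[of _ 0]) simp
next
  case (insert b B)
  have sub: "span B \<subseteq> span (insert b B)" by (rule span_mono) auto
  have "\<exists>K\<ge>0. \<forall>x\<in>span B. norm (f x) \<le> K * norm x"
    using insert.prems sub by (intro insert.IH) blast
  then obtain K where K: "K \<ge> 0" "\<And>x. x \<in> span B \<Longrightarrow> norm (f x) \<le> K * norm x" by blast
  show ?case
  proof (cases "b \<in> span B")
    case True
    then have "span (insert b B) = span B" by (rule span_redundant)
    then show ?thesis using K by auto
  next
    case False
    have "closed (span B)"
      by (rule closed_of_bounded_subsequences) (rule span_bounded_subsequence[OF insert.hyps(1)])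
    then obtain d where d: "d > 0" "\<And>a y. y \<in> span B \<Longrightarrow> \<bar>a\<bar> * d \<le> norm (a *\<^sub>R b + y)"
      using coefficient_bound[OF subspace_span _ False] by blast
    have "norm (f x) \<le> (norm (f b) / d + K * (1 + norm b / d)) * norm x" if x: "x \<in> span (insert b B)" for x
    proof -
      obtain a where a: "x - a *\<^sub>R b \<in> span B" using x unfolding span_breakdown_eq by blast
      define y where "y = x - a *\<^sub>R b"
      have y: "y \<in> span B" "x = a *\<^sub>R b + y" using a by (auto simp: y_def)
      have ad: "\<bar>a\<bar> \<le> norm x / d" using d(2)[OF y(1), of a] d(1) y(2) by (simp add: field_simps)
      have b: "b \<in> span (insert b B)" by (rule span_base) simp
      have "f x = a *\<^sub>R f b + f y"
        using insert.prems[OF subsetD[OF sub y(1)] b, of a] y(2) by (simp add: add.commute)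
      then have "norm (f x) \<le> \<bar>a\<bar> * norm (f b) + norm (f y)"
        using norm_triangle_ineq[of "a *\<^sub>R f b" "f y"] by simp
      also have "\<dots> \<le> norm x / d * norm (f b) + K * (norm x + norm x / d * norm b)"
      proof (rule add_mono)
        show "\<bar>a\<bar> * norm (f b) \<le> norm x / d * norm (f b)" using ad by (rule mult_right_mono) simp
        have "norm y \<le> norm x + \<bar>a\<bar> * norm b"
          unfolding y_def using norm_triangle_ineq4[of x "a *\<^sub>R b"] by simp
        also have "\<dots> \<le> norm x + norm x / d * norm b" using ad by (intro add_left_mono mult_right_mono) simp_all
        finally show "norm (f y) \<le> K * (norm x + norm x / d * norm b)"
          using K(2)[OF y(1)] mult_left_mono[OF _ K(1)] by (meson order_trans)
      qed
      also have "\<dots> = (norm (f b) / d + K * (1 + norm b / d)) * norm x" by (simp add: algebra_simps)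
      finally show ?thesis .
    qed
    moreover have "norm (f b) / d + K * (1 + norm b / d) \<ge> 0" using d(1) K(1) by simp
    ultimately show ?thesis by blast
  qed
qed

lemma dual_norm_bound:
  assumes S: "subspace S" and f: "f \<in> dual S" and x: "x \<in> S"
  shows "\<bar>f x\<bar> \<le> dual_norm S f * norm x"
proof (cases "x = 0")
  case True
  have "f (0 *\<^sub>R x) = 0 * f x" using f x unfolding dual_def by blast
  with True show ?thesis by simp
next
  case False
  obtain K where K: "\<And>x. x \<in> S \<Longrightarrow> \<bar>f x\<bar> \<le> K * norm x" using f unfolding dual_def by blast
  have "bdd_above ((\<lambda>x. \<bar>f x\<bar>) ` {x \<in> S. norm x \<le> 1})"
  proof (rule bdd_aboveI2)
    fix y assume y: "y \<in> {x \<in> S. norm x \<le> 1}"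
    then have "\<bar>f y\<bar> \<le> K * norm y" using K by simp
    also have "\<dots> \<le> \<bar>K\<bar> * norm y" by (rule mult_right_mono) simp_all
    also have "\<dots> \<le> \<bar>K\<bar> * 1" using y by (intro mult_left_mono) auto
    finally show "\<bar>f y\<bar> \<le> \<bar>K\<bar>" by simp
  qed
  moreover have "x /\<^sub>R norm x \<in> {x \<in> S. norm x \<le> 1}"
    using x False subspace_scale[OF S] by simp
  ultimately have "\<bar>f (x /\<^sub>R norm x)\<bar> \<le> dual_norm S f"
    unfolding dual_norm_def by (rule cSUP_upper[rotated])
  moreover have "f (x /\<^sub>R norm x) = f x / norm x"
    using f x unfolding dual_def by (simp add: divide_inverse mult.commute)
  ultimately have "\<bar>f x\<bar> / norm x \<le> dual_norm S f" by (simp only: abs_divide abs_norm_cancel)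
  then show ?thesis using False by (simp add: pos_divide_le_eq)
qed

section \<open>The discrete systems\<close>

text \<open>An abstract version of the situation, in which \<open>D\<close> stands for the time derivative on the
  finite dimensional space \<open>X\<^sub>d\<close> and \<open>\<gamma>\<close>, \<open>\<gamma>'\<close> for the traces at the two end points.\<close>

locale galerkin =
  fixes Y Xd :: "'y::real_normed_vector set" and A D :: "'y \<Rightarrow> 'y \<Rightarrow> real"
    and \<gamma> \<gamma>' :: "'y \<Rightarrow> 'h::real_inner" and l :: "'y \<Rightarrow> real" and u\<^sub>0 :: 'h
    and L m K K\<^sub>0 K\<^sub>D :: real
  assumes Y: "subspace Y" and Xd: "subspace Xd" "Xd \<subseteq> Y"
    and Xd_subsequence: "\<And>x :: nat \<Rightarrow> 'y. range x \<subseteq> Xd \<Longrightarrow> bounded (range x) \<Longrightarrow>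
      \<exists>z\<in>Xd. \<exists>r. strict_mono r \<and> (x \<circ> r) \<longlonglongrightarrow> z"
    and A_diff: "\<And>w v v'. w \<in> Y \<Longrightarrow> v \<in> Y \<Longrightarrow> v' \<in> Y \<Longrightarrow> A w (v - v') = A w v - A w v'"
    and A_lipschitz: "\<And>w w' v. w \<in> Y \<Longrightarrow> w' \<in> Y \<Longrightarrow> v \<in> Y \<Longrightarrow> \<bar>A w v - A w' v\<bar> \<le> L * norm (w - w') * norm v"
    and A_monotone: "\<And>w w'. w \<in> Y \<Longrightarrow> w' \<in> Y \<Longrightarrow> A w (w - w') - A w' (w - w') \<ge> m * (norm (w - w'))\<^sup>2"
    and A_zero: "\<And>v. v \<in> Y \<Longrightarrow> A 0 v = 0"
    and L: "L > 0" and m: "m > 0"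
    and D_diff_left: "\<And>x x' v. x \<in> Xd \<Longrightarrow> x' \<in> Xd \<Longrightarrow> v \<in> Y \<Longrightarrow> D (x - x') v = D x v - D x' v"
    and D_bound: "\<And>x v. x \<in> Xd \<Longrightarrow> v \<in> Y \<Longrightarrow> \<bar>D x v\<bar> \<le> K\<^sub>D * norm x * norm v"
    and \<gamma>_diff: "\<And>x x'. x \<in> Xd \<Longrightarrow> x' \<in> Xd \<Longrightarrow> \<gamma> (x - x') = \<gamma> x - \<gamma> x'"
    and \<gamma>_bound: "\<And>x. x \<in> Xd \<Longrightarrow> norm (\<gamma> x) \<le> K\<^sub>0 * norm x"
    and l_bound: "\<And>v. v \<in> Y \<Longrightarrow> \<bar>l v\<bar> \<le> K * norm v"
    and nonneg: "K \<ge> 0" "K\<^sub>0 \<ge> 0" "K\<^sub>D \<ge> 0"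
begin

text \<open>The first equation is tested with \<open>\<theta>\<close> and the second with \<open>u\<close>. The coupling term \<open>D u \<theta>\<close> occurs in
  both and cancels; \<open>A 0 = 0\<close> makes both remaining terms with \<open>A\<close> coercive.\<close>

lemma a_priori_bound:
  assumes \<theta>: "\<theta> \<in> Y" and u: "u \<in> Xd"
    and eq1: "A \<theta> \<theta> + D u \<theta> = l \<theta>"
    and eq2: "D u \<theta> - (A u u + \<gamma>' u \<bullet> \<gamma>' u) = - (l u + u\<^sub>0 \<bullet> \<gamma> u)"
  shows "norm u \<le> 2 * (K + norm u\<^sub>0 * K\<^sub>0) / m"
proof -
  define C where "C = K + norm u\<^sub>0 * K\<^sub>0"
  have C: "C \<ge> K" "C \<ge> 0" using nonneg by (simp_all add: C_def)
  have uY: "u \<in> Y" using u Xd by blast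
  have coercive: "m * (norm w)\<^sup>2 \<le> A w w" if "w \<in> Y" for w
    using A_monotone[OF that subspace_0[OF Y]] A_zero[OF that] by simp
  have "u\<^sub>0 \<bullet> \<gamma> u \<le> norm u\<^sub>0 * norm (\<gamma> u)" by (rule norm_cauchy_schwarz)
  also have "\<dots> \<le> norm u\<^sub>0 * (K\<^sub>0 * norm u)" using \<gamma>_bound[OF u] by (rule mult_left_mono) simp
  finally have "l \<theta> + l u + u\<^sub>0 \<bullet> \<gamma> u \<le> K * norm \<theta> + (K * norm u + norm u\<^sub>0 * (K\<^sub>0 * norm u))"
    using l_bound[OF \<theta>] l_bound[OF uY] by linarith
  also have "\<dots> = K * norm \<theta> + C * norm u" by (simp add: C_def algebra_simps)
  also have "\<dots> \<le> C * norm \<theta> + C * norm u" using C by (auto intro: mult_right_mono)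
  finally have "l \<theta> + l u + u\<^sub>0 \<bullet> \<gamma> u \<le> C * (norm \<theta> + norm u)" by (simp add: algebra_simps)
  moreover have "A \<theta> \<theta> + A u u + \<gamma>' u \<bullet> \<gamma>' u = l \<theta> + l u + u\<^sub>0 \<bullet> \<gamma> u" using eq1 eq2 by linarith
  moreover have "\<gamma>' u \<bullet> \<gamma>' u \<ge> 0" by simp
  ultimately have h1: "m * (norm \<theta>)\<^sup>2 + m * (norm u)\<^sup>2 \<le> C * (norm \<theta> + norm u)"
    using coercive[OF \<theta>] coercive[OF uY] by linarith
  have h2: "m * (norm \<theta> + norm u)\<^sup>2 \<le> 2 * (m * (norm \<theta>)\<^sup>2 + m * (norm u)\<^sup>2)"
  proof -
    have "0 \<le> m * (norm \<theta> - norm u)\<^sup>2" using m by simp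
    then show ?thesis by (simp add: power2_eq_square algebra_simps)
  qed
  have *: "m * (norm \<theta> + norm u)\<^sup>2 \<le> 2 * (C * (norm \<theta> + norm u))"
    by (rule order_trans[OF h2 mult_left_mono[OF h1]]) simp
  have "norm \<theta> + norm u \<le> 2 * C / m"
  proof (cases "norm \<theta> + norm u = 0")
    case False
    define s where "s = norm \<theta> + norm u"
    have "s > 0" using False norm_ge_zero[of \<theta>] norm_ge_zero[of u] unfolding s_def by linarith
    moreover have "(m * s) * s \<le> (2 * C) * s"
      using * unfolding s_def[symmetric] by (simp add: power2_eq_square)
    ultimately have "m * s \<le> 2 * C" by simp
    then show ?thesis using m unfolding s_def[symmetric] by (simp add: pos_le_divide_eq mult.commute)
  qed (use C m in simp)
  then show ?thesis unfolding C_def using norm_ge_zero[of \<theta>] by linarith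
qed

text \<open>Cea's lemma: the Galerkin orthogonality \<open>A \<eta> - A \<theta> = 0\<close> on \<open>Yd\<close> permits replacing \<open>\<eta> - \<theta>\<close> by \<open>\<eta> - v\<close>
  in one argument.\<close>

lemma quasi_optimality:
  assumes \<theta>: "\<theta> \<in> Yd" and \<eta>: "\<eta> \<in> Y" and Yd: "subspace Yd" "Yd \<subseteq> Y" and v: "v \<in> Yd"
    and eq: "\<And>v. v \<in> Yd \<Longrightarrow> A \<eta> v = A \<theta> v"
  shows "m * norm (\<eta> - \<theta>) \<le> L * norm (\<eta> - v)"
proof (cases "\<eta> = \<theta>")
  case True
  then show ?thesis using L by simp
next
  case False
  have Ys: "\<theta> \<in> Y" "v \<in> Y" "v - \<theta> \<in> Yd" "v - \<theta> \<in> Y" "\<eta> - v \<in> Y"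
    using assms subspace_diff[OF Yd(1) v \<theta>] subspace_diff[OF Y] by blast+
  have "m * (norm (\<eta> - \<theta>))\<^sup>2 \<le> A \<eta> (\<eta> - \<theta>) - A \<theta> (\<eta> - \<theta>)" using A_monotone[OF \<eta> Ys(1)] .
  also have "\<dots> = (A \<eta> (\<eta> - v) - A \<theta> (\<eta> - v)) + (A \<eta> (v - \<theta>) - A \<theta> (v - \<theta>))"
    using A_diff[OF \<eta> \<eta>] A_diff[OF \<eta> Ys(2)] A_diff[OF Ys(1) \<eta>] A_diff[OF Ys(1) Ys(2)] Ys(1,2) by simp
  also have "\<dots> = A \<eta> (\<eta> - v) - A \<theta> (\<eta> - v)" using eq[OF Ys(3)] by simp
  also have "\<dots> \<le> L * norm (\<eta> - \<theta>) * norm (\<eta> - v)" using A_lipschitz[OF \<eta> Ys(1) Ys(5)] by linarith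
  finally have "norm (\<eta> - \<theta>) * (m * norm (\<eta> - \<theta>)) \<le> norm (\<eta> - \<theta>) * (L * norm (\<eta> - v))"
    by (simp add: power2_eq_square ac_simps)
  then show ?thesis using False by simp
qed

lemma continuous_dependence:
  assumes \<eta>: "\<eta> \<in> Y" "\<eta>' \<in> Y" and x: "x \<in> Xd" "x' \<in> Xd"
    and eq: "\<And>v. v \<in> Y \<Longrightarrow> A \<eta> v = l v - D x v" "\<And>v. v \<in> Y \<Longrightarrow> A \<eta>' v = l v - D x' v"
  shows "m * norm (\<eta> - \<eta>') \<le> K\<^sub>D * norm (x - x')"
proof (cases "\<eta> = \<eta>'")
  case True
  then show ?thesis using nonneg by simp
next
  case False
  have d: "\<eta> - \<eta>' \<in> Y" using \<eta> subspace_diff[OF Y] by blast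
  have "m * (norm (\<eta> - \<eta>'))\<^sup>2 \<le> A \<eta> (\<eta> - \<eta>') - A \<eta>' (\<eta> - \<eta>')" using A_monotone[OF \<eta>] .
  also have "\<dots> = - D (x - x') (\<eta> - \<eta>')" using eq d D_diff_left[OF x d] by simp
  also have "\<dots> \<le> K\<^sub>D * norm (x - x') * norm (\<eta> - \<eta>')"
    using D_bound[OF subspace_diff[OF Xd(1) x] d] by linarith
  finally have "norm (\<eta> - \<eta>') * (m * norm (\<eta> - \<eta>')) \<le> norm (\<eta> - \<eta>') * (K\<^sub>D * norm (x - x'))"
    by (simp add: power2_eq_square ac_simps)
  then show ?thesis using False by simp
qed

definition discrete_solution :: "'y set \<Rightarrow> 'y \<Rightarrow> 'y \<Rightarrow> 'y \<Rightarrow> bool" where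
  "discrete_solution Yd \<theta> x \<eta> \<longleftrightarrow> subspace Yd \<and> Yd \<subseteq> Y \<and> Xd \<subseteq> Yd \<and> \<theta> \<in> Yd \<and> x \<in> Xd \<and> \<eta> \<in> Y \<and>
    (\<forall>v\<in>Yd. A \<theta> v + D x v = l v) \<and>
    (\<forall>w\<in>Xd. D w \<theta> - (A x w + \<gamma>' x \<bullet> \<gamma>' w) = - (l w + u\<^sub>0 \<bullet> \<gamma> w)) \<and>
    (\<forall>v\<in>Y. A \<eta> v = l v - D x v)"

text \<open>The sequence \<open>\<eta>\<close> is Cauchy, since it depends Lipschitz continuously on the convergent sequence
  \<open>x\<close>. Therefore an approximation from some \<open>Ys k\<close> to one late member \<open>\<eta> N\<close> is a good approximation
  to all later members.\<close>

lemma discrete_solution_error_tendsto_0: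
  assumes sol: "\<And>n. discrete_solution (Yd n) (\<theta> n) (x n) (\<eta> n)"
    and x: "x \<longlonglongrightarrow> z"
    and Ys: "\<And>n k. k \<le> n \<Longrightarrow> Ys k \<subseteq> Yd n" "Y \<subseteq> closure (\<Union>k::nat. Ys k)"
  shows "(\<lambda>n. norm (\<eta> n - \<theta> n)) \<longlonglongrightarrow> 0"
proof -
  have S: "subspace (Yd n)" "Yd n \<subseteq> Y" "\<theta> n \<in> Yd n" "x n \<in> Xd" "\<eta> n \<in> Y"
    "\<And>v. v \<in> Yd n \<Longrightarrow> A (\<eta> n) v = A (\<theta> n) v" "\<And>v. v \<in> Y \<Longrightarrow> A (\<eta> n) v = l v - D (x n) v" for n
  proof -
    show "A (\<eta> n) v = A (\<theta> n) v" if v: "v \<in> Yd n" for v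
    proof -
      have "A (\<eta> n) v = l v - D (x n) v" "A (\<theta> n) v + D (x n) v = l v"
        using sol[of n] v unfolding discrete_solution_def by blast+
      then show ?thesis by simp
    qed
  qed (use sol[of n] in \<open>simp_all add: discrete_solution_def\<close>)
  show ?thesis
  proof (rule LIMSEQ_I)
    fix e :: real assume e: "e > 0"
    \<comment> \<open>\<open>e2\<close> keeps \<open>\<eta> n\<close> within \<open>e1\<close> of \<open>\<eta> N\<close>, and the distance \<open>2 e1\<close> of \<open>\<eta> n\<close> from \<open>Yd n\<close> yields an error below \<open>e\<close>\<close>
    define e1 where "e1 = e * m / (4 * L)"
    define e2 where "e2 = e1 * m / (K\<^sub>D + 1)"
    have e1: "e1 > 0" using e m L by (simp add: e1_def)
    have e2: "e2 > 0" using e1 m nonneg by (simp add: e2_def)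
    obtain N where N: "\<And>n. n \<ge> N \<Longrightarrow> norm (x n - x N) < e2"
      using LIMSEQ_imp_Cauchy[OF x] e2 unfolding Cauchy_iff by blast
    have "\<eta> N \<in> closure (\<Union>k. Ys k)" using S(5) Ys(2) by blast
    then obtain v where "v \<in> (\<Union>k. Ys k)" "dist v (\<eta> N) < e1" using e1 unfolding closure_approachable by blast
    then obtain k where v: "v \<in> Ys k" "norm (\<eta> N - v) < e1" by (auto simp: dist_norm norm_minus_commute)
    show "\<exists>n0. \<forall>n\<ge>n0. norm (norm (\<eta> n - \<theta> n) - 0) < e"
    proof (intro exI[of _ "max N k"] allI impI)
      fix n assume n: "n \<ge> max N k"
      have "m * norm (\<eta> n - \<eta> N) \<le> K\<^sub>D * norm (x n - x N)"
        by (rule continuous_dependence[OF S(5) S(5) S(4) S(4) S(7) S(7)])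
      also have "\<dots> \<le> (K\<^sub>D + 1) * e2" using N[of n] n nonneg by (intro mult_mono) auto
      also have "\<dots> = m * e1" using nonneg by (simp add: e2_def field_simps)
      finally have 1: "norm (\<eta> n - \<eta> N) \<le> e1" using m by simp
      have "v \<in> Yd n" using v(1) Ys(1)[of k n] n by auto
      from quasi_optimality[OF S(3) S(5) S(1,2) this S(6)]
      have "m * norm (\<eta> n - \<theta> n) \<le> L * norm (\<eta> n - v)" .
      also have "norm (\<eta> n - v) \<le> norm (\<eta> n - \<eta> N) + norm (\<eta> N - v)"
        using norm_triangle_ineq[of "\<eta> n - \<eta> N" "\<eta> N - v"] by simp
      then have "L * norm (\<eta> n - v) \<le> L * (2 * e1)"
        using 1 v(2) L by (intro mult_left_mono) auto
      also have "\<dots> < m * e" using L m e by (simp add: e1_def)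
      finally show "norm (norm (\<eta> n - \<theta> n) - 0) < e" using m by simp
    qed
  qed
qed

text \<open>Otherwise a sequence of discrete solutions with ever larger \<open>Y\<^sub>d\<close> has a limit in \<open>X\<^sub>d\<close>, because
  \<open>X\<^sub>d\<close> is finite dimensional; the violated inequality and the convergence of the Galerkin
  approximations turn this limit into an exact solution.\<close>

lemma eventually_error_small:
  assumes no_solution: "\<And>z. z \<in> Xd \<Longrightarrow> (\<And>v. v \<in> Y \<Longrightarrow> D z v + A z v = l v) \<Longrightarrow> \<gamma> z \<noteq> u\<^sub>0"
    and Ys_mono: "\<And>i k. i \<le> k \<Longrightarrow> Ys i \<subseteq> Ys k" and Ys_dense: "Y \<subseteq> closure (\<Union>i::nat. Ys i)"
    and \<rho>: "\<rho> > 0" and C: "C > 0"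
  shows "\<forall>\<^sub>F i in sequentially. \<forall>Yd \<theta> x \<eta>. discrete_solution Yd \<theta> x \<eta> \<and> Ys i \<subseteq> Yd \<longrightarrow>
    norm (\<eta> - \<theta>) \<le> \<rho> * (norm (\<theta> - x) + C * norm (u\<^sub>0 - \<gamma> x))"
proof (rule ccontr)
  let ?bad = "\<lambda>Yd \<theta> x \<eta>. norm (\<eta> - \<theta>) > \<rho> * (norm (\<theta> - x) + C * norm (u\<^sub>0 - \<gamma> x))"
  assume "\<not> ?thesis"
  then have *: "\<exists>i\<ge>n. \<exists>Yd \<theta> x \<eta>. discrete_solution Yd \<theta> x \<eta> \<and> Ys i \<subseteq> Yd \<and> ?bad Yd \<theta> x \<eta>" for n
    unfolding eventually_sequentially not_le[symmetric] by blast
  have "\<forall>n. \<exists>Yd \<theta> x \<eta>. discrete_solution Yd \<theta> x \<eta> \<and> Ys n \<subseteq> Yd \<and> ?bad Yd \<theta> x \<eta>"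
  proof
    fix n
    obtain i Yd \<theta> x \<eta> where "i \<ge> n" "discrete_solution Yd \<theta> x \<eta>" "Ys i \<subseteq> Yd" "?bad Yd \<theta> x \<eta>"
      using *[of n] by blast
    moreover from this Ys_mono[of n i] have "Ys n \<subseteq> Yd" by simp
    ultimately show "\<exists>Yd \<theta> x \<eta>. discrete_solution Yd \<theta> x \<eta> \<and> Ys n \<subseteq> Yd \<and> ?bad Yd \<theta> x \<eta>" by blast
  qed
  then obtain Yd \<theta> x \<eta> where bad: "\<And>n. discrete_solution (Yd n) (\<theta> n) (x n) (\<eta> n)" "\<And>n. Ys n \<subseteq> Yd n"
      "\<And>n. norm (\<eta> n - \<theta> n) > \<rho> * (norm (\<theta> n - x n) + C * norm (u\<^sub>0 - \<gamma> (x n)))"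
    by metis
  have "norm (x n) \<le> 2 * (K + norm u\<^sub>0 * K\<^sub>0) / m" for n
  proof (rule a_priori_bound)
    have sol: "Yd n \<subseteq> Y" "Xd \<subseteq> Yd n" "\<theta> n \<in> Yd n" "x n \<in> Xd"
      using bad(1)[of n] by (simp_all add: discrete_solution_def)
    then show "\<theta> n \<in> Y" "x n \<in> Xd" by blast+
    show "A (\<theta> n) (\<theta> n) + D (x n) (\<theta> n) = l (\<theta> n)"
      using bad(1)[of n] sol by (simp add: discrete_solution_def)
    show "D (x n) (\<theta> n) - (A (x n) (x n) + \<gamma>' (x n) \<bullet> \<gamma>' (x n)) = - (l (x n) + u\<^sub>0 \<bullet> \<gamma> (x n))"
      using bad(1)[of n] sol by (simp add: discrete_solution_def)
  qed
  then have "bounded (range x)" unfolding bounded_iff by blast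
  moreover have xXd: "x n \<in> Xd" for n using bad(1)[of n] by (simp add: discrete_solution_def)
  ultimately obtain z r where z: "z \<in> Xd" "strict_mono r" "(x \<circ> r) \<longlonglongrightarrow> z"
    using Xd_subsequence[of x] by blast
  define e where "e n = norm (\<eta> (r n) - \<theta> (r n))" for n
  have Ysr: "Ys k \<subseteq> Yd (r n)" if "k \<le> n" for k n
  proof -
    have "k \<le> r n" using that seq_suble[OF z(2), of n] by simp
    then have "Ys k \<subseteq> Ys (r n)" by (rule Ys_mono)
    then show ?thesis using bad(2)[of "r n"] by simp
  qed
  have xr: "(\<lambda>n. x (r n)) \<longlonglongrightarrow> z" using z(3) by (simp add: o_def)
  have e0: "e \<longlonglongrightarrow> 0" unfolding e_def
    by (rule discrete_solution_error_tendsto_0[OF bad(1) xr Ysr Ys_dense])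
  have eb: "\<rho> * (norm (\<theta> (r n) - x (r n)) + C * norm (u\<^sub>0 - \<gamma> (x (r n)))) \<le> e n" for n
    using bad(3)[of "r n"] by (simp add: e_def)
  have c1: "(\<lambda>n. \<theta> (r n) - x (r n)) \<longlonglongrightarrow> 0"
  proof (rule Lim_null_comparison)
    have "norm (\<theta> (r n) - x (r n)) \<le> e n / \<rho>" for n
    proof -
      have "0 \<le> \<rho> * (C * norm (u\<^sub>0 - \<gamma> (x (r n))))" using \<rho> C by simp
      then have "\<rho> * norm (\<theta> (r n) - x (r n)) \<le> e n"
        using eb[of n] unfolding distrib_left by linarith
      then show ?thesis using \<rho> by (simp add: field_simps)
    qed
    then show "\<forall>\<^sub>F n in sequentially. norm (\<theta> (r n) - x (r n)) \<le> e n / \<rho>" by simp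
    show "(\<lambda>n. e n / \<rho>) \<longlonglongrightarrow> 0" using tendsto_divide_zero[OF e0] .
  qed
  have c2: "(\<lambda>n. u\<^sub>0 - \<gamma> (x (r n))) \<longlonglongrightarrow> 0"
  proof (rule Lim_null_comparison)
    have "norm (u\<^sub>0 - \<gamma> (x (r n))) \<le> e n / (\<rho> * C)" for n
    proof -
      have "0 \<le> \<rho> * norm (\<theta> (r n) - x (r n))" using \<rho> by simp
      then have "\<rho> * (C * norm (u\<^sub>0 - \<gamma> (x (r n)))) \<le> e n"
        using eb[of n] unfolding distrib_left by linarith
      then show ?thesis using \<rho> C by (simp add: field_simps)
    qed
    then show "\<forall>\<^sub>F n in sequentially. norm (u\<^sub>0 - \<gamma> (x (r n))) \<le> e n / (\<rho> * C)" by simp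
    show "(\<lambda>n. e n / (\<rho> * C)) \<longlonglongrightarrow> 0" using tendsto_divide_zero[OF e0] .
  qed
  have xz: "(\<lambda>n. norm (x (r n) - z)) \<longlonglongrightarrow> 0"
    using xr by (simp add: LIM_zero tendsto_norm_zero)
  have "(\<lambda>n. \<gamma> (x (r n)) - \<gamma> z) \<longlonglongrightarrow> 0"
  proof (rule Lim_null_comparison)
    show "\<forall>\<^sub>F n in sequentially. norm (\<gamma> (x (r n)) - \<gamma> z) \<le> K\<^sub>0 * norm (x (r n) - z)"
      using \<gamma>_bound[OF subspace_diff[OF Xd(1) xXd z(1)]] unfolding \<gamma>_diff[OF xXd z(1)] by simp
    show "(\<lambda>n. K\<^sub>0 * norm (x (r n) - z)) \<longlonglongrightarrow> 0" using tendsto_mult_right_zero[OF xz] .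
  qed
  from tendsto_add[OF c2 this] have "(\<lambda>n. u\<^sub>0 - \<gamma> z) \<longlonglongrightarrow> 0" by simp
  then have "\<gamma> z = u\<^sub>0" by (simp add: LIMSEQ_const_iff)
  moreover have "D z v + A z v = l v" if v: "v \<in> Y" for v
  proof -
    have "(\<lambda>n. \<eta> (r n) - \<theta> (r n)) \<longlonglongrightarrow> 0" using e0 unfolding e_def by (rule tendsto_norm_zero_cancel)
    from tendsto_add[OF tendsto_add[OF this c1] xr] have "(\<lambda>n. \<eta> (r n)) \<longlonglongrightarrow> z" by simp
    then have \<eta>z: "(\<lambda>n. norm (\<eta> (r n) - z)) \<longlonglongrightarrow> 0" by (simp add: LIM_zero tendsto_norm_zero)
    have \<eta>Y: "\<eta> n \<in> Y" "A (\<eta> n) v = l v - D (x n) v" for n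
      using bad(1)[of n] v by (simp_all add: discrete_solution_def)
    have zY: "z \<in> Y" using z(1) Xd by blast
    have "(\<lambda>n. A (\<eta> (r n)) v - A z v) \<longlonglongrightarrow> 0"
    proof (rule Lim_null_comparison)
      show "\<forall>\<^sub>F n in sequentially. norm (A (\<eta> (r n)) v - A z v) \<le> L * norm (\<eta> (r n) - z) * norm v"
        using A_lipschitz[OF \<eta>Y(1) zY v] by simp
      show "(\<lambda>n. L * norm (\<eta> (r n) - z) * norm v) \<longlonglongrightarrow> 0"
        using tendsto_mult_left_zero[OF tendsto_mult_right_zero[OF \<eta>z]] .
    qed
    moreover have "(\<lambda>n. D (x (r n)) v - D z v) \<longlonglongrightarrow> 0"
    proof (rule Lim_null_comparison)
      show "\<forall>\<^sub>F n in sequentially. norm (D (x (r n)) v - D z v) \<le> K\<^sub>D * norm (x (r n) - z) * norm v"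
        using D_bound[OF subspace_diff[OF Xd(1) xXd z(1)] v] D_diff_left[OF xXd z(1) v] by simp
      show "(\<lambda>n. K\<^sub>D * norm (x (r n) - z) * norm v) \<longlonglongrightarrow> 0"
        using tendsto_mult_left_zero[OF tendsto_mult_right_zero[OF xz]] .
    qed
    ultimately have "(\<lambda>n. (A (\<eta> (r n)) v - A z v) + (D (x (r n)) v - D z v)) \<longlonglongrightarrow> 0 + 0"
      by (rule tendsto_add)
    then have "(\<lambda>n. l v - A z v - D z v) \<longlonglongrightarrow> 0" by (simp add: \<eta>Y(2) algebra_simps)
    then show ?thesis by (simp add: LIMSEQ_const_iff)
  qed
  ultimately show False using no_solution[OF z(1)] by blast
qed

end

section \<open>The parabolic problem\<close>

text \<open>For the difference \<open>e\<close> of the two solutions, which has initial value zero, the energy identity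
  gives \<open>d_t e e \<ge> 0\<close>, whereas strong monotonicity gives \<open>d_t e e \<le> - m \<parallel>e\<parallel>\<^sup>2\<close>.\<close>

lemma solution_unique:
  fixes j :: "'v::real_inner \<Rightarrow> 'h::{real_inner,complete_space}"
  assumes j: "bounded_linear j" and T: "T > 0" and m: "m > 0" and mono: "strongly_monotone_op T A m"
    and u: "solves T j A l u\<^sub>0 u" and z: "solves T j A l u\<^sub>0 z"
  shows "z = u"
proof -
  have X: "z \<in> X_space T j" "u \<in> X_space T j" using u z by (simp_all add: solves_def)
  then have Y: "z \<in> Y_space T" "u \<in> Y_space T" using X_space_subset by blast+
  define e where "e = z - u"
  have e: "e = z + (- 1) *\<^sub>R u" by (simp add: e_def)
  have eX: "e \<in> X_space T j" unfolding e_def by (rule subspace_diff[OF subspace_X_space[OF j] X])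
  then have eY: "e \<in> Y_space T" using X_space_subset by blast
  have "time_trace T j 0 e = time_trace T j 0 z + (- 1) *\<^sub>R time_trace T j 0 u"
    unfolding e using T by (intro time_trace_lincomb[OF j T X]) simp
  also have "\<dots> = 0" using u z by (simp add: solves_def)
  finally have "2 * d_t T j e e = (norm (time_trace T j T e))\<^sup>2"
    using energy_identity[OF j T eX] by simp
  then have "d_t T j e e \<ge> 0" using zero_le_power2[of "norm (time_trace T j T e)"] by linarith
  moreover have "d_t T j e e = d_t T j z e - d_t T j u e"
    using d_t_lincomb[OF j X, of "- 1" e] unfolding e[symmetric] by simp
  moreover have "d_t T j z e + induced_op T A z e = l e" "d_t T j u e + induced_op T A u e = l e"
    using u z eY by (auto simp: solves_def)
  moreover have "induced_op T A z e - induced_op T A u e \<ge> m * (norm e)\<^sup>2"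
    using mono Y unfolding strongly_monotone_op_def e_def by blast
  ultimately have "m * (norm e)\<^sup>2 \<le> 0" by linarith
  then have "norm e = 0" using m by (simp add: mult_le_0_iff)
  then show ?thesis by (simp add: e_def)
qed

lemma dual_diff:
  assumes S: "subspace S" and f: "f \<in> dual S" and xy: "x \<in> S" "y \<in> S"
  shows "f (x - y) = f x - f y"
proof -
  have "f (x + (- 1) *\<^sub>R y) = f x + f ((- 1) *\<^sub>R y)"
    using f xy(1) subspace_scale[OF S xy(2)] unfolding dual_def by blast
  also have "f ((- 1) *\<^sub>R y) = - 1 * f y" using f xy(2) unfolding dual_def by blast
  finally show ?thesis by simp
qed

lemma dual_diff_closed:
  assumes f: "f \<in> dual S" and g: "g \<in> dual S"
  shows "(\<lambda>x. f x - g x) \<in> dual S"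
proof -
  obtain K where K: "\<And>x. x \<in> S \<Longrightarrow> \<bar>f x\<bar> \<le> K * norm x" using f unfolding dual_def by blast
  obtain K' where K': "\<And>x. x \<in> S \<Longrightarrow> \<bar>g x\<bar> \<le> K' * norm x" using g unfolding dual_def by blast
  have "\<bar>f x - g x\<bar> \<le> (K + K') * norm x" if "x \<in> S" for x
    using K[OF that] K'[OF that] by (simp add: distrib_right)
  then show ?thesis using f g unfolding dual_def by (auto simp: right_diff_distrib)
qed

theorem proposition6p5:
  fixes j :: "'v::{real_inner,complete_space} \<Rightarrow> 'h::{real_inner,complete_space}"
    and T L\<^sub>A m\<^sub>A \<rho> :: real
    and A :: "real \<Rightarrow> 'v \<Rightarrow> 'v \<Rightarrow>\<^sub>L real"
    and Ys :: "nat \<Rightarrow> 'v L2 set"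
    and Xd :: "'v L2 set"
    and l :: "'v L2 \<Rightarrow> real"
    and u\<^sub>0 :: 'h
    and u :: "'v L2"
  assumes triple: "gelfand_triple j"
    and T_pos: "T > 0"
    and A_maps: "maps_Y_to_dual T A"
    and L_pos: "L\<^sub>A > 0" and A_lipschitz: "lipschitz_op T A L\<^sub>A"
    and m_pos: "m\<^sub>A > 0" and A_monotone: "strongly_monotone_op T A m\<^sub>A"
    and A_zero: "\<forall>v\<in>Y_space T. induced_op T A 0 v = 0"
    and Ys_subspace: "\<forall>i. subspace (Ys i) \<and> Ys i \<subseteq> Y_space T \<and> closed (Ys i) \<and> Ys i \<noteq> {0}"
    and Ys_kind: "\<forall>i. finite_dimensional (Ys i) \<or> Ys i = Y_space T"
    and Ys_incr: "\<forall>i. Ys i \<subseteq> Ys (Suc i)"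
    and Ys_dense: "closure (\<Union>i. Ys i) = Y_space T"
    and rho_pos: "\<rho> > 0"
    and l_dual: "l \<in> dual (Y_space T)"
    and u_solves: "solves T j A l u\<^sub>0 u"
    and Xd: "finite_dimensional Xd" "Xd \<subseteq> X_space T j" "Xd \<noteq> {0}"
    and u_notin: "u \<notin> Xd"
  shows "\<forall>\<^sub>F i in sequentially. \<forall>Yd \<theta> ud \<theta>\<^sub>\<delta>.
    finite_dimensional Yd \<and> Yd \<subseteq> Y_space T \<and> Ys i \<union> Xd \<subseteq> Yd \<and>
    \<theta> \<in> Yd \<and> ud \<in> Xd \<and>
    N_op T j A Yd Xd (\<theta>, ud) =
      (restrict l Yd, restrict (\<lambda>w. - (l w + u\<^sub>0 \<bullet> time_trace T j 0 w)) Xd) \<and>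
    \<theta>\<^sub>\<delta> \<in> Y_space T \<and>
    (\<forall>v\<in>Y_space T. induced_op T A \<theta>\<^sub>\<delta> v = l v - d_t T j ud v) \<longrightarrow>
    norm (\<theta>\<^sub>\<delta> - \<theta>) \<le>
      \<rho> * (norm (\<theta> - ud) + sqrt (1 + L\<^sub>A\<^sup>2) / m\<^sub>A * norm (u\<^sub>0 - time_trace T j 0 ud))"
proof -
  have j: "bounded_linear j" using triple by (simp add: gelfand_triple_def)
  note Y = subspace_Y_space[of T]
  obtain B where B: "finite B" "Xd = span B" using Xd(1) unfolding finite_dimensional_def by blast
  have XdY: "Xd \<subseteq> Y_space T" using Xd(2) X_space_subset by blast
  have sXd: "subspace Xd" unfolding B(2) by (rule subspace_span)
  have dual_A: "induced_op T A w \<in> dual (Y_space T)" if "w \<in> Y_space T" for w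
    using A_maps that unfolding maps_Y_to_dual_def by blast
  have XdX: "x \<in> X_space T j" if "x \<in> Xd" for x using that Xd(2) by blast
  have "\<exists>G\<ge>0. \<forall>x\<in>span B. norm (time_trace T j 0 x) \<le> G * norm x"
  proof (rule span_linear_bounded[OF B(1)])
    fix x assume x: "x \<in> span B"
    then have xX: "x \<in> X_space T j" using XdX B(2) by simp
    show "time_trace T j 0 (x + c *\<^sub>R y) = time_trace T j 0 x + c *\<^sub>R time_trace T j 0 y"
      if "y \<in> span B" for y c
      using time_trace_lincomb[OF j T_pos xX] XdX[of y] that B(2) T_pos by simp
  qed
  then obtain G where G: "G \<ge> 0" "\<And>x. x \<in> Xd \<Longrightarrow> norm (time_trace T j 0 x) \<le> G * norm x"
    unfolding B(2) by blast
  have "\<exists>KD\<ge>0. \<forall>x\<in>span B. norm (weak_derivative T j x) \<le> KD * norm x"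
  proof (rule span_linear_bounded[OF B(1)])
    fix x assume x: "x \<in> span B"
    then have xX: "x \<in> X_space T j" using XdX B(2) by simp
    show "weak_derivative T j (x + c *\<^sub>R y) = weak_derivative T j x + c *\<^sub>R weak_derivative T j y"
      if "y \<in> span B" for y c
      using weak_derivative_lincomb[OF j xX] XdX[of y] that B(2) by simp
  qed
  then obtain KD where KD: "KD \<ge> 0" "\<And>x. x \<in> Xd \<Longrightarrow> norm (weak_derivative T j x) \<le> KD * norm x"
    unfolding B(2) by blast
  obtain K where K: "\<And>v. v \<in> Y_space T \<Longrightarrow> \<bar>l v\<bar> \<le> K * norm v" using l_dual unfolding dual_def by blast
  have K': "\<bar>l v\<bar> \<le> \<bar>K\<bar> * norm v" if "v \<in> Y_space T" for v
    using K[OF that] mult_right_mono[OF abs_ge_self[of K] norm_ge_zero[of v]] by linarith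
  interpret discrete: galerkin "Y_space T" Xd "induced_op T A" "d_t T j" "time_trace T j 0" "time_trace T j T" l u\<^sub>0
    L\<^sub>A m\<^sub>A "\<bar>K\<bar>" G KD
  proof (rule galerkin.intro[OF Y sXd XdY])
    show "\<exists>z\<in>Xd. \<exists>r. strict_mono r \<and> (x \<circ> r) \<longlonglongrightarrow> z" if "range x \<subseteq> Xd" "bounded (range x)"
      for x :: "nat \<Rightarrow> 'v L2"
      using span_bounded_subsequence[OF B(1)] that unfolding B(2) by blast
    show "induced_op T A w (v - v') = induced_op T A w v - induced_op T A w v'"
      if "w \<in> Y_space T" "v \<in> Y_space T" "v' \<in> Y_space T" for w v v'
      using dual_diff[OF Y dual_A] that by blast
    show "\<bar>induced_op T A w v - induced_op T A w' v\<bar> \<le> L\<^sub>A * norm (w - w') * norm v"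
      if w: "w \<in> Y_space T" "w' \<in> Y_space T" and v: "v \<in> Y_space T" for w w' v
    proof -
      let ?f = "\<lambda>z. induced_op T A w z - induced_op T A w' z"
      have "\<bar>?f v\<bar> \<le> dual_norm (Y_space T) ?f * norm v"
        by (rule dual_norm_bound[OF Y dual_diff_closed[OF dual_A[OF w(1)] dual_A[OF w(2)]] v])
      also have "\<dots> \<le> L\<^sub>A * norm (w - w') * norm v"
        using A_lipschitz w unfolding lipschitz_op_def by (intro mult_right_mono) auto
      finally show ?thesis .
    qed
    show "induced_op T A w (w - w') - induced_op T A w' (w - w') \<ge> m\<^sub>A * (norm (w - w'))\<^sup>2"
      if "w \<in> Y_space T" "w' \<in> Y_space T" for w w'
      using A_monotone that unfolding strongly_monotone_op_def by blast
    show "induced_op T A 0 v = 0" if "v \<in> Y_space T" for v using A_zero that by blast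
    show "d_t T j (x - x') v = d_t T j x v - d_t T j x' v" if "x \<in> Xd" "x' \<in> Xd" for x x' v
      using d_t_lincomb[OF j XdX[OF that(1)] XdX[OF that(2)], of "- 1" v] by simp
    show "\<bar>d_t T j x v\<bar> \<le> KD * norm x * norm v" if "x \<in> Xd" for x v
      unfolding d_t_eq_pairing
      using pairing_bound[of T "weak_derivative T j x" v] mult_right_mono[OF KD(2)[OF that] norm_ge_zero[of v]]
      by linarith
    show "time_trace T j 0 (x - x') = time_trace T j 0 x - time_trace T j 0 x'"
      if "x \<in> Xd" "x' \<in> Xd" for x x'
      using time_trace_lincomb[OF j T_pos XdX[OF that(1)] XdX[OF that(2)], of 0 "- 1"] T_pos by simp
  qed (use L_pos m_pos G KD K' in auto)
  have Ys_mono: "Ys i \<subseteq> Ys k" if "i \<le> k" for i k using lift_Suc_mono_le[of Ys] Ys_incr that by blast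
  have no_solution: "time_trace T j 0 z \<noteq> u\<^sub>0"
    if "z \<in> Xd" "\<And>v. v \<in> Y_space T \<Longrightarrow> d_t T j z v + induced_op T A z v = l v" for z
  proof
    assume "time_trace T j 0 z = u\<^sub>0"
    then have "solves T j A l u\<^sub>0 z" using that XdX by (simp add: solves_def)
    from solution_unique[OF j T_pos m_pos A_monotone u_solves this] show False using u_notin that(1) by simp
  qed
  have C: "sqrt (1 + L\<^sub>A\<^sup>2) / m\<^sub>A > 0" using m_pos by (simp add: add_pos_nonneg)
  have "Y_space T \<subseteq> closure (\<Union>i. Ys i)" using Ys_dense by simp
  then have "\<forall>\<^sub>F i in sequentially. \<forall>Yd \<theta> x \<eta>. discrete.discrete_solution Yd \<theta> x \<eta> \<and> Ys i \<subseteq> Yd \<longrightarrow>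
      norm (\<eta> - \<theta>) \<le> \<rho> * (norm (\<theta> - x) + sqrt (1 + L\<^sub>A\<^sup>2) / m\<^sub>A * norm (u\<^sub>0 - time_trace T j 0 x))"
    by (intro discrete.eventually_error_small Ys_mono rho_pos C no_solution)
  then show ?thesis
  proof eventually_elim
    case (elim i)
    show ?case
    proof (intro allI impI, elim conjE)
      fix Yd \<theta> ud \<theta>\<^sub>\<delta>
      assume Yd: "finite_dimensional Yd" "Yd \<subseteq> Y_space T" "Ys i \<union> Xd \<subseteq> Yd" "\<theta> \<in> Yd" "ud \<in> Xd"
        and N: "N_op T j A Yd Xd (\<theta>, ud) =
          (restrict l Yd, restrict (\<lambda>w. - (l w + u\<^sub>0 \<bullet> time_trace T j 0 w)) Xd)"
        and \<theta>\<^sub>\<delta>: "\<theta>\<^sub>\<delta> \<in> Y_space T" "\<forall>v\<in>Y_space T. induced_op T A \<theta>\<^sub>\<delta> v = l v - d_t T j ud v"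
      have N1: "restrict (\<lambda>v. induced_op T A \<theta> v + d_t T j ud v) Yd = restrict l Yd"
        and N2: "restrict (\<lambda>w. d_t T j w \<theta> - (induced_op T A ud w + time_trace T j T ud \<bullet> time_trace T j T w)) Xd
          = restrict (\<lambda>w. - (l w + u\<^sub>0 \<bullet> time_trace T j 0 w)) Xd"
        using N unfolding N_op_def by simp_all
      have "\<forall>v\<in>Yd. induced_op T A \<theta> v + d_t T j ud v = l v"
      proof
        fix v assume "v \<in> Yd"
        then show "induced_op T A \<theta> v + d_t T j ud v = l v" using fun_cong[OF N1, of v] by simp
      qed
      moreover have "\<forall>w\<in>Xd. d_t T j w \<theta> - (induced_op T A ud w + time_trace T j T ud \<bullet> time_trace T j T w)
          = - (l w + u\<^sub>0 \<bullet> time_trace T j 0 w)"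
      proof
        fix w assume "w \<in> Xd"
        then show "d_t T j w \<theta> - (induced_op T A ud w + time_trace T j T ud \<bullet> time_trace T j T w)
          = - (l w + u\<^sub>0 \<bullet> time_trace T j 0 w)" using fun_cong[OF N2, of w] by simp
      qed
      moreover have "subspace Yd"
        using Yd(1) subspace_span unfolding finite_dimensional_def by blast
      ultimately have "discrete.discrete_solution Yd \<theta> ud \<theta>\<^sub>\<delta>"
        using Yd \<theta>\<^sub>\<delta> unfolding discrete.discrete_solution_def by simp
      then show "norm (\<theta>\<^sub>\<delta> - \<theta>) \<le>
          \<rho> * (norm (\<theta> - ud) + sqrt (1 + L\<^sub>A\<^sup>2) / m\<^sub>A * norm (u\<^sub>0 - time_trace T j 0 ud))"
        using elim Yd(3) by blast
    qed
  qed
qed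

end
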